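(* Let $G$ be a compact Lie group with Laplace-Beltrami operator $\mathcal{L}$. There is a constant $C>0$ (independent of $t$ and of the initial data) such that the following holds. Let $u_0,u_1\in H^1_{\mathcal L}(G)$ and let $u\in\mathcal{C}^1([0,\infty),H^1_{\mathcal L}(G))$ be the solution to the homogeneous Cauchy problem $$\begin{cases}\partial^2_tu-\mathcal{L}u+\partial_tu-\mathcal{L}\partial_tu=0, & x\in G,\ t>0,\\ u(0,x)=u_0(x), & x\in G,\\ \partial_tu(0,x)=u_1(x), & x\in G.\end{cases}$$ Then $u$ satisfies, for every $t\geq 0$, the $L^2$-estimates $$\| u(t,\cdot)\|_{L^2( G)} \leq C\left(\| u_0\|_{L^2( G)}+\| u_1\|_{L^2( G)}\right),$$ $$\|(-\mathcal L)^{1/2} u(t,\cdot)\|_{L^2( G)}\leq C(1+t)^{-\frac{1}{2}}\left(\| u_0\|_{H^1_{\mathcal{L}}( G)}+\| u_1\|_{L^2( G)}\right),$$ $$\|\partial_tu(t,\cdot)\|_{L^2( G)}\leq C(1+t)^{-1}\left(\| u_0\|_{H^1_{\mathcal{L}}( G)}+\| u_1\|_{L^2( G)}\right),$$ $$\|\partial_t(-\mathcal L)^{1/2} u(t,\cdot)\|_{L^2( G)}\leq C(1+t)^{-\frac{3}{2}}\left(\| u_0\|_{H^1_{\mathcal{L}}( G)}+\| u_1\|_{H^1_{\mathcal{L}}( G)}\right).$$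
   Context: $\mathcal{L}$ is the Laplace-Beltrami operator on $G$ (for a bi-invariant Riemannian metric), which coincides with the Casimir element of the universal enveloping algebra of the Lie algebra of $G$; $-\mathcal L$ is non-negative. $L^2(G)$ is taken with respect to the normalized Haar measure $dx$ on $G$. Let $\widehat G$ be the unitary dual of $G$ (equivalence classes $[\xi]$ of continuous irreducible unitary representations, realized as matrix-valued maps of dimension $d_\xi$). The group Fourier transform is $\widehat f(\xi)=\int_G f(x)\xi(x)^*\,dx$. For each $[\xi]\in\widehat G$ there is $\lambda_\xi^2\ge 0$ such that all matrix coefficients satisfy $-\mathcal L\xi_{ij}=\lambda_\xi^2\xi_{ij}$, so $\widehat{\mathcal L f}(\xi)=-\lambda_\xi^2\widehat f(\xi)$. For $s>0$, $(-\mathcal L)^{s/2}$ is the operator defined spectrally, i.e. it multiplies $\widehat f(\xi)$ by $\lambda_\xi^{s}$ (with $\lambda_\xi\ge0$), and $\|(-\mathcal L)^{s/2}f\|_{L^2(G)}^2=\sum_{[\xi]\in\widehat G}d_\xi\lambda_\xi^{2s}\|\widehat f(\xi)\|_{\mathrm{HS}}^2$, where $\|\cdot\|_{\mathrm{HS}}$ is the Hilbert-Schmidt norm. The Sobolev space is $H^s_{\mathcal L}(G)=\{f\in L^2(G):(-\mathcal L)^{s/2}f\in L^2(G)\}$ with norm $\|f\|_{H^s_{\mathcal L}(G)}=\|f\|_{L^2(G)}+\|(-\mathcal L)^{s/2}f\|_{L^2(G)}$. The solution $u$ of the Cauchy problem is understood through the group Fourier transform in $x$: for each $[\xi]\in\widehat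 G$, every matrix entry of $\widehat u(t,\xi)$ solves $\partial_t^2\widehat u(t,\xi)_{kl}+(1+\lambda_\xi^2)\partial_t\widehat u(t,\xi)_{kl}+\lambda_\xi^2\widehat u(t,\xi)_{kl}=0$ for $t>0$, with $\widehat u(0,\xi)_{kl}=\widehat u_0(\xi)_{kl}$ and $\partial_t\widehat u(0,\xi)_{kl}=\widehat u_1(\xi)_{kl}$. *)

theory Defs
  imports
    "HOL-Analysis.Analysis"
    "HOL-Probability.Probability_Measure"
    "Jordan_Normal_Form.Schur_Decomposition"
begin

text \<open>
  Conventions. The group is a type of class \<^class>\<open>topological_group_add\<close>; the library has no
  multiplicative counterpart, so the (in general non-commutative) group law is written \<open>x + y\<close>,
  the inverse \<open>- x\<close> and the neutral element \<open>0\<close>. The model space of an \<open>n\<close>-dimensional manifold is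
  \<^term>\<open>Euclidean_space n\<close> (sequences of reals that vanish from index \<open>n\<close> on), so that the
  dimension is a natural number and \<open>n = 0\<close> (finite groups) is included. Elements of \<open>L\<^sup>2(G)\<close> are
  represented by functions; the norms and Fourier coefficients do not see changes on null sets.
\<close>

section \<open>Smooth functions and smooth manifolds\<close>

definition partial_deriv ::
  "nat \<Rightarrow> ((nat \<Rightarrow> real) \<Rightarrow> 'b::real_normed_vector) \<Rightarrow> (nat \<Rightarrow> real) \<Rightarrow> 'b" where
  "partial_deriv i f x = vector_derivative (\<lambda>h. f (x(i := h))) (at (x i))"

text \<open>\<open>C_k_on k n W f\<close>: \<open>f\<close> is of class \<open>C\<^sup>k\<close> on the open set \<open>W\<close> of \<^term>\<open>Euclidean_space n\<close>.\<close>

primrec C_k_on ::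
  "nat \<Rightarrow> nat \<Rightarrow> (nat \<Rightarrow> real) set \<Rightarrow> ((nat \<Rightarrow> real) \<Rightarrow> 'b::real_normed_vector) \<Rightarrow> bool" where
  "C_k_on 0 n W f \<longleftrightarrow> continuous_map (subtopology (Euclidean_space n) W) euclidean f"
| "C_k_on (Suc k) n W f \<longleftrightarrow>
     continuous_map (subtopology (Euclidean_space n) W) euclidean f \<and>
     (\<forall>i<n. (\<forall>x\<in>W. (\<lambda>h. f (x(i := h))) differentiable (at (x i))) \<and>
            C_k_on k n W (partial_deriv i f))"

definition smooth_on ::
  "nat \<Rightarrow> (nat \<Rightarrow> real) set \<Rightarrow> ((nat \<Rightarrow> real) \<Rightarrow> 'b::real_normed_vector) \<Rightarrow> bool" where
  "smooth_on n W f \<longleftrightarrow> (\<forall>k. C_k_on k n W f)"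

type_synonym 'a chart = "'a set \<times> ('a \<Rightarrow> nat \<Rightarrow> real)"

definition smooth_atlas :: "nat \<Rightarrow> 'a::topological_space chart set \<Rightarrow> bool" where
  "smooth_atlas n A \<longleftrightarrow>
     (\<Union>c\<in>A. fst c) = UNIV \<and>
     (\<forall>(U, \<phi>)\<in>A. open U \<and> openin (Euclidean_space n) (\<phi> ` U) \<and>
        homeomorphic_map (subtopology euclidean U) (subtopology (Euclidean_space n) (\<phi> ` U)) \<phi>) \<and>
     (\<forall>(U, \<phi>)\<in>A. \<forall>(V, \<psi>)\<in>A. \<forall>i<n. smooth_on n (\<phi> ` (U \<inter> V)) (\<lambda>x. \<psi> (inv_into U \<phi> x) i))"

definition smooth_map ::
  "nat \<Rightarrow> 'a::topological_space chart set \<Rightarrow> nat \<Rightarrow> 'b::topological_space chart set \<Rightarrow>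
   ('a \<Rightarrow> 'b) \<Rightarrow> bool" where
  "smooth_map m A n B F \<longleftrightarrow>
     continuous_on UNIV F \<and>
     (\<forall>(U, \<phi>)\<in>A. \<forall>(V, \<psi>)\<in>B. \<forall>i<n.
        smooth_on m (\<phi> ` (U \<inter> F -` V)) (\<lambda>x. \<psi> (F (inv_into U \<phi> x)) i))"

text \<open>The product of two atlases, the first one of dimension \<open>m\<close>; coordinates are concatenated.\<close>

definition product_atlas :: "nat \<Rightarrow> 'a chart set \<Rightarrow> 'b chart set \<Rightarrow> ('a \<times> 'b) chart set" where
  "product_atlas m A B =
     {(U \<times> V, \<lambda>(a, b) i. if i < m then \<phi> a i else \<psi> b (i - m)) | U \<phi> V \<psi>.
        (U, \<phi>) \<in> A \<and> (V, \<psi>) \<in> B}"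

definition smooth_functions :: "nat \<Rightarrow> 'a chart set \<Rightarrow> ('a \<Rightarrow> real) set" where
  "smooth_functions n A = {f. \<forall>(U, \<phi>)\<in>A. smooth_on n (\<phi> ` U) (f \<circ> inv_into U \<phi>)}"

section \<open>Compact Lie groups with a bi-invariant Riemannian metric\<close>

text \<open>Tangent vectors at \<open>p\<close> are the derivations at \<open>p\<close> of the algebra of smooth functions,
  extended by \<open>0\<close> to non-smooth functions so that they are determined as HOL functions.\<close>

type_synonym 'a tangent = "('a \<Rightarrow> real) \<Rightarrow> real"

definition tangent_space :: "nat \<Rightarrow> 'a chart set \<Rightarrow> 'a \<Rightarrow> 'a tangent set" where
  "tangent_space n A p =
     {v. (\<forall>f\<in>smooth_functions n A. \<forall>h\<in>smooth_functions n A.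
            v (\<lambda>x. f x + h x) = v f + v h \<and> v (\<lambda>x. f x * h x) = v f * h p + f p * v h) \<and>
         (\<forall>f\<in>smooth_functions n A. \<forall>c. v (\<lambda>x. c * f x) = c * v f) \<and>
         (\<forall>f. f \<notin> smooth_functions n A \<longrightarrow> v f = 0)}"

definition coord_vector ::
  "nat \<Rightarrow> 'a chart set \<Rightarrow> 'a chart \<Rightarrow> nat \<Rightarrow> 'a \<Rightarrow> 'a tangent" where
  "coord_vector n A c i p =
     (\<lambda>f. if f \<in> smooth_functions n A
          then partial_deriv i (f \<circ> inv_into (fst c) (snd c)) (snd c p) else 0)"

text \<open>The differential of a diffeomorphism \<open>F\<close> (for which \<open>f \<circ> F\<close> is smooth iff \<open>f\<close> is).\<close>

definition pushforward :: "('a \<Rightarrow> 'a) \<Rightarrow> 'a tangent \<Rightarrow> 'a tangent" where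
  "pushforward F v = (\<lambda>f. v (f \<circ> F))"

record 'a lie_data =
  lie_dim :: nat
  lie_charts :: "'a chart set"
  lie_metric :: "'a \<Rightarrow> 'a tangent \<Rightarrow> 'a tangent \<Rightarrow> real"
  haar :: "'a measure"

definition compact_lie_group :: "('a::topological_group_add) lie_data \<Rightarrow> bool" where
  "compact_lie_group G \<longleftrightarrow>
     compact (UNIV :: 'a set) \<and>
     smooth_atlas (lie_dim G) (lie_charts G) \<and>
     smooth_map (lie_dim G + lie_dim G) (product_atlas (lie_dim G) (lie_charts G) (lie_charts G))
       (lie_dim G) (lie_charts G) (\<lambda>(x, y). x + y) \<and>
     smooth_map (lie_dim G) (lie_charts G) (lie_dim G) (lie_charts G) uminus"

abbreviation lie_tangent_space :: "'a lie_data \<Rightarrow> 'a \<Rightarrow> 'a tangent set" where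
  "lie_tangent_space G \<equiv> tangent_space (lie_dim G) (lie_charts G)"

definition metric_coeff :: "'a lie_data \<Rightarrow> 'a chart \<Rightarrow> nat \<Rightarrow> nat \<Rightarrow> (nat \<Rightarrow> real) \<Rightarrow> real" where
  "metric_coeff G c i j x =
     (let p = inv_into (fst c) (snd c) x in
        lie_metric G p (coord_vector (lie_dim G) (lie_charts G) c i p)
                       (coord_vector (lie_dim G) (lie_charts G) c j p))"

definition riemannian_metric :: "'a lie_data \<Rightarrow> bool" where
  "riemannian_metric G \<longleftrightarrow>
     (\<forall>p. \<forall>v\<in>lie_tangent_space G p. \<forall>w\<in>lie_tangent_space G p.
        lie_metric G p v w = lie_metric G p w v \<and>
        (\<forall>z\<in>lie_tangent_space G p.
           lie_metric G p (\<lambda>f. v f + w f) z = lie_metric G p v z + lie_metric G p w z) \<and>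
        (\<forall>a. lie_metric G p (\<lambda>f. a * v f) w = a * lie_metric G p v w) \<and>
        (v \<noteq> (\<lambda>f. 0) \<longrightarrow> lie_metric G p v v > 0)) \<and>
     (\<forall>c\<in>lie_charts G. \<forall>i<lie_dim G. \<forall>j<lie_dim G.
        smooth_on (lie_dim G) (snd c ` fst c) (metric_coeff G c i j))"

definition bi_invariant_metric :: "('a::group_add) lie_data \<Rightarrow> bool" where
  "bi_invariant_metric G \<longleftrightarrow>
     riemannian_metric G \<and>
     (\<forall>a p. \<forall>v\<in>lie_tangent_space G p. \<forall>w\<in>lie_tangent_space G p.
        lie_metric G (a + p) (pushforward (\<lambda>x. a + x) v) (pushforward (\<lambda>x. a + x) w) =
          lie_metric G p v w \<and>
        lie_metric G (p + a) (pushforward (\<lambda>x. x + a) v) (pushforward (\<lambda>x. x + a) w) =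
          lie_metric G p v w)"

text \<open>The Laplace-Beltrami operator in local coordinates,
  \<open>|g|\<^sup>-\<^sup>1\<^sup>/\<^sup>2 \<Sum>\<^sub>i \<partial>\<^sub>i (\<Sum>\<^sub>j |g|\<^sup>1\<^sup>/\<^sup>2 g\<^sup>i\<^sup>j \<partial>\<^sub>j f)\<close>, where \<open>(g\<^sup>i\<^sup>j)\<close> is the inverse of the matrix \<open>(g\<^sub>i\<^sub>j)\<close>. The value
  does not depend on which chart around \<open>p\<close> is used.\<close>

definition laplace_beltrami :: "'a lie_data \<Rightarrow> ('a \<Rightarrow> complex) \<Rightarrow> 'a \<Rightarrow> complex" where
  "laplace_beltrami G f p =
     (let n = lie_dim G;
          c = (SOME c. c \<in> lie_charts G \<and> p \<in> fst c);
          g = (\<lambda>x. mat n n (\<lambda>(i, j). metric_coeff G c i j x));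
          w = (\<lambda>x. sqrt (Determinant.det (g x)));
          g_inv = (\<lambda>x. the (mat_inverse (g x)))
      in (1 / w (snd c p)) *\<^sub>R
         (\<Sum>i<n. partial_deriv i
            (\<lambda>x. \<Sum>j<n. (w x * g_inv x $$ (i, j)) *\<^sub>R
               partial_deriv j (f \<circ> inv_into (fst c) (snd c)) x) (snd c p)))"

text \<open>On a compact group the left-invariant Borel probability measure is unique.\<close>

definition normalized_haar :: "('a::topological_group_add) measure \<Rightarrow> bool" where
  "normalized_haar \<mu> \<longleftrightarrow>
     prob_space \<mu> \<and> sets \<mu> = sets borel \<and> (\<forall>a. distr \<mu> \<mu> (\<lambda>x. a + x) = \<mu>)"

definition L2 :: "'a lie_data \<Rightarrow> ('a \<Rightarrow> complex) set" where
  "L2 G = {f \<in> borel_measurable (haar G). integrable (haar G) (\<lambda>x. (cmod (f x))\<^sup>2)}"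

definition L2_norm :: "'a lie_data \<Rightarrow> ('a \<Rightarrow> complex) \<Rightarrow> real" where
  "L2_norm G f = sqrt (\<integral>x. (cmod (f x))\<^sup>2 \<partial>haar G)"

section \<open>The unitary dual and the group Fourier transform\<close>

definition unitary_mat :: "nat \<Rightarrow> complex mat \<Rightarrow> bool" where
  "unitary_mat d T \<longleftrightarrow> T \<in> carrier_mat d d \<and> T * mat_adjoint T = 1\<^sub>m d \<and> mat_adjoint T * T = 1\<^sub>m d"

definition rep_dim :: "('a::zero \<Rightarrow> complex mat) \<Rightarrow> nat" where
  "rep_dim \<xi> = dim_row (\<xi> 0)"

definition unitary_rep :: "('a::topological_group_add \<Rightarrow> complex mat) \<Rightarrow> bool" where
  "unitary_rep \<xi> \<longleftrightarrow>
     (\<forall>x. unitary_mat (rep_dim \<xi>) (\<xi> x)) \<and>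
     (\<forall>x y. \<xi> (x + y) = \<xi> x * \<xi> y) \<and>
     (\<forall>i<rep_dim \<xi>. \<forall>j<rep_dim \<xi>. continuous_on UNIV (\<lambda>x. \<xi> x $$ (i, j)))"

definition irreducible_rep :: "('a::zero \<Rightarrow> complex mat) \<Rightarrow> bool" where
  "irreducible_rep \<xi> \<longleftrightarrow>
     rep_dim \<xi> > 0 \<and>
     (\<forall>W. VectorSpace.subspace class_ring W (module_vec TYPE(complex) (rep_dim \<xi>)) \<and>
          (\<forall>x. \<forall>v\<in>W. \<xi> x *\<^sub>v v \<in> W) \<longrightarrow>
          W = {0\<^sub>v (rep_dim \<xi>)} \<or> W = carrier_vec (rep_dim \<xi>))"

definition irreps :: "('a::topological_group_add \<Rightarrow> complex mat) set" where
  "irreps = {\<xi>. unitary_rep \<xi> \<and> irreducible_rep \<xi>}"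

definition rep_equiv ::
  "(('a::topological_group_add \<Rightarrow> complex mat) \<times> ('a \<Rightarrow> complex mat)) set" where
  "rep_equiv =
     {(\<xi>, \<eta>). \<xi> \<in> irreps \<and> \<eta> \<in> irreps \<and> rep_dim \<xi> = rep_dim \<eta> \<and>
        (\<exists>T. unitary_mat (rep_dim \<xi>) T \<and> (\<forall>x. T * \<xi> x = \<eta> x * T))}"

definition unitary_dual :: "('a::topological_group_add \<Rightarrow> complex mat) set set" where
  "unitary_dual = irreps // rep_equiv"

text \<open>The chosen representative \<open>\<xi>\<close> of a class \<open>[\<xi>]\<close>.\<close>

definition repr :: "('a \<Rightarrow> complex mat) set \<Rightarrow> 'a \<Rightarrow> complex mat" where
  "repr \<kappa> = (SOME \<xi>. \<xi> \<in> \<kappa>)"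

definition fourier ::
  "('a::zero) lie_data \<Rightarrow> ('a \<Rightarrow> complex) \<Rightarrow> ('a \<Rightarrow> complex mat) \<Rightarrow> complex mat" where
  "fourier G f \<xi> =
     mat (rep_dim \<xi>) (rep_dim \<xi>) (\<lambda>(i, j). \<integral>x. f x * (mat_adjoint (\<xi> x) $$ (i, j)) \<partial>haar G)"

text \<open>\<open>\<lambda>\<^sub>\<xi>\<close> is the nonnegative square root of the eigenvalue of \<open>-\<L>\<close> shared by the matrix
  coefficients of \<open>\<xi>\<close>.\<close>

definition lap_root :: "('a::zero) lie_data \<Rightarrow> ('a \<Rightarrow> complex mat) \<Rightarrow> real" where
  "lap_root G \<xi> =
     (THE l. l \<ge> 0 \<and>
        (\<forall>i<rep_dim \<xi>. \<forall>j<rep_dim \<xi>. \<forall>x.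
           - laplace_beltrami G (\<lambda>y. \<xi> y $$ (i, j)) x = complex_of_real (l\<^sup>2) * \<xi> x $$ (i, j)))"

section \<open>Fractional powers and Sobolev spaces\<close>

text \<open>\<open>is_frac_lap G s f h\<close>: \<open>h \<in> L\<^sup>2(G)\<close> is \<open>(-\<L>)\<^sup>s\<^sup>/\<^sup>2 f\<close>. Such an \<open>h\<close> is determined by its
  Fourier coefficients up to null sets.\<close>

definition is_frac_lap ::
  "('a::topological_group_add) lie_data \<Rightarrow> real \<Rightarrow> ('a \<Rightarrow> complex) \<Rightarrow> ('a \<Rightarrow> complex) \<Rightarrow> bool" where
  "is_frac_lap G s f h \<longleftrightarrow>
     h \<in> L2 G \<and>
     (\<forall>\<kappa>\<in>unitary_dual. fourier G h (repr \<kappa>) =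
        complex_of_real (lap_root G (repr \<kappa>) powr s) \<cdot>\<^sub>m fourier G f (repr \<kappa>))"

definition frac_lap ::
  "('a::topological_group_add) lie_data \<Rightarrow> real \<Rightarrow> ('a \<Rightarrow> complex) \<Rightarrow> 'a \<Rightarrow> complex" where
  "frac_lap G s f = (SOME h. is_frac_lap G s f h)"

definition sobolev ::
  "('a::topological_group_add) lie_data \<Rightarrow> real \<Rightarrow> ('a \<Rightarrow> complex) set" where
  "sobolev G s = {f \<in> L2 G. \<exists>h. is_frac_lap G s f h}"

definition sobolev_norm ::
  "('a::topological_group_add) lie_data \<Rightarrow> real \<Rightarrow> ('a \<Rightarrow> complex) \<Rightarrow> real" where
  "sobolev_norm G s f = L2_norm G f + L2_norm G (frac_lap G s f)"

section \<open>Differentiable curves in function spaces and the Cauchy problem\<close>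

text \<open>Curves \<open>[0,\<infinity>) \<rightarrow> X\<close> into a space \<open>X\<close> of functions with (semi)norm \<open>N\<close>; the derivative at
  \<open>t = 0\<close> is one-sided.\<close>

definition has_curve_deriv ::
  "(('a \<Rightarrow> complex) \<Rightarrow> real) \<Rightarrow> (real \<Rightarrow> 'a \<Rightarrow> complex) \<Rightarrow> ('a \<Rightarrow> complex) \<Rightarrow> real \<Rightarrow> bool" where
  "has_curve_deriv N f v t \<longleftrightarrow>
     ((\<lambda>s. N (\<lambda>x. f s x - f t x - complex_of_real (s - t) * v x) / \<bar>s - t\<bar>) \<longlongrightarrow> 0) (at t within {0..})"

definition curve_deriv ::
  "('a \<Rightarrow> complex) set \<Rightarrow> (('a \<Rightarrow> complex) \<Rightarrow> real) \<Rightarrow> (real \<Rightarrow> 'a \<Rightarrow> complex) \<Rightarrow>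
   real \<Rightarrow> 'a \<Rightarrow> complex" where
  "curve_deriv X N f t = (SOME v. v \<in> X \<and> has_curve_deriv N f v t)"

definition C1_curve ::
  "('a \<Rightarrow> complex) set \<Rightarrow> (('a \<Rightarrow> complex) \<Rightarrow> real) \<Rightarrow> (real \<Rightarrow> 'a \<Rightarrow> complex) \<Rightarrow> bool" where
  "C1_curve X N f \<longleftrightarrow>
     (\<exists>f'. \<forall>t\<ge>0. f t \<in> X \<and> f' t \<in> X \<and> has_curve_deriv N f (f' t) t \<and>
        ((\<lambda>s. N (\<lambda>x. f' s x - f' t x)) \<longlongrightarrow> 0) (at t within {0..}))"

text \<open>The equation \<open>\<partial>\<^sub>t\<^sup>2 u - \<L> u + \<partial>\<^sub>t u - \<L> \<partial>\<^sub>t u = 0\<close> with data \<open>u\<^sub>0\<close>, \<open>u\<^sub>1\<close>, understood through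
  the group Fourier transform in \<open>x\<close>.\<close>

definition cauchy_solution ::
  "('a::topological_group_add) lie_data \<Rightarrow> ('a \<Rightarrow> complex) \<Rightarrow> ('a \<Rightarrow> complex) \<Rightarrow>
   (real \<Rightarrow> 'a \<Rightarrow> complex) \<Rightarrow> bool" where
  "cauchy_solution G u0 u1 u \<longleftrightarrow>
     (\<forall>\<kappa>\<in>unitary_dual. \<forall>k<rep_dim (repr \<kappa>). \<forall>l<rep_dim (repr \<kappa>).
        let v = (\<lambda>t. fourier G (u t) (repr \<kappa>) $$ (k, l));
            m = complex_of_real ((lap_root G (repr \<kappa>))\<^sup>2)
        in v 0 = fourier G u0 (repr \<kappa>) $$ (k, l) \<and>
           (\<exists>v'. (\<forall>t\<ge>0. (v has_vector_derivative v' t) (at t within {0..})) \<and>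
                 v' 0 = fourier G u1 (repr \<kappa>) $$ (k, l) \<and>
                 (\<forall>t>0. \<exists>v''. (v' has_vector_derivative v'') (at t) \<and>
                              v'' + (1 + m) * v' t + m * v t = 0)))"

end

theory Submission
  imports Defs "Jordan_Normal_Form.Spectral_Radius"
begin

text \<open>
  The group Fourier transform turns the equation into one ordinary differential equation per matrix
  coefficient, \<open>v'' + (1 + m) v' + m v = 0\<close> with \<open>m = \<lambda>\<^sub>\<xi>\<^sup>2\<close>, which factors as \<open>(\<partial> + 1)(\<partial> + m) v = 0\<close>.
  Hence \<open>v\<close> and \<open>v'\<close> are explicit combinations of the data, \<open>exp (- t)\<close> and the kernel
  \<open>K(t) = \<integral>\<^sub>0\<^sup>t exp (- m (t - s)) exp (- s) ds\<close> (lemma \<open>mode_solution\<close>). For small \<open>m\<close> the kernel is at most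
  \<open>2 exp (- m t)\<close>, so each factor \<open>m\<^sup>1\<^sup>/\<^sup>2\<close> in front of it gains \<open>(1 + t)\<^sup>-\<^sup>1\<^sup>/\<^sup>2\<close>; for \<open>m\<close> away from \<open>0\<close> the
  product \<open>m K\<close> decays exponentially, uniformly in \<open>m\<close>. This yields the four estimates for a single
  mode with constants that are uniform in \<open>m \<ge> 0\<close> (lemma \<open>mode_bounds\<close>).

  Passing from modes to \<open>L\<^sup>2\<close>-norms requires that the \<open>L\<^sup>2\<close>-norm is a monotone function of the moduli of
  the coefficients (theorem \<open>nrm_le_if_coefficients_le\<close>), that is, the Peter-Weyl theorem: the matrix
  coefficients of the irreducible unitary representations form a complete orthogonal system.
  Orthogonality is Schur's lemma. Completeness is proved without spectral theory: if all coefficients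
  of a continuous \<open>g \<noteq> 0\<close> vanish, form the convolution powers of \<open>F = g\<^sup>* * g\<close>. Their squared norms
  are a log-convex and submultiplicative sequence, which makes the normalized powers of suitable even
  order converge uniformly to a nonzero idempotent \<open>p = p * p\<close> (lemma \<open>idempotent_limit\<close>).
  The functions \<open>h = p * h\<close> form a finite-dimensional space that is invariant under right translations,
  and a minimal invariant subspace of it is spanned by matrix coefficients of an irreducible
  representation (lemma \<open>irrep_in_inv_space\<close>). But all coefficients of \<open>p\<close>, and therefore those of
  \<open>p * h\<close>, vanish like those of \<open>g\<close>, a contradiction. Square-integrable functions are reduced to
  continuous ones by convolution.

  Since \<open>H\<^sup>1\<close>-derivatives are in particular \<open>L\<^sup>2\<close>-derivatives, the coefficients of the time derivatives
  in the statement are the derivatives of the coefficients, and the mode bounds apply to them.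
\<close>

section \<open>The Hilbert space of square-integrable functions\<close>

definition sq_int :: "'a measure \<Rightarrow> ('a \<Rightarrow> complex) set" where
  "sq_int M = {f \<in> borel_measurable M. integrable M (\<lambda>x. (cmod (f x))\<^sup>2)}"

definition ip :: "'a measure \<Rightarrow> ('a \<Rightarrow> complex) \<Rightarrow> ('a \<Rightarrow> complex) \<Rightarrow> complex" where
  "ip M f g = (\<integral>x. f x * cnj (g x) \<partial>M)"

definition nrm :: "'a measure \<Rightarrow> ('a \<Rightarrow> complex) \<Rightarrow> real" where
  "nrm M f = sqrt (\<integral>x. (cmod (f x))\<^sup>2 \<partial>M)"

lemma borel_measurable_cnj [measurable]:
  "f \<in> borel_measurable M \<Longrightarrow> (\<lambda>x. cnj (f x)) \<in> borel_measurable M"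
  by (erule measurable_compose) (intro borel_measurable_continuous_onI continuous_on_cnj continuous_on_id)

lemma sq_int_measurable [measurable_dest]: "f \<in> sq_int M \<Longrightarrow> f \<in> borel_measurable M"
  by (simp add: sq_int_def)

lemma integrable_sq_int: "f \<in> sq_int M \<Longrightarrow> integrable M (\<lambda>x. (cmod (f x))\<^sup>2)"
  by (simp add: sq_int_def)

lemma integrable_ip:
  assumes "f \<in> sq_int M" "g \<in> sq_int M"
  shows "integrable M (\<lambda>x. f x * cnj (g x))"
proof (rule Bochner_Integration.integrable_bound)
  show "integrable M (\<lambda>x. (cmod (f x))\<^sup>2 + (cmod (g x))\<^sup>2)"
    using assms by (intro Bochner_Integration.integrable_add integrable_sq_int)
  show "(\<lambda>x. f x * cnj (g x)) \<in> borel_measurable M"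
    using assms[THEN sq_int_measurable] by measurable
  show "AE x in M. norm (f x * cnj (g x)) \<le> norm ((cmod (f x))\<^sup>2 + (cmod (g x))\<^sup>2)"
  proof (rule AE_I2)
    fix x
    have "2 * (cmod (f x) * cmod (g x)) \<le> (cmod (f x))\<^sup>2 + (cmod (g x))\<^sup>2"
      using sum_squares_bound[of "cmod (f x)" "cmod (g x)"] by simp
    moreover have "0 \<le> cmod (f x) * cmod (g x)" by simp
    ultimately have "cmod (f x) * cmod (g x) \<le> (cmod (f x))\<^sup>2 + (cmod (g x))\<^sup>2" by linarith
    then show "norm (f x * cnj (g x)) \<le> norm ((cmod (f x))\<^sup>2 + (cmod (g x))\<^sup>2)"
      by (simp add: norm_mult)
  qed
qed

lemma zero_sq_int: "(\<lambda>x. 0) \<in> sq_int M"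
  by (simp add: sq_int_def)

lemma scale_sq_int:
  assumes "f \<in> sq_int M" shows "(\<lambda>x. c * f x) \<in> sq_int M"
  using assms by (auto simp: sq_int_def norm_mult power_mult_distrib)

lemma add_sq_int:
  assumes f: "f \<in> sq_int M" and g: "g \<in> sq_int M"
  shows "(\<lambda>x. f x + g x) \<in> sq_int M"
proof -
  have "integrable M (\<lambda>x. (cmod (f x + g x))\<^sup>2)"
  proof (rule Bochner_Integration.integrable_bound)
    show "integrable M (\<lambda>x. 2 * (cmod (f x))\<^sup>2 + 2 * (cmod (g x))\<^sup>2)"
      using assms by (intro Bochner_Integration.integrable_add integrable_mult_right integrable_sq_int)
    show "(\<lambda>x. (cmod (f x + g x))\<^sup>2) \<in> borel_measurable M"
      using assms[THEN sq_int_measurable] by measurable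
    show "AE x in M. norm ((cmod (f x + g x))\<^sup>2) \<le> norm (2 * (cmod (f x))\<^sup>2 + 2 * (cmod (g x))\<^sup>2)"
    proof (rule AE_I2)
      fix x
      have "(cmod (f x + g x))\<^sup>2 \<le> (cmod (f x) + cmod (g x))\<^sup>2"
        by (intro power_mono norm_triangle_ineq) simp
      also have "\<dots> \<le> 2 * (cmod (f x))\<^sup>2 + 2 * (cmod (g x))\<^sup>2"
        using sum_squares_bound[of "cmod (f x)" "cmod (g x)"] by (simp add: power2_sum)
      finally show "norm ((cmod (f x + g x))\<^sup>2) \<le> norm (2 * (cmod (f x))\<^sup>2 + 2 * (cmod (g x))\<^sup>2)"
        by simp
    qed
  qed
  then show ?thesis
    using assms[THEN sq_int_measurable] by (auto simp: sq_int_def)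
qed

lemma diff_sq_int:
  assumes "f \<in> sq_int M" "g \<in> sq_int M"
  shows "(\<lambda>x. f x - g x) \<in> sq_int M"
  using add_sq_int[OF assms(1) scale_sq_int[OF assms(2), of "-1"]] by simp

lemma sum_sq_int:
  assumes "\<And>i. i \<in> I \<Longrightarrow> f i \<in> sq_int M"
  shows "(\<lambda>x. \<Sum>i\<in>I. c i * f i x) \<in> sq_int M"
  using assms
proof (induction I rule: infinite_finite_induct)
  case (insert j I)
  then show ?case by (simp add: add_sq_int[OF scale_sq_int])
qed (simp_all add: zero_sq_int)

lemma ip_scale_left: "ip M (\<lambda>x. c * f x) g = c * ip M f g"
  by (simp add: ip_def mult.assoc)

lemma ip_commute: "ip M g f = cnj (ip M f g)"
  unfolding ip_def Bochner_Integration.integral_cnj[symmetric] by (simp add: mult.commute)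

lemma ip_scale_right: "ip M f (\<lambda>x. c * g x) = cnj c * ip M f g"
  by (simp add: ip_commute[of M f] ip_scale_left)

lemma ip_add_left:
  "f \<in> sq_int M \<Longrightarrow> g \<in> sq_int M \<Longrightarrow> h \<in> sq_int M \<Longrightarrow>
   ip M (\<lambda>x. f x + g x) h = ip M f h + ip M g h"
  by (simp add: ip_def distrib_right integrable_ip)

lemma ip_diff_left:
  "f \<in> sq_int M \<Longrightarrow> g \<in> sq_int M \<Longrightarrow> h \<in> sq_int M \<Longrightarrow>
   ip M (\<lambda>x. f x - g x) h = ip M f h - ip M g h"
  by (simp add: ip_def left_diff_distrib integrable_ip)

lemma ip_diff_right:
  "f \<in> sq_int M \<Longrightarrow> g \<in> sq_int M \<Longrightarrow> h \<in> sq_int M \<Longrightarrow>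
   ip M h (\<lambda>x. f x - g x) = ip M h f - ip M h g"
  by (simp add: ip_commute[of M h] ip_diff_left)

lemma ip_zero_left: "ip M (\<lambda>x. 0) g = 0"
  by (simp add: ip_def)

lemma ip_sum_left:
  assumes "\<And>i. i \<in> I \<Longrightarrow> f i \<in> sq_int M" "g \<in> sq_int M"
  shows "ip M (\<lambda>x. \<Sum>i\<in>I. c i * f i x) g = (\<Sum>i\<in>I. c i * ip M (f i) g)"
  using assms
proof (induction I rule: infinite_finite_induct)
  case (insert j I)
  then show ?case
    by (simp add: ip_add_left[OF scale_sq_int sum_sq_int] ip_scale_left)
qed (auto simp: ip_zero_left)

lemma ip_sum_right:
  assumes "\<And>i. i \<in> I \<Longrightarrow> f i \<in> sq_int M" "g \<in> sq_int M"
  shows "ip M g (\<lambda>x. \<Sum>i\<in>I. c i * f i x) = (\<Sum>i\<in>I. cnj (c i) * ip M g (f i))"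
proof -
  have "ip M (\<lambda>x. \<Sum>i\<in>I. c i * f i x) g = (\<Sum>i\<in>I. c i * ip M (f i) g)"
    using assms by (rule ip_sum_left)
  then show ?thesis by (simp add: ip_commute[of M g])
qed

lemma nrm_nonneg [simp]: "0 \<le> nrm M f"
  by (simp add: nrm_def)

lemma nrm_sq: "(nrm M f)\<^sup>2 = (\<integral>x. (cmod (f x))\<^sup>2 \<partial>M)"
  by (simp add: nrm_def)

lemma ip_self: "ip M f f = complex_of_real ((nrm M f)\<^sup>2)"
  by (simp add: ip_def nrm_sq complex_mult_cnj cmod_power2 flip: integral_complex_of_real)

lemma nrm_zero [simp]: "nrm M (\<lambda>x. 0) = 0"
  by (simp add: nrm_def)

lemma nrm_scale: "nrm M (\<lambda>x. c * f x) = cmod c * nrm M f"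
  by (simp add: nrm_def norm_mult power_mult_distrib real_sqrt_mult)

lemma nrm_minus_commute: "nrm M (\<lambda>x. f x - g x) = nrm M (\<lambda>x. g x - f x)"
  by (simp add: nrm_def norm_minus_commute)

lemma nrm_eq_0_AE:
  assumes "f \<in> sq_int M"
  shows "nrm M f = 0 \<longleftrightarrow> (AE x in M. f x = 0)"
  using integral_nonneg_eq_0_iff_AE[OF integrable_sq_int[OF assms]] by (simp add: nrm_def)

lemma nrm_diff_sq:
  assumes f: "f \<in> sq_int M" and g: "g \<in> sq_int M"
  shows "(nrm M (\<lambda>x. f x - g x))\<^sup>2 = (nrm M f)\<^sup>2 + (nrm M g)\<^sup>2 - 2 * Re (ip M f g)"
proof -
  have "complex_of_real ((nrm M (\<lambda>x. f x - g x))\<^sup>2) =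
      ip M f f + ip M g g - (ip M f g + cnj (ip M f g))"
    using f g
    by (simp add: ip_self[symmetric] ip_diff_left ip_diff_right diff_sq_int ip_commute[of M g f]
        del: of_real_power)
  also have "\<dots> = complex_of_real ((nrm M f)\<^sup>2 + (nrm M g)\<^sup>2 - 2 * Re (ip M f g))"
    by (simp add: ip_self complex_add_cnj)
  finally show ?thesis by (simp only: of_real_eq_iff)
qed

lemma cauchy_schwarz:
  assumes f: "f \<in> sq_int M" and g: "g \<in> sq_int M"
  shows "cmod (ip M f g) \<le> nrm M f * nrm M g"
proof -
  have *: "2 * (cmod (ip M f g))\<^sup>2 * r \<le> (nrm M f)\<^sup>2 + (cmod (ip M f g))\<^sup>2 * r\<^sup>2 * (nrm M g)\<^sup>2" for r
  proof -
    define c where "c = complex_of_real r * ip M f g"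
    have "ip M f (\<lambda>x. c * g x) = cnj c * ip M f g"
      by (rule ip_scale_right)
    also have "\<dots> = complex_of_real (r * (cmod (ip M f g))\<^sup>2)"
      by (simp add: c_def complex_norm_square mult_ac del: of_real_power)
    finally have "ip M f (\<lambda>x. c * g x) = complex_of_real (r * (cmod (ip M f g))\<^sup>2)" .
    then have "(nrm M (\<lambda>x. f x - c * g x))\<^sup>2 =
        (nrm M f)\<^sup>2 + (cmod c * nrm M g)\<^sup>2 - 2 * (r * (cmod (ip M f g))\<^sup>2)"
      using nrm_diff_sq[OF f scale_sq_int[OF g, of c]]
      by (simp only: nrm_scale Re_complex_of_real)
    moreover have "(cmod c * nrm M g)\<^sup>2 = (cmod (ip M f g))\<^sup>2 * r\<^sup>2 * (nrm M g)\<^sup>2"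
      by (simp add: c_def norm_mult power_mult_distrib)
    moreover have "0 \<le> (nrm M (\<lambda>x. f x - c * g x))\<^sup>2" by simp
    ultimately show ?thesis by (simp add: mult_ac)
  qed
  show ?thesis
  proof (cases "nrm M g = 0")
    case True
    have "ip M f g = 0"
    proof (rule ccontr)
      assume "ip M f g \<noteq> 0"
      then show False
        using *[of "((nrm M f)\<^sup>2 + 1) / (2 * (cmod (ip M f g))\<^sup>2)"] True by simp
    qed
    then show ?thesis by simp
  next
    case False
    define a where "a = (cmod (ip M f g))\<^sup>2"
    define N where "N = (nrm M g)\<^sup>2"
    have N: "N > 0" using False by (simp add: N_def)
    have "2 * a * (1 / N) \<le> (nrm M f)\<^sup>2 + a * (1 / N)\<^sup>2 * N"
      using *[of "1 / N"] by (simp only: a_def N_def)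
    also have "a * (1 / N)\<^sup>2 * N = a * (1 / N)"
      using N by (simp add: power2_eq_square)
    finally have "a / N \<le> (nrm M f)\<^sup>2" by simp
    then have "(cmod (ip M f g))\<^sup>2 \<le> (nrm M f * nrm M g)\<^sup>2"
      using N by (simp add: pos_divide_le_eq a_def N_def power_mult_distrib)
    then show ?thesis by (rule power2_le_imp_le) simp
  qed
qed

lemma nrm_triangle:
  assumes f: "f \<in> sq_int M" and g: "g \<in> sq_int M"
  shows "nrm M (\<lambda>x. f x + g x) \<le> nrm M f + nrm M g"
proof -
  have "(nrm M (\<lambda>x. f x + g x))\<^sup>2 = (nrm M f)\<^sup>2 + (nrm M g)\<^sup>2 + 2 * Re (ip M f g)"
    using nrm_diff_sq[OF f scale_sq_int[OF g, of "-1"]]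
    by (simp add: nrm_scale[of M "-1", simplified] ip_scale_right[of M _ "-1", simplified])
  also have "Re (ip M f g) \<le> nrm M f * nrm M g"
    using cauchy_schwarz[OF f g] complex_Re_le_cmod[of "ip M f g"] by linarith
  finally have "(nrm M (\<lambda>x. f x + g x))\<^sup>2 \<le> (nrm M f + nrm M g)\<^sup>2"
    by (simp add: power2_sum)
  then show ?thesis by (rule power2_le_imp_le) simp
qed

lemma nrm_triangle_diff:
  assumes "f \<in> sq_int M" "g \<in> sq_int M" "h \<in> sq_int M"
  shows "nrm M (\<lambda>x. f x - h x) \<le> nrm M (\<lambda>x. f x - g x) + nrm M (\<lambda>x. g x - h x)"
  using nrm_triangle[OF diff_sq_int[OF assms(1,2)] diff_sq_int[OF assms(2,3)]] by simp

lemma nrm_le_add_diff: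
  assumes "f \<in> sq_int M" "g \<in> sq_int M"
  shows "nrm M f \<le> nrm M g + nrm M (\<lambda>x. f x - g x)"
  using nrm_triangle[OF assms(2) diff_sq_int[OF assms]] by simp

lemma nrm_tendsto:
  assumes "f \<in> sq_int M" "\<And>n. S n \<in> sq_int M"
    and "((\<lambda>n. nrm M (\<lambda>x. S n x - f x)) \<longlongrightarrow> 0) F"
  shows "((\<lambda>n. nrm M (S n)) \<longlongrightarrow> nrm M f) F"
proof (rule Lim_transform2[where f="\<lambda>n. nrm M f"])
  have "\<bar>nrm M f - nrm M (S n)\<bar> \<le> nrm M (\<lambda>x. S n x - f x)" for n
    using nrm_le_add_diff[OF assms(1) assms(2)[of n]] nrm_le_add_diff[OF assms(2)[of n] assms(1)]
    by (simp add: nrm_minus_commute[of M f] abs_le_iff)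
  then show "((\<lambda>n. nrm M f - nrm M (S n)) \<longlongrightarrow> 0) F"
    by (intro Lim_null_comparison[OF _ assms(3)]) simp
qed simp

lemma ip_tendsto_left:
  assumes "f \<in> sq_int M" "\<And>n. S n \<in> sq_int M" "g \<in> sq_int M"
    and "((\<lambda>n. nrm M (\<lambda>x. S n x - f x)) \<longlongrightarrow> 0) F"
  shows "((\<lambda>n. ip M (S n) g) \<longlongrightarrow> ip M f g) F"
proof (rule Lim_transform2[where f="\<lambda>n. ip M f g"])
  have "cmod (ip M f g - ip M (S n) g) \<le> nrm M (\<lambda>x. S n x - f x) * nrm M g" for n
    using cauchy_schwarz[OF diff_sq_int[OF assms(1,2)] assms(3), of n] assms(1-3)
    by (simp add: ip_diff_left nrm_minus_commute[of M f])
  then show "((\<lambda>n. ip M f g - ip M (S n) g) \<longlongrightarrow> 0) F"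
    by (intro Lim_null_comparison[OF _ tendsto_mult_left_zero[OF assms(4), of "nrm M g"]]) simp
qed simp

text \<open>Completeness. Since \<open>M\<close> is a probability measure, the \<open>L\<^sup>1\<close>-norms of the increments are summable
  as well, so the sequence converges almost everywhere, and Fatou's lemma bounds the distance of
  its limit to the terms.\<close>

lemma (in prob_space) riesz_fischer:
  assumes S: "\<And>n. S n \<in> sq_int M"
    and inc: "\<And>n. nrm M (\<lambda>x. S (Suc n) x - S n x) \<le> (1/2)^n"
  obtains F where "F \<in> sq_int M" "(\<lambda>n. nrm M (\<lambda>x. S n x - F x)) \<longlonglongrightarrow> 0"
proof -
  have [measurable]: "S n \<in> borel_measurable M" for n
    using S by (rule sq_int_measurable)
  define D where "D n = (\<lambda>x. S (Suc n) x - S n x)" for n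
  have D: "D n \<in> sq_int M" for n
    unfolding D_def by (intro diff_sq_int S)
  have [measurable]: "D n \<in> borel_measurable M" for n
    using D by (rule sq_int_measurable)
  have one: "(\<lambda>x. 1) \<in> sq_int M"
    by (simp add: sq_int_def)
  have absD: "(\<lambda>x. complex_of_real (cmod (D n x))) \<in> sq_int M" for n
    using D[of n] by (auto simp: sq_int_def)
  have intD: "integrable M (\<lambda>x. cmod (D n x))" for n
    using integrable_norm[OF integrable_ip[OF D[of n] one]] by simp
  have L1: "(\<integral>x. cmod (D n x) \<partial>M) \<le> (1/2)^n" for n
  proof -
    have "ip M (\<lambda>x. complex_of_real (cmod (D n x))) (\<lambda>x. 1) = complex_of_real (\<integral>x. cmod (D n x) \<partial>M)"
      by (simp add: ip_def)
    moreover have "nrm M (\<lambda>x. 1) = 1"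
      by (simp add: nrm_def prob_space)
    moreover have "nrm M (\<lambda>x. complex_of_real (cmod (D n x))) = nrm M (D n)"
      by (simp add: nrm_def)
    ultimately have "\<bar>\<integral>x. cmod (D n x) \<partial>M\<bar> \<le> nrm M (D n)"
      using cauchy_schwarz[OF absD[of n] one] by simp
    also have "\<dots> \<le> (1/2)^n" using inc[of n] by (simp add: D_def)
    finally show ?thesis by simp
  qed
  have "(\<integral>\<^sup>+x. (\<Sum>n. ennreal (cmod (D n x))) \<partial>M) = (\<Sum>n. \<integral>\<^sup>+x. ennreal (cmod (D n x)) \<partial>M)"
    by (intro nn_integral_suminf) measurable
  also have "\<dots> = (\<Sum>n. ennreal (\<integral>x. cmod (D n x) \<partial>M))"
    using intD by (simp add: nn_integral_eq_integral)
  also have "\<dots> \<le> (\<Sum>n. ennreal ((1/2)^n))"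
    by (intro suminf_le ennreal_leI L1) auto
  also have "\<dots> = ennreal (\<Sum>n. (1/2)^n)"
    by (intro suminf_ennreal2) auto
  finally have "(\<integral>\<^sup>+x. (\<Sum>n. ennreal (cmod (D n x))) \<partial>M) \<noteq> \<infinity>"
    by (auto simp: top_unique)
  then have "AE x in M. (\<Sum>n. ennreal (cmod (D n x))) \<noteq> \<infinity>"
    by (intro nn_integral_noteq_infinite) auto
  then have conv: "AE x in M. convergent (\<lambda>n. S n x)"
  proof eventually_elim
    case (elim x)
    then have "summable (\<lambda>n. cmod (D n x))"
      by (intro summable_suminf_not_top) auto
    then have "summable (\<lambda>n. D n x)" by (rule summable_norm_cancel)
    moreover have "(\<Sum>k<n. D k x) = S n x - S 0 x" for n
      unfolding D_def by (rule sum_lessThan_telescope)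
    ultimately have "convergent (\<lambda>n. S n x - S 0 x)"
      by (simp add: summable_iff_convergent)
    from convergent_add[OF this convergent_const[of "S 0 x"]] show ?case by simp
  qed
  define F where "F x = lim (\<lambda>n. S n x)" for x
  have [measurable]: "F \<in> borel_measurable M"
    unfolding F_def by measurable
  have tail: "nrm M (\<lambda>x. S (n + k) x - S n x) \<le> 2 * (1/2)^n - 2 * (1/2)^(n + k)" for n k
  proof (induction k)
    case (Suc k)
    have "nrm M (\<lambda>x. S (n + Suc k) x - S n x) \<le>
        nrm M (\<lambda>x. S (Suc (n + k)) x - S (n + k) x) + nrm M (\<lambda>x. S (n + k) x - S n x)"
      using nrm_triangle_diff[OF S[of "n + Suc k"] S[of "n + k"] S[of n]] by simp
    also have "\<dots> \<le> (1/2)^(n + k) + (2 * (1/2)^n - 2 * (1/2)^(n + k))"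
      using inc[of "n + k"] Suc.IH by linarith
    finally show ?case by simp
  qed simp
  have fatou: "(\<integral>\<^sup>+x. ennreal ((cmod (F x - S n x))\<^sup>2) \<partial>M) \<le> ennreal ((2 * (1/2)^n)\<^sup>2)" for n
  proof -
    have "(\<integral>\<^sup>+x. ennreal ((cmod (F x - S n x))\<^sup>2) \<partial>M) =
        (\<integral>\<^sup>+x. liminf (\<lambda>k. ennreal ((cmod (S (n + k) x - S n x))\<^sup>2)) \<partial>M)"
    proof (rule nn_integral_cong_AE)
      show "AE x in M. ennreal ((cmod (F x - S n x))\<^sup>2) =
          liminf (\<lambda>k. ennreal ((cmod (S (n + k) x - S n x))\<^sup>2))"
        using conv
      proof eventually_elim
        case (elim x)
        then have "(\<lambda>n. S n x) \<longlonglongrightarrow> F x"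
          unfolding F_def by (simp add: convergent_LIMSEQ_iff)
        from LIMSEQ_ignore_initial_segment[OF this, of n]
        have lim: "(\<lambda>k. S (n + k) x) \<longlonglongrightarrow> F x" by (simp add: add.commute)
        have "(\<lambda>k. ennreal ((cmod (S (n + k) x - S n x))\<^sup>2)) \<longlonglongrightarrow> ennreal ((cmod (F x - S n x))\<^sup>2)"
          by (intro tendsto_intros lim)
        from lim_imp_Liminf[OF _ this] show ?case by simp
      qed
    qed
    also have "\<dots> \<le> liminf (\<lambda>k. \<integral>\<^sup>+x. ennreal ((cmod (S (n + k) x - S n x))\<^sup>2) \<partial>M)"
      by (intro nn_integral_liminf) measurable
    also have "\<dots> \<le> liminf (\<lambda>k. ennreal ((2 * (1/2)^n)\<^sup>2))"
    proof (intro Liminf_mono always_eventually allI)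
      fix k
      have "(\<integral>\<^sup>+x. ennreal ((cmod (S (n + k) x - S n x))\<^sup>2) \<partial>M) = ennreal ((nrm M (\<lambda>x. S (n + k) x - S n x))\<^sup>2)"
        unfolding nrm_sq using diff_sq_int[OF S S]
        by (intro nn_integral_eq_integral integrable_sq_int) auto
      also have "\<dots> \<le> ennreal ((2 * (1/2)^n)\<^sup>2)"
      proof (intro ennreal_leI power_mono)
        have "0 \<le> 2 * (1/2::real)^(n + k)" by simp
        with tail[of n k] show "nrm M (\<lambda>x. S (n + k) x - S n x) \<le> 2 * (1/2)^n" by linarith
      qed simp
      finally show "(\<integral>\<^sup>+x. ennreal ((cmod (S (n + k) x - S n x))\<^sup>2) \<partial>M) \<le> ennreal ((2 * (1/2)^n)\<^sup>2)" .
    qed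
    also have "\<dots> = ennreal ((2 * (1/2)^n)\<^sup>2)"
      by (simp add: Liminf_const)
    finally show ?thesis .
  qed
  have diff: "(\<lambda>x. F x - S n x) \<in> sq_int M" for n
    using fatou[of n] by (auto simp: sq_int_def integrable_iff_bounded intro: le_less_trans)
  have bound: "nrm M (\<lambda>x. S n x - F x) \<le> 2 * (1/2)^n" for n
  proof -
    have "ennreal ((nrm M (\<lambda>x. F x - S n x))\<^sup>2) \<le> ennreal ((2 * (1/2)^n)\<^sup>2)"
      using fatou[of n] nn_integral_eq_integral[OF integrable_sq_int[OF diff[of n]]]
      by (simp add: nrm_sq)
    then have "(nrm M (\<lambda>x. F x - S n x))\<^sup>2 \<le> (2 * (1/2)^n)\<^sup>2"
      by (simp add: ennreal_le_iff)
    then have "nrm M (\<lambda>x. F x - S n x) \<le> 2 * (1/2)^n" by (rule power2_le_imp_le) simp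
    then show ?thesis by (simp add: nrm_minus_commute[of M F])
  qed
  show ?thesis
  proof
    show "F \<in> sq_int M" using add_sq_int[OF diff[of 0] S[of 0]] by simp
    have "(\<lambda>n. 2 * (1/2::real)^n) \<longlonglongrightarrow> 0"
      by (intro tendsto_mult_right_zero LIMSEQ_power_zero) simp
    then show "(\<lambda>n. nrm M (\<lambda>x. S n x - F x)) \<longlonglongrightarrow> 0"
      by (rule Lim_null_comparison[rotated]) (simp add: bound)
  qed
qed

definition orthonormal :: "'a measure \<Rightarrow> 'i set \<Rightarrow> ('i \<Rightarrow> 'a \<Rightarrow> complex) \<Rightarrow> bool" where
  "orthonormal M I e \<longleftrightarrow>
     (\<forall>i\<in>I. e i \<in> sq_int M) \<and> (\<forall>i\<in>I. \<forall>j\<in>I. ip M (e i) (e j) = (if i = j then 1 else 0))"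

lemma orthonormal_subset: "orthonormal M I e \<Longrightarrow> J \<subseteq> I \<Longrightarrow> orthonormal M J e"
  by (auto simp: orthonormal_def subset_eq)

lemma ip_orthonormal_sum:
  assumes "orthonormal M I e" "finite I" "j \<in> I"
  shows "ip M (\<lambda>x. \<Sum>i\<in>I. c i * e i x) (e j) = c j"
proof -
  have "ip M (\<lambda>x. \<Sum>i\<in>I. c i * e i x) (e j) = (\<Sum>i\<in>I. c i * ip M (e i) (e j))"
    using assms by (intro ip_sum_left) (auto simp: orthonormal_def)
  also have "\<dots> = (\<Sum>i\<in>I. if i = j then c j else 0)"
    using assms by (intro sum.cong) (auto simp: orthonormal_def)
  finally show ?thesis using assms by simp
qed

lemma nrm_orthonormal_sum:
  assumes "orthonormal M I e" "finite I"
  shows "(nrm M (\<lambda>x. \<Sum>i\<in>I. c i * e i x))\<^sup>2 = (\<Sum>i\<in>I. (cmod (c i))\<^sup>2)"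
proof -
  let ?s = "\<lambda>x. \<Sum>i\<in>I. c i * e i x"
  have "?s \<in> sq_int M" using assms by (intro sum_sq_int) (auto simp: orthonormal_def)
  then have "ip M ?s ?s = (\<Sum>i\<in>I. cnj (c i) * ip M ?s (e i))"
    using assms by (intro ip_sum_right) (auto simp: orthonormal_def)
  also have "\<dots> = (\<Sum>i\<in>I. cnj (c i) * c i)"
    using assms by (intro sum.cong) (simp_all add: ip_orthonormal_sum)
  also have "\<dots> = complex_of_real (\<Sum>i\<in>I. (cmod (c i))\<^sup>2)"
    by (simp add: complex_norm_square mult.commute del: of_real_power)
  finally show ?thesis unfolding ip_self by (simp only: of_real_eq_iff)
qed

lemma bessel:
  assumes "orthonormal M I e" "finite I" "f \<in> sq_int M"
  shows "(\<Sum>i\<in>I. (cmod (ip M f (e i)))\<^sup>2) \<le> (nrm M f)\<^sup>2"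
proof -
  let ?s = "\<lambda>x. \<Sum>i\<in>I. ip M f (e i) * e i x"
  have s: "?s \<in> sq_int M" using assms by (intro sum_sq_int) (auto simp: orthonormal_def)
  have "ip M f ?s = (\<Sum>i\<in>I. cnj (ip M f (e i)) * ip M f (e i))"
    using assms by (intro ip_sum_right) (auto simp: orthonormal_def)
  also have "\<dots> = complex_of_real (\<Sum>i\<in>I. (cmod (ip M f (e i)))\<^sup>2)"
    by (simp add: complex_norm_square mult.commute del: of_real_power)
  finally have "Re (ip M f ?s) = (\<Sum>i\<in>I. (cmod (ip M f (e i)))\<^sup>2)" by simp
  moreover have "0 \<le> (nrm M (\<lambda>x. f x - ?s x))\<^sup>2" by simp
  ultimately show ?thesis
    using nrm_diff_sq[OF assms(3) s] nrm_orthonormal_sum[OF assms(1,2), of "\<lambda>i. ip M f (e i)"]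
    by linarith
qed

text \<open>Parseval's inequality. The index set may be uncountable; finite sets of indices along which the
  Bessel sums approach their supremum give partial sums of the Fourier series that converge by
  completeness, and the limit has the same coefficients as \<open>f\<close>: a coefficient outside of these sets
  vanishes, because it would push the Bessel sums above the supremum.\<close>

lemma (in prob_space) parseval_le:
  assumes e: "orthonormal M I e"
    and complete: "\<And>g. g \<in> sq_int M \<Longrightarrow> (\<And>i. i \<in> I \<Longrightarrow> ip M g (e i) = 0) \<Longrightarrow> nrm M g = 0"
    and f: "f \<in> sq_int M"
    and B: "\<And>J. finite J \<Longrightarrow> J \<subseteq> I \<Longrightarrow> (\<Sum>i\<in>J. (cmod (ip M f (e i)))\<^sup>2) \<le> B"
  shows "(nrm M f)\<^sup>2 \<le> B"
proof -
  define Q where "Q J = (\<Sum>i\<in>J. (cmod (ip M f (e i)))\<^sup>2)" for J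
  define s where "s = (SUP J\<in>{J. finite J \<and> J \<subseteq> I}. Q J)"
  have ne: "{J. finite J \<and> J \<subseteq> I} \<noteq> {}" by auto
  have bdd: "bdd_above (Q ` {J. finite J \<and> J \<subseteq> I})"
    using B by (auto simp: Q_def bdd_above_def)
  have Qs: "Q J \<le> s" if "finite J" "J \<subseteq> I" for J
    unfolding s_def using that by (intro cSUP_upper bdd) auto
  have sB: "s \<le> B"
    unfolding s_def using B by (intro cSUP_least ne) (auto simp: Q_def)
  have "\<exists>J. finite J \<and> J \<subseteq> I \<and> s - (1/4)^n < Q J" for n :: nat
    using less_cSUP_iff[OF ne bdd, of "s - (1/4)^n"] by (auto simp: s_def)
  then obtain \<Phi> where \<Phi>: "\<And>n. finite (\<Phi> n)" "\<And>n. \<Phi> n \<subseteq> I" "\<And>n. s - (1/4)^n < Q (\<Phi> n)"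
    by metis
  define \<Psi> where "\<Psi> n = (\<Union>k\<le>n. \<Phi> k)" for n :: nat
  have \<Psi>: "finite (\<Psi> n)" "\<Psi> n \<subseteq> I" for n
    using \<Phi> by (auto simp: \<Psi>_def)
  have \<Psi>_mono: "\<Psi> n \<subseteq> \<Psi> m" if "n \<le> m" for n m
    using that by (auto simp: \<Psi>_def intro: order_trans)
  have Q\<Psi>: "s - (1/4)^n < Q (\<Psi> n)" for n
  proof -
    have "Q (\<Phi> n) \<le> Q (\<Psi> n)"
      unfolding Q_def using \<Psi>(1) by (intro sum_mono2) (auto simp: \<Psi>_def)
    with \<Phi>(3)[of n] show ?thesis by linarith
  qed
  have eI: "e i \<in> sq_int M" if "i \<in> I" for i
    using e that by (auto simp: orthonormal_def)
  define S where "S n = (\<lambda>x. \<Sum>i\<in>\<Psi> n. ip M f (e i) * e i x)" for n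
  have S: "S n \<in> sq_int M" for n
    unfolding S_def using \<Psi>(2) by (intro sum_sq_int eI) auto
  have "nrm M (\<lambda>x. S (Suc n) x - S n x) \<le> (1/2)^n" for n
  proof -
    have sub: "\<Psi> n \<subseteq> \<Psi> (Suc n)" by (intro \<Psi>_mono) simp
    have "(\<lambda>x. S (Suc n) x - S n x) = (\<lambda>x. \<Sum>i\<in>\<Psi> (Suc n) - \<Psi> n. ip M f (e i) * e i x)"
      unfolding S_def by (simp add: sum_diff[OF \<Psi>(1) sub])
    then have "(nrm M (\<lambda>x. S (Suc n) x - S n x))\<^sup>2 = Q (\<Psi> (Suc n) - \<Psi> n)"
      unfolding Q_def using \<Psi>
      by (simp only:) (intro nrm_orthonormal_sum orthonormal_subset[OF e]; blast)
    also have "\<dots> = Q (\<Psi> (Suc n)) - Q (\<Psi> n)"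
      unfolding Q_def by (simp add: sum_diff[OF \<Psi>(1) sub])
    also have "\<dots> \<le> (1/4)^n"
      using Qs[OF \<Psi>, of "Suc n"] Q\<Psi>[of n] by linarith
    also have "\<dots> = ((1/2::real)^n)\<^sup>2"
      by (simp add: power_mult[symmetric] mult.commute[of n 2] power_mult[of _ 2 n] power_divide)
    finally show ?thesis by (rule power2_le_imp_le) simp
  qed
  from riesz_fischer[OF S this] obtain F where
    F: "F \<in> sq_int M" and lim: "(\<lambda>n. nrm M (\<lambda>x. S n x - F x)) \<longlonglongrightarrow> 0"
    by blast
  have ipS: "ip M (S n) (e j) = (if j \<in> \<Psi> n then ip M f (e j) else 0)" if "j \<in> I" for n j
  proof -
    have "ip M (S n) (e j) = (\<Sum>i\<in>\<Psi> n. ip M f (e i) * ip M (e i) (e j))"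
      unfolding S_def using \<Psi>(2) that by (intro ip_sum_left eI) auto
    also have "\<dots> = (\<Sum>i\<in>\<Psi> n. if i = j then ip M f (e j) else 0)"
      using e \<Psi>(2)[of n] that by (intro sum.cong) (auto simp: orthonormal_def)
    finally show ?thesis using \<Psi>(1) by simp
  qed
  have coef: "ip M F (e j) = ip M f (e j)" if j: "j \<in> I" for j
  proof (cases "\<exists>n. j \<in> \<Psi> n")
    case True
    then obtain n where "j \<in> \<Psi> n" by blast
    then have "\<forall>\<^sub>F k in sequentially. ip M (S k) (e j) = ip M f (e j)"
      using \<Psi>_mono ipS[OF j] by (intro eventually_sequentiallyI[of n]) auto
    then have "(\<lambda>k. ip M (S k) (e j)) \<longlonglongrightarrow> ip M f (e j)"
      by (rule tendsto_eventually)
    with ip_tendsto_left[OF F S eI[OF j] lim] show ?thesis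
      by (rule LIMSEQ_unique)
  next
    case False
    then have "(\<lambda>k. ip M (S k) (e j)) = (\<lambda>k. 0)" using ipS[OF j] by auto
    with ip_tendsto_left[OF F S eI[OF j] lim] have F0: "ip M F (e j) = 0"
      by (simp add: LIMSEQ_const_iff)
    have "(cmod (ip M f (e j)))\<^sup>2 \<le> (1/4)^n" for n
    proof -
      have "Q (insert j (\<Psi> n)) = (cmod (ip M f (e j)))\<^sup>2 + Q (\<Psi> n)"
        unfolding Q_def using False \<Psi>(1) by simp
      moreover have "Q (insert j (\<Psi> n)) \<le> s" using \<Psi> j by (intro Qs) auto
      ultimately show ?thesis using Q\<Psi>[of n] by linarith
    qed
    moreover have "(\<lambda>n. (1/4::real)^n) \<longlonglongrightarrow> 0" by (intro LIMSEQ_power_zero) simp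
    ultimately have "(cmod (ip M f (e j)))\<^sup>2 \<le> 0"
      by (intro LIMSEQ_le_const) auto
    with F0 show ?thesis by simp
  qed
  have "nrm M (\<lambda>x. f x - F x) = 0"
    using F f coef eI by (intro complete diff_sq_int) (auto simp: ip_diff_left)
  then have "nrm M f \<le> nrm M F"
    using nrm_le_add_diff[OF f F] by simp
  then have "(nrm M f)\<^sup>2 \<le> (nrm M F)\<^sup>2" by (intro power_mono) auto
  also have "\<dots> \<le> s"
  proof (rule LIMSEQ_le_const2)
    show "(\<lambda>n. (nrm M (S n))\<^sup>2) \<longlonglongrightarrow> (nrm M F)\<^sup>2"
      by (intro tendsto_intros nrm_tendsto F S lim)
    have "(nrm M (S n))\<^sup>2 = Q (\<Psi> n)" for n
      unfolding S_def Q_def using \<Psi>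
      by (intro nrm_orthonormal_sum orthonormal_subset[OF e])
    then show "\<exists>N. \<forall>n\<ge>N. (nrm M (S n))\<^sup>2 \<le> s" using Qs \<Psi> by auto
  qed
  also note sB
  finally show ?thesis .
qed

section \<open>Haar measure and convolution on a compact group\<close>

locale compact_haar =
  fixes \<mu> :: "'a::{topological_group_add, t2_space, second_countable_topology} measure"
  assumes compact_group: "compact (UNIV :: 'a set)"
    and haar_measure: "normalized_haar \<mu>"

sublocale compact_haar \<subseteq> prob_space \<mu>
  using haar_measure by (simp add: normalized_haar_def)

context compact_haar
begin

lemma sets_haar [measurable_cong]: "sets \<mu> = sets borel"
  using haar_measure by (simp add: normalized_haar_def)

lemma space_haar [simp]: "space \<mu> = UNIV"
  using sets_eq_imp_space_eq[OF sets_haar] by simp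

lemma emeasure_haar_UNIV [simp]: "emeasure \<mu> UNIV = 1"
  using emeasure_space_1 by simp

lemma borel_measurable_haar: "borel_measurable \<mu> = borel_measurable borel"
  by (rule measurable_cong_sets[OF sets_haar refl])

lemma distr_translate_left: "distr \<mu> \<mu> (\<lambda>x. a + x) = \<mu>"
  using haar_measure by (simp add: normalized_haar_def)

lemma measurable_cont:
  fixes f :: "'a \<Rightarrow> 'b::topological_space"
  assumes "continuous_on UNIV f"
  shows "f \<in> borel_measurable \<mu>"
  unfolding borel_measurable_haar by (rule borel_measurable_continuous_onI[OF assms])

lemma measurable_translate [measurable]: "(\<lambda>x. a + x) \<in> measurable \<mu> \<mu>" "(\<lambda>x. x + a) \<in> measurable \<mu> \<mu>"
  and measurable_uminus [measurable]: "(\<lambda>x. - x) \<in> measurable \<mu> \<mu>"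
proof -
  have *: "f \<in> measurable \<mu> \<mu>" if "continuous_on UNIV f" for f :: "'a \<Rightarrow> 'a"
    using measurable_cont[OF that] measurable_cong_sets[OF refl sets_haar, of \<mu>] by simp
  show "(\<lambda>x. a + x) \<in> measurable \<mu> \<mu>" "(\<lambda>x. x + a) \<in> measurable \<mu> \<mu>" "(\<lambda>x. - x) \<in> measurable \<mu> \<mu>"
    by (intro * continuous_intros)+
qed

lemma measurable_cont_prod:
  fixes k :: "'a \<times> 'a \<Rightarrow> 'b::topological_space"
  assumes "continuous_on UNIV k"
  shows "k \<in> borel_measurable (\<mu> \<Otimes>\<^sub>M \<mu>)"
proof -
  have "sets (\<mu> \<Otimes>\<^sub>M \<mu>) = sets (borel :: ('a \<times> 'a) measure)"
    unfolding borel_prod[symmetric] by (rule sets_pair_measure_cong[OF sets_haar sets_haar])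
  then have "borel_measurable (\<mu> \<Otimes>\<^sub>M \<mu>) = borel_measurable (borel :: ('a \<times> 'a) measure)"
    by (rule measurable_cong_sets) simp
  then show ?thesis
    using borel_measurable_continuous_onI[OF assms] by blast
qed

text \<open>Write \<open>\<mu>(A)\<close> as the double integral of \<open>1\<^sub>A(-x + y)\<close>: integrating first over \<open>y\<close> gives \<open>\<mu>(A)\<close>,
  and integrating first over \<open>x\<close> gives \<open>\<mu>(-A)\<close>, both times by left invariance.\<close>

lemma distr_uminus: "distr \<mu> \<mu> uminus = \<mu>"
proof (rule measure_eqI)
  fix A assume "A \<in> sets (distr \<mu> \<mu> uminus)"
  then have A [measurable]: "A \<in> sets \<mu>" by simp
  have [measurable]: "(\<lambda>(x, y). - x + y) \<in> measurable (\<mu> \<Otimes>\<^sub>M \<mu>) \<mu>"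
  proof -
    have "continuous_on UNIV (\<lambda>(x::'a, y). - x + y)"
      by (auto simp: split_def intro!: continuous_intros)
    from measurable_cont_prod[OF this] show ?thesis
      using measurable_cong_sets[OF refl sets_haar, of "\<mu> \<Otimes>\<^sub>M \<mu>"] by simp
  qed
  have trans: "(\<integral>\<^sup>+x. h (a + x) \<partial>\<mu>) = (\<integral>\<^sup>+x. h x \<partial>\<mu>)"
    if [measurable]: "h \<in> borel_measurable \<mu>" for a and h :: "'a \<Rightarrow> ennreal"
    by (subst (2) distr_translate_left[of a, symmetric]) (simp add: nn_integral_distr)
  have "emeasure \<mu> A = (\<integral>\<^sup>+x. (\<integral>\<^sup>+y. indicator A (- x + y) \<partial>\<mu>) \<partial>\<mu>)"
    by (simp add: trans[of "indicator A"])
  also have "\<dots> = (\<integral>\<^sup>+y. (\<integral>\<^sup>+x. indicator A (- x + y) \<partial>\<mu>) \<partial>\<mu>)"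
    by (rule pair_sigma_finite.Fubini'[symmetric]) (unfold_locales, measurable)
  also have "\<dots> = (\<integral>\<^sup>+y. (\<integral>\<^sup>+x. indicator A (- x) \<partial>\<mu>) \<partial>\<mu>)"
  proof (rule nn_integral_cong)
    fix y
    have [measurable]: "(\<lambda>x. - x + y) \<in> measurable \<mu> \<mu>"
      using measurable_compose[OF measurable_uminus measurable_translate(2)[of y]] .
    have "(\<integral>\<^sup>+x. indicator A (- x + y) \<partial>\<mu>) = (\<integral>\<^sup>+x. (indicator A (- (y + x) + y) :: ennreal) \<partial>\<mu>)"
      by (rule trans[of "\<lambda>x. indicator A (- x + y)", symmetric]) measurable
    then show "(\<integral>\<^sup>+x. indicator A (- x + y) \<partial>\<mu>) = (\<integral>\<^sup>+x. (indicator A (- x) :: ennreal) \<partial>\<mu>)"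
      by (simp add: minus_add diff_conv_add_uminus add.assoc del: add_uminus_conv_diff)
  qed
  also have "\<dots> = (\<integral>\<^sup>+x. indicator A (- x) \<partial>\<mu>)"
    by simp
  also have "\<dots> = (\<integral>\<^sup>+x. indicator A x \<partial>distr \<mu> \<mu> uminus)"
    by (subst nn_integral_distr) auto
  also have "\<dots> = emeasure (distr \<mu> \<mu> uminus) A"
    by simp
  finally show "emeasure (distr \<mu> \<mu> uminus) A = emeasure \<mu> A" by simp
qed simp

lemma integral_translate_left:
  fixes f :: "'a \<Rightarrow> 'b::{banach, second_countable_topology}"
  assumes "f \<in> borel_measurable \<mu>"
  shows "(\<integral>x. f (a + x) \<partial>\<mu>) = (\<integral>x. f x \<partial>\<mu>)"
  using integral_distr[OF measurable_translate(1)[of a] assms] by (simp add: distr_translate_left)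

lemma integral_uminus:
  fixes f :: "'a \<Rightarrow> 'b::{banach, second_countable_topology}"
  assumes "f \<in> borel_measurable \<mu>"
  shows "(\<integral>x. f (- x) \<partial>\<mu>) = (\<integral>x. f x \<partial>\<mu>)"
  using integral_distr[OF measurable_uminus assms] by (simp add: distr_uminus)

lemma integral_translate_right:
  fixes f :: "'a \<Rightarrow> 'b::{banach, second_countable_topology}"
  assumes [measurable]: "f \<in> borel_measurable \<mu>"
  shows "(\<integral>x. f (x + a) \<partial>\<mu>) = (\<integral>x. f x \<partial>\<mu>)"
proof -
  have "(\<integral>x. f (x + a) \<partial>\<mu>) = (\<integral>x. f (- x + a) \<partial>\<mu>)"
    by (rule integral_uminus[symmetric]) measurable
  also have "\<dots> = (\<integral>x. f (- (- a + x)) \<partial>\<mu>)"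
    by (simp add: minus_add)
  also have "\<dots> = (\<integral>x. f (- x) \<partial>\<mu>)"
    by (rule integral_translate_left) measurable
  also have "\<dots> = (\<integral>x. f x \<partial>\<mu>)"
    by (rule integral_uminus) measurable
  finally show ?thesis .
qed

lemma cont_bounded:
  fixes f :: "'a \<Rightarrow> complex"
  assumes "continuous_on UNIV f"
  obtains B where "B > 0" "\<And>x. cmod (f x) \<le> B"
proof -
  have "bounded (range f)"
    by (intro compact_imp_bounded compact_continuous_image assms compact_group)
  then show ?thesis using that by (auto simp: bounded_pos)
qed

lemma cont_sq_int:
  fixes f :: "'a \<Rightarrow> complex"
  assumes "continuous_on UNIV f"
  shows "f \<in> sq_int \<mu>"
proof -
  obtain B where B: "B > 0" "\<And>x. cmod (f x) \<le> B" using cont_bounded[OF assms] by blast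
  have [measurable]: "f \<in> borel_measurable \<mu>" by (rule measurable_cont[OF assms])
  have "integrable \<mu> (\<lambda>x. (cmod (f x))\<^sup>2)"
    by (rule integrable_const_bound[where B="B\<^sup>2"]) (auto intro!: power_mono B)
  then show ?thesis by (simp add: sq_int_def)
qed

lemma one_sq_int: "(\<lambda>x. 1) \<in> sq_int \<mu>"
  by (intro cont_sq_int continuous_intros)

lemma integrable_sq_int1: "f \<in> sq_int \<mu> \<Longrightarrow> integrable \<mu> f"
  using integrable_ip[OF _ one_sq_int, of f] by simp

lemma integrable_cont:
  fixes f :: "'a \<Rightarrow> complex"
  shows "continuous_on UNIV f \<Longrightarrow> integrable \<mu> f"
  by (intro integrable_sq_int1 cont_sq_int)

lemma nrm_le_bound:
  assumes "f \<in> sq_int \<mu>" "\<And>x. cmod (f x) \<le> B"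
  shows "nrm \<mu> f \<le> B"
proof -
  have B: "0 \<le> B" using norm_ge_zero assms(2) by (rule order_trans)
  have "(nrm \<mu> f)\<^sup>2 \<le> (\<integral>x. B\<^sup>2 \<partial>\<mu>)"
    unfolding nrm_sq using assms
    by (intro integral_mono integrable_sq_int) (auto intro: power_mono)
  also have "\<dots> = B\<^sup>2" by (simp add: prob_space[simplified])
  finally show ?thesis using B by (rule power2_le_imp_le)
qed

text \<open>A nonzero continuous function is bounded away from zero on a nonempty open set, finitely many
  translates of which cover the group.\<close>

lemma cont_nrm_eq_0:
  fixes f :: "'a \<Rightarrow> complex"
  assumes f: "continuous_on UNIV f" and 0: "nrm \<mu> f = 0"
  shows "f x = 0"
proof (rule ccontr)
  assume fx: "f x \<noteq> 0"
  define U where "U = {y. f y \<noteq> 0}"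
  have "open U"
    unfolding U_def using f by (intro open_Collect_neq continuous_on_const)
  then have [measurable]: "U \<in> sets \<mu>" by (simp add: sets_haar)
  have "AE y in \<mu>. f y = 0"
    using 0 nrm_eq_0_AE[OF cont_sq_int[OF f]] by blast
  moreover have "{y \<in> space \<mu>. \<not> f y = 0} = U" by (simp add: U_def)
  ultimately have nullU: "emeasure \<mu> U = 0"
    using AE_iff_measurable[OF \<open>U \<in> sets \<mu>\<close>, of "\<lambda>y. f y = 0"] by blast
  define V where "V a = (\<lambda>y. - a + y) -` U" for a
  have openV: "open (V a)" for a
    unfolding V_def using \<open>open U\<close> by (intro open_vimage continuous_intros)
  have nullV: "emeasure \<mu> (V a) = 0" for a
  proof -
    have "emeasure \<mu> U = emeasure \<mu> (V a)"
      by (subst distr_translate_left[of "- a", symmetric]) (simp add: emeasure_distr V_def)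
    with nullU show ?thesis by simp
  qed
  have cover: "y \<in> V (y - x)" for y
    using fx by (simp add: V_def U_def)
  obtain T where T: "finite T" "UNIV \<subseteq> (\<Union>a\<in>T. V a)"
  proof (rule compactE_image[OF compact_group, of UNIV V])
    show "UNIV \<subseteq> (\<Union>a. V a)" using cover by blast
  qed (use openV in auto)
  have "(\<Union>a\<in>T. V a) \<in> null_sets \<mu>"
    using T(1) nullV openV by (intro null_sets.finite_UN) (auto simp: null_sets_def sets_haar)
  then have "emeasure \<mu> (\<Union>a\<in>T. V a) = 0" by auto
  then have "emeasure \<mu> UNIV = 0"
    using T(2) by (simp add: top.extremum_unique)
  then show False using emeasure_space_1 by simp
qed

definition conv :: "('a \<Rightarrow> complex) \<Rightarrow> ('a \<Rightarrow> complex) \<Rightarrow> 'a \<Rightarrow> complex" where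
  "conv f g x = (\<integral>y. f y * g (- y + x) \<partial>\<mu>)"

text \<open>The involution of the convolution algebra: convolution with \<open>adj f\<close> is the adjoint of convolution
  with \<open>f\<close>.\<close>

definition adj :: "('a \<Rightarrow> complex) \<Rightarrow> 'a \<Rightarrow> complex" where
  "adj f x = cnj (f (- x))"

lemma adj_adj [simp]: "adj (adj f) = f"
  by (simp add: adj_def fun_eq_iff)

lemma translate_cont:
  fixes f :: "'a \<Rightarrow> complex"
  assumes "continuous_on UNIV f"
  shows "continuous_on UNIV (\<lambda>y. f (- y + x))" "continuous_on UNIV (\<lambda>y. f (y + x))"
    "continuous_on UNIV (\<lambda>y. f (x + y))" "continuous_on UNIV (\<lambda>y. f (x - y))"
    "continuous_on UNIV (\<lambda>y. f (- y))"
proof -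
  have *: "continuous_on UNIV (\<lambda>y. f (u y))" if "continuous_on UNIV u" for u :: "'a \<Rightarrow> 'a"
    using assms that by (rule continuous_on_compose2) simp
  show "continuous_on UNIV (\<lambda>y. f (- y + x))" "continuous_on UNIV (\<lambda>y. f (y + x))"
    "continuous_on UNIV (\<lambda>y. f (x + y))" "continuous_on UNIV (\<lambda>y. f (x - y))"
    "continuous_on UNIV (\<lambda>y. f (- y))"
    unfolding diff_conv_add_uminus
    by (rule *, intro continuous_on_add continuous_on_minus continuous_on_const continuous_on_id)+
qed

lemma adj_cont: "continuous_on UNIV f \<Longrightarrow> continuous_on UNIV (adj f)"
  unfolding adj_def by (intro continuous_on_cnj translate_cont)

text \<open>The group is first countable, so that continuity follows from dominated convergence along
  sequences.\<close>

lemma conv_cont: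
  assumes f: "integrable \<mu> f" and g: "continuous_on UNIV g"
  shows "continuous_on UNIV (conv f g)"
proof (rule continuous_on_sequentiallyI)
  fix u :: "nat \<Rightarrow> 'a" and x assume u: "u \<longlonglongrightarrow> x"
  obtain B where B: "B > 0" "\<And>x. cmod (g x) \<le> B" using cont_bounded[OF g] by blast
  have [measurable]: "(\<lambda>y. g (- y + z)) \<in> borel_measurable \<mu>" for z
    by (intro measurable_cont translate_cont g)
  have [measurable]: "f \<in> borel_measurable \<mu>" using f by simp
  show "(\<lambda>n. conv f g (u n)) \<longlonglongrightarrow> conv f g x"
    unfolding conv_def
  proof (rule integral_dominated_convergence)
    show "integrable \<mu> (\<lambda>y. B * cmod (f y))" using f by simp
    show "AE y in \<mu>. (\<lambda>n. f y * g (- y + u n)) \<longlonglongrightarrow> f y * g (- y + x)"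
    proof (rule AE_I2)
      fix y
      have "isCont g (- y + x)" using g by (simp add: continuous_on_eq_continuous_at)
      from isCont_tendsto_compose[OF this tendsto_add[OF tendsto_const u]]
      show "(\<lambda>n. f y * g (- y + u n)) \<longlonglongrightarrow> f y * g (- y + x)"
        by (intro tendsto_intros)
    qed
    show "AE y in \<mu>. norm (f y * g (- y + u n)) \<le> B * cmod (f y)" for n
      using B by (intro AE_I2) (simp add: norm_mult mult.commute[of B] mult_left_mono)
  qed measurable
qed

lemma conv_cont': "continuous_on UNIV f \<Longrightarrow> continuous_on UNIV g \<Longrightarrow> continuous_on UNIV (conv f g)"
  by (intro conv_cont integrable_cont)

lemma fubini_cont:
  fixes k :: "'a \<Rightarrow> 'a \<Rightarrow> complex"
  assumes f: "integrable \<mu> f" and k: "continuous_on UNIV (\<lambda>(x, y). k x y)"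
  shows "(\<integral>x. (\<integral>y. f y * k x y \<partial>\<mu>) \<partial>\<mu>) = (\<integral>y. f y * (\<integral>x. k x y \<partial>\<mu>) \<partial>\<mu>)"
proof -
  have "bounded (range (\<lambda>(x, y). k x y))"
    using compact_Times[OF compact_group compact_group]
    by (intro compact_imp_bounded compact_continuous_image k) simp
  then obtain B where B: "B > 0" "\<And>x y. cmod (k x y) \<le> B" by (auto simp: bounded_pos)
  have [measurable]: "(\<lambda>(x, y). k x y) \<in> borel_measurable (\<mu> \<Otimes>\<^sub>M \<mu>)"
    by (rule measurable_cont_prod[OF k])
  have [measurable]: "f \<in> borel_measurable \<mu>" using f by simp
  have "(\<lambda>z. f (snd z) * (case z of (x, y) \<Rightarrow> k x y)) \<in> borel_measurable (\<mu> \<Otimes>\<^sub>M \<mu>)"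
    by measurable
  then have m [measurable]: "(\<lambda>(x, y). f y * k x y) \<in> borel_measurable (\<mu> \<Otimes>\<^sub>M \<mu>)"
    by (simp add: split_def)
  have "integrable (\<mu> \<Otimes>\<^sub>M \<mu>) (\<lambda>(x, y). f y * k x y)"
    unfolding integrable_iff_bounded
  proof
    have "(\<integral>\<^sup>+z. ennreal (norm (case z of (x, y) \<Rightarrow> f y * k x y)) \<partial>(\<mu> \<Otimes>\<^sub>M \<mu>)) =
        (\<integral>\<^sup>+x. (\<integral>\<^sup>+y. ennreal (cmod (f y * k x y)) \<partial>\<mu>) \<partial>\<mu>)"
      using m by (subst nn_integral_fst[symmetric]) simp_all
    also have "\<dots> \<le> (\<integral>\<^sup>+x. (\<integral>\<^sup>+y. ennreal (cmod (of_real B * f y)) \<partial>\<mu>) \<partial>\<mu>)"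
      using B by (intro nn_integral_mono ennreal_leI) (auto simp: norm_mult mult.commute[of B] intro!: mult_left_mono)
    also have "\<dots> = (\<integral>\<^sup>+y. ennreal (cmod (of_real B * f y)) \<partial>\<mu>)"
      by simp
    also have "\<dots> < \<infinity>"
      using integrable_mult_right[OF f, of "of_real B"] unfolding integrable_iff_bounded by blast
    finally show "(\<integral>\<^sup>+z. ennreal (norm (case z of (x, y) \<Rightarrow> f y * k x y)) \<partial>(\<mu> \<Otimes>\<^sub>M \<mu>)) < \<infinity>" .
  qed (rule m)
  moreover have "pair_sigma_finite \<mu> \<mu>" ..
  ultimately show ?thesis
    using pair_sigma_finite.Fubini_integral[of \<mu> \<mu> "\<lambda>x y. f y * k x y"] by simp
qed

lemma conv_assoc:
  assumes f: "continuous_on UNIV f" and g: "continuous_on UNIV g" and h: "continuous_on UNIV h"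
  shows "conv (conv f g) h = conv f (conv g h)"
proof
  fix x
  have "conv (conv f g) h x = (\<integral>y. (\<integral>z. f z * (g (- z + y) * h (- y + x)) \<partial>\<mu>) \<partial>\<mu>)"
    unfolding conv_def by (simp add: mult.assoc flip: integral_mult_left_zero)
  also have "\<dots> = (\<integral>z. f z * (\<integral>y. g (- z + y) * h (- y + x) \<partial>\<mu>) \<partial>\<mu>)"
  proof (rule fubini_cont)
    show "continuous_on UNIV (\<lambda>(y, z). g (- z + y) * h (- y + x))"
      unfolding split_def
      by (intro continuous_on_mult continuous_on_compose2[OF g] continuous_on_compose2[OF h] continuous_intros) auto
  qed (rule integrable_cont[OF f])
  also have "\<dots> = (\<integral>z. f z * (\<integral>y. g y * h (- (z + y) + x) \<partial>\<mu>) \<partial>\<mu>)"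
  proof (rule Bochner_Integration.integral_cong[OF refl], rule arg_cong2[where f="(*)", OF refl])
    fix z
    have "(\<lambda>y. g (- z + y) * h (- y + x)) \<in> borel_measurable \<mu>"
      by (intro measurable_cont continuous_on_mult translate_cont g h)
    from integral_translate_left[OF this, of z]
    show "(\<integral>y. g (- z + y) * h (- y + x) \<partial>\<mu>) = (\<integral>y. g y * h (- (z + y) + x) \<partial>\<mu>)"
      by (simp add: add.assoc[symmetric])
  qed
  also have "\<dots> = conv f (conv g h) x"
    unfolding conv_def
    by (simp add: minus_add diff_conv_add_uminus add.assoc del: add_uminus_conv_diff)
  finally show "conv (conv f g) h x = conv f (conv g h) x" .
qed

lemma adj_conv:
  assumes f: "continuous_on UNIV f" and g: "continuous_on UNIV g"
  shows "adj (conv f g) = conv (adj g) (adj f)"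
proof
  fix x
  have "(\<lambda>y. cnj (g (- y) * f (- x + y))) \<in> borel_measurable \<mu>"
    by (intro measurable_cont continuous_on_cnj continuous_on_mult translate_cont f g)
  from integral_translate_left[OF this, of x]
  have "(\<integral>y. cnj (g (- y) * f (- x + y)) \<partial>\<mu>) = (\<integral>y. cnj (g (- (x + y)) * f y) \<partial>\<mu>)"
    by (simp add: add.assoc[symmetric])
  then show "adj (conv f g) x = conv (adj g) (adj f) x"
    unfolding adj_def conv_def Bochner_Integration.integral_cnj[symmetric]
    by (simp add: minus_add diff_conv_add_uminus mult.commute del: add_uminus_conv_diff)
qed

lemma conv_0: "conv f g 0 = ip \<mu> f (adj g)"
  by (simp add: conv_def ip_def adj_def)

lemma nrm_translate:
  assumes g: "continuous_on UNIV g"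
  shows "nrm \<mu> (\<lambda>y. cnj (g (- y + x))) = nrm \<mu> g" "nrm \<mu> (\<lambda>y. cnj (g (x - y))) = nrm \<mu> g"
    "nrm \<mu> (adj g) = nrm \<mu> g"
proof -
  have m: "(\<lambda>y. (cmod (g y))\<^sup>2) \<in> borel_measurable \<mu>"
    by (intro measurable_cont continuous_intros g)
  have mr: "(\<lambda>y. (cmod (g (y + x)))\<^sup>2) \<in> borel_measurable \<mu>" for x
    by (intro measurable_cont continuous_on_power continuous_on_norm translate_cont g)
  have ml: "(\<lambda>y. (cmod (g (x + y)))\<^sup>2) \<in> borel_measurable \<mu>" for x
    by (intro measurable_cont continuous_on_power continuous_on_norm translate_cont g)
  show "nrm \<mu> (\<lambda>y. cnj (g (- y + x))) = nrm \<mu> g" for x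
    unfolding nrm_def using integral_uminus[OF mr[of x]] integral_translate_right[OF m, of x] by simp
  from this[of 0] show "nrm \<mu> (adj g) = nrm \<mu> g"
    by (simp add: adj_def[abs_def])
  show "nrm \<mu> (\<lambda>y. cnj (g (x - y))) = nrm \<mu> g"
    unfolding nrm_def using integral_uminus[OF ml[of x]] integral_translate_left[OF m, of x] by simp
qed

lemma conv_bound:
  assumes f: "f \<in> sq_int \<mu>" and g: "continuous_on UNIV g"
  shows "cmod (conv f g x) \<le> nrm \<mu> f * nrm \<mu> g"
proof -
  have "conv f g x = ip \<mu> f (\<lambda>y. cnj (g (- y + x)))"
    by (simp add: conv_def ip_def)
  then show ?thesis
    using cauchy_schwarz[OF f cont_sq_int[OF continuous_on_cnj[OF translate_cont(1)[OF g]]], of x]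
    by (simp add: nrm_translate[OF g])
qed

lemma nrm_conv:
  assumes f: "continuous_on UNIV f" and g: "continuous_on UNIV g"
  shows "nrm \<mu> (conv f g) \<le> nrm \<mu> f * nrm \<mu> g"
  by (intro nrm_le_bound conv_bound cont_sq_int conv_cont' f g)

lemma conv_diff_left:
  assumes "continuous_on UNIV f" "continuous_on UNIV g" "continuous_on UNIV h"
  shows "conv (\<lambda>x. f x - g x) h x = conv f h x - conv g h x"
  unfolding conv_def left_diff_distrib using assms
  by (intro Bochner_Integration.integral_diff integrable_cont continuous_on_mult translate_cont)

lemma conv_diff_right:
  assumes "continuous_on UNIV f" "continuous_on UNIV g" "continuous_on UNIV h"
  shows "conv h (\<lambda>x. f x - g x) x = conv h f x - conv h g x"
  unfolding conv_def right_diff_distrib using assms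
  by (intro Bochner_Integration.integral_diff integrable_cont continuous_on_mult translate_cont)

lemma conv_scale: "conv (\<lambda>x. c * f x) (\<lambda>x. d * g x) x = c * d * conv f g x"
proof -
  have "(\<lambda>y. (c * f y) * (d * g (- y + x))) = (\<lambda>y. (c * d) * (f y * g (- y + x)))"
    by (simp add: mult_ac fun_eq_iff)
  then show ?thesis unfolding conv_def by simp
qed

text \<open>The open set is a countable union of basic open sets whose closures it contains. Urysohn's lemma
  supplies a continuous function for each of them, and the complementary products combine finitely many
  of these functions without leaving the unit interval.\<close>

lemma indicator_open_limit:
  assumes U: "open (U :: 'a set)"
  obtains g :: "nat \<Rightarrow> 'a \<Rightarrow> real" where
    "\<And>n. continuous_on UNIV (g n)" "\<And>n x. 0 \<le> g n x" "\<And>n x. g n x \<le> 1"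
    "\<And>x. (\<lambda>n. g n x) \<longlonglongrightarrow> indicator U x"
proof -
  have comp: "compact_space (euclidean :: 'a topology)"
    using compact_group by (simp add: compact_space_def)
  have "Hausdorff_space (euclidean :: 'a topology)"
    unfolding Hausdorff_space_def disjnt_def using hausdorff[where 'a='a] by simp
  then have norm: "normal_space (euclidean :: 'a topology)"
    using comp by (intro compact_Hausdorff_or_regular_imp_normal_space disjI1)
  obtain \<B> :: "'a set set" where \<B>: "countable \<B>" "topological_basis \<B>"
    using ex_countable_basis by blast
  define \<C> where "\<C> = {b \<in> \<B>. closure b \<subseteq> U}"
  have C: "countable (insert {} \<C>)" using \<B>(1) by (simp add: \<C>_def)
  have sub: "\<exists>b\<in>\<C>. x \<in> b" if "x \<in> U" for x
  proof -
    have "closedin euclidean {x}" "openin euclidean U" "{x} \<subseteq> U" using U that by simp_all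
    then have "\<exists>V. openin euclidean V \<and> {x} \<subseteq> V \<and> euclidean closure_of V \<subseteq> U"
      using norm[unfolded normal_space_alt, rule_format, of "{x}" U] by blast
    then obtain V where V: "open V" "x \<in> V" "closure V \<subseteq> U"
      by auto
    then obtain b where "b \<in> \<B>" "x \<in> b" "b \<subseteq> V"
      using topological_basisE[OF \<B>(2), of V x] by auto
    moreover from this V have "closure b \<subseteq> U"
      using closure_mono[of b V] by blast
    ultimately show ?thesis by (auto simp: \<C>_def)
  qed
  have "\<exists>f::'a \<Rightarrow> real. continuous_on UNIV f \<and> range f \<subseteq> {0..1} \<and> (\<forall>x\<in>- U. f x = 0) \<and> (\<forall>x\<in>b. f x = 1)"
    if "b \<in> insert {} \<C>" for b
  proof -
    have "closedin euclidean (- U)" "closedin euclidean (closure b)" "disjnt (- U) (closure b)"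
      using U that by (auto simp: \<C>_def disjnt_def)
    then obtain f where "continuous_map euclidean (top_of_set {0..1::real}) f" "f ` (- U) \<subseteq> {0}" "f ` closure b \<subseteq> {1}"
      using Urysohn_lemma[OF norm, of "- U" "closure b" 0 1] by auto
    then show ?thesis
      using closure_subset[of b]
      by (intro exI[of _ f]) (auto simp: continuous_map_in_subtopology image_subset_iff)
  qed
  then have "\<forall>b\<in>insert {} \<C>. \<exists>f::'a \<Rightarrow> real. continuous_on UNIV f \<and> range f \<subseteq> {0..1} \<and>
      (\<forall>x\<in>- U. f x = 0) \<and> (\<forall>x\<in>b. f x = 1)"
    by blast
  from bchoice[OF this] obtain f :: "'a set \<Rightarrow> 'a \<Rightarrow> real" where
    f': "\<forall>b\<in>insert {} \<C>. continuous_on UNIV (f b) \<and> range (f b) \<subseteq> {0..1} \<and>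
      (\<forall>x\<in>- U. f b x = 0) \<and> (\<forall>x\<in>b. f b x = 1)" ..
  have f: "continuous_on UNIV (f b)" "0 \<le> f b x \<and> f b x \<le> 1" "x \<notin> U \<Longrightarrow> f b x = 0" "x \<in> b \<Longrightarrow> f b x = 1"
    if "b \<in> insert {} \<C>" for b x
    using f'[rule_format, OF that] by (auto simp: image_subset_iff)
  define e where "e = from_nat_into (insert {} \<C>)"
  have e: "e n \<in> insert {} \<C>" for n
    unfolding e_def by (rule from_nat_into) simp
  have surj_e: "\<exists>n. e n = b" if "b \<in> \<C>" for b
    using from_nat_into_surj[OF C, of b] that by (auto simp: e_def)
  \<comment> \<open>Once \<open>n\<close> exceeds an index \<open>k\<close> with \<open>x \<in> e k\<close>, the product contains the factor \<open>0\<close>.\<close>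
  define g where "g n x = 1 - (\<Prod>k\<le>n. 1 - f (e k) x)" for n :: nat and x
  show ?thesis
  proof
    show "continuous_on UNIV (g n)" for n
      unfolding g_def using f(1)[OF e] by (intro continuous_intros)
    show "0 \<le> g n x" for n x
      unfolding g_def using f(2)[OF e] prod_le_1[of "{..n}" "\<lambda>k. 1 - f (e k) x"] by simp
    show "g n x \<le> 1" for n x
      unfolding g_def using f(2)[OF e] prod_nonneg[of "{..n}" "\<lambda>k. 1 - f (e k) x"] by simp
    show "(\<lambda>n. g n x) \<longlonglongrightarrow> indicator U x" for x
    proof (cases "x \<in> U")
      case True
      then obtain N where "x \<in> e N" using sub surj_e by metis
      then have "f (e N) x = 1" using f(4)[OF e] by blast
      then have "g n x = 1" if "n \<ge> N" for n
        unfolding g_def using that by (auto intro!: prod_zero bexI[of _ N])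
      then show ?thesis
        using True by (intro tendsto_eventually eventually_sequentiallyI[of N]) simp
    next
      case False
      then show ?thesis using f(3)[OF e] by (simp add: g_def)
    qed
  qed
qed

text \<open>Dominated convergence carries the assumption from continuous functions to indicators of open
  sets, which form an intersection-stable generator of the Borel sets.\<close>

lemma AE_zero_if_orthogonal_cont:
  fixes f :: "'a \<Rightarrow> complex"
  assumes f: "integrable \<mu> f"
    and orth: "\<And>h. continuous_on UNIV h \<Longrightarrow> (\<integral>x. f x * h x \<partial>\<mu>) = 0"
  shows "AE x in \<mu>. f x = 0"
proof (rule density_zero[OF f])
  have [measurable]: "f \<in> borel_measurable \<mu>" using f by simp
  have int: "integrable \<mu> (\<lambda>x. indicator A x *\<^sub>R f x)" if "A \<in> sets borel" for A
    using that by (intro integrable_mult_indicator f) (simp add: sets_haar)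
  fix A assume "A \<in> sets \<mu>"
  then have A: "A \<in> sigma_sets UNIV {S. open S}" by (simp add: sets_haar borel_def)
  have all: "(\<integral>x. f x \<partial>\<mu>) = 0" using orth[of "\<lambda>_. 1"] by simp
  have "(\<integral>x. indicator A x *\<^sub>R f x \<partial>\<mu>) = 0"
  proof (rule sigma_sets_induct_disjoint[OF _ _ A])
    show "Int_stable {S :: 'a set. open S}" by (auto simp: Int_stable_def)
    show "(\<integral>x. indicator U x *\<^sub>R f x \<partial>\<mu>) = 0" if U: "U \<in> {S. open S}" for U
    proof -
      obtain g :: "nat \<Rightarrow> 'a \<Rightarrow> real" where g: "\<And>n. continuous_on UNIV (g n)" "\<And>n x. 0 \<le> g n x" "\<And>n x. g n x \<le> 1"
        "\<And>x. (\<lambda>n. g n x) \<longlonglongrightarrow> indicator U x"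
        using indicator_open_limit U by blast
      have [measurable]: "g n \<in> borel_measurable \<mu>" for n by (rule measurable_cont[OF g(1)])
      have "(\<lambda>n. \<integral>x. g n x *\<^sub>R f x \<partial>\<mu>) \<longlonglongrightarrow> (\<integral>x. indicator U x *\<^sub>R f x \<partial>\<mu>)"
      proof (rule integral_dominated_convergence)
        show "integrable \<mu> (\<lambda>x. cmod (f x))" using f by simp
        show "(\<lambda>x. indicator U x *\<^sub>R f x) \<in> borel_measurable \<mu>"
          using int[of U] U by auto
        show "AE x in \<mu>. (\<lambda>n. g n x *\<^sub>R f x) \<longlonglongrightarrow> indicator U x *\<^sub>R f x"
          by (intro AE_I2 tendsto_intros g(4))
        show "AE x in \<mu>. norm (g n x *\<^sub>R f x) \<le> cmod (f x)" for n
          using g(2,3) by (intro AE_I2) (simp add: mult_left_le_one_le)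
      qed measurable
      moreover have "(\<integral>x. g n x *\<^sub>R f x \<partial>\<mu>) = 0" for n
        using orth[of "\<lambda>x. of_real (g n x)"] g(1)[of n]
        by (simp add: scaleR_conv_of_real mult.commute continuous_on_of_real)
      ultimately show ?thesis by (simp add: LIMSEQ_const_iff)
    qed
    show "(\<integral>x. indicator (UNIV - B) x *\<^sub>R f x \<partial>\<mu>) = 0"
      if "B \<in> sigma_sets UNIV {S. open S}" "(\<integral>x. indicator B x *\<^sub>R f x \<partial>\<mu>) = 0" for B
    proof -
      have B: "B \<in> sets borel" using that(1) by (simp add: borel_def)
      have "(\<lambda>x. indicator (UNIV - B) x *\<^sub>R f x) = (\<lambda>x. f x - indicator B x *\<^sub>R f x)"
        by (auto simp: indicator_def)
      then show ?thesis using that(2) all int[OF B] f by simp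
    qed
    show "(\<integral>x. indicator (\<Union>i. B i) x *\<^sub>R f x \<partial>\<mu>) = 0"
      if "disjoint_family B" "range B \<subseteq> sigma_sets UNIV {S. open S}"
        "\<And>i. (\<integral>x. indicator (B i) x *\<^sub>R f x \<partial>\<mu>) = 0" for B :: "nat \<Rightarrow> 'a set"
    proof -
      have B: "B i \<in> sets \<mu>" for i using that(2) by (auto simp: borel_def sets_haar)
      have "set_integrable \<mu> (\<Union>i. B i) f"
        unfolding set_integrable_def using B f by (intro integrable_mult_indicator) auto
      then have "set_lebesgue_integral \<mu> (\<Union>i. B i) f = (\<Sum>i. set_lebesgue_integral \<mu> (B i) f)"
        using B that(1) by (intro lebesgue_integral_countable_add) (auto simp: disjoint_family_on_def)
      with that(3) show ?thesis
        by (simp add: set_lebesgue_integral_def)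
    qed
  qed simp_all
  then show "set_lebesgue_integral \<mu> A f = 0" by (simp add: set_lebesgue_integral_def)
qed

end

section \<open>Convolution idempotents\<close>

text \<open>The sequence \<open>a\<^sub>n\<close> stands for the squared \<open>L\<^sup>2\<close>-norms of the powers of a self-adjoint element,
  \<open>\<Sum>\<lambda>\<^sup>2\<^sup>n\<^sup>+\<^sup>2\<close> over its eigenvalues \<open>\<lambda>\<close>. The ratios \<open>a\<^sub>n\<^sub>+\<^sub>1/a\<^sub>n\<close> increase to the square \<open>r\<close> of the
  largest \<open>|\<lambda>|\<close>, and the limit \<open>\<beta>\<close> of \<open>a\<^sub>n/r\<^sup>n\<^sup>+\<^sup>1\<close> is the multiplicity. It is at least \<open>1\<close>: if a term
  dropped below \<open>1\<close>, submultiplicativity would make the normalized sequence decay geometrically,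
  although its ratios tend to \<open>1\<close>.\<close>

lemma log_convex_submultiplicative_limit:
  fixes a :: "nat \<Rightarrow> real"
  assumes pos: "\<And>n. a n > 0"
    and lc: "\<And>n. (a (Suc n))\<^sup>2 \<le> a n * a (Suc (Suc n))"
    and sub: "\<And>m n. a (Suc (m + n)) \<le> a m * a n"
  obtains r \<beta> where "r > 0" "\<beta> \<ge> 1" "(\<lambda>n. a n / r ^ Suc n) \<longlonglongrightarrow> \<beta>"
proof -
  define \<rho> where "\<rho> n = a (Suc n) / a n" for n
  have \<rho>_pos: "\<rho> n > 0" for n using pos by (simp add: \<rho>_def)
  have "incseq \<rho>"
  proof (rule incseq_SucI)
    show "\<rho> n \<le> \<rho> (Suc n)" for n
      using lc[of n] pos[of n] pos[of "Suc n"]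
      by (simp add: \<rho>_def divide_simps power2_eq_square mult.commute)
  qed
  moreover have \<rho>_le: "\<rho> n \<le> a 0" for n
    using sub[of n 0] pos[of n] by (simp add: \<rho>_def divide_simps mult.commute)
  ultimately obtain r where r: "\<rho> \<longlonglongrightarrow> r" "\<And>n. \<rho> n \<le> r"
    using incseq_convergent[of \<rho> "a 0"] by auto
  have r_pos: "r > 0" using r(2)[of 0] \<rho>_pos[of 0] by linarith
  define b where "b n = a n / r ^ Suc n" for n
  have b_pos: "b n > 0" for n using pos r_pos by (simp add: b_def)
  have b_Suc: "b (Suc n) = \<rho> n / r * b n" for n
    using pos[of n] by (simp add: b_def \<rho>_def)
  have b_dec: "decseq b"
  proof (rule decseq_SucI)
    fix n
    have "\<rho> n / r \<le> 1" using r(2)[of n] r_pos by simp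
    then show "b (Suc n) \<le> b n"
      unfolding b_Suc using mult_right_mono[of "\<rho> n / r" 1 "b n"] b_pos[of n] by simp
  qed
  have b_sub: "b (Suc (m + n)) \<le> b m * b n" for m n
  proof -
    have "b (Suc (m + n)) = a (Suc (m + n)) / (r ^ Suc m * r ^ Suc n)"
      by (simp add: b_def power_add mult_ac)
    also have "\<dots> \<le> (a m * a n) / (r ^ Suc m * r ^ Suc n)"
      using r_pos by (intro divide_right_mono sub) simp
    finally show ?thesis by (simp add: b_def)
  qed
  have b_ge1: "b n \<ge> 1" for n
  proof (rule ccontr)
    assume "\<not> b n \<ge> 1"
    then have bn: "b n < 1" by simp
    \<comment> \<open>Bernoulli's inequality keeps the power \<open>q ^ Suc n\<close> above \<open>(1 + b n) / 2\<close>, hence above \<open>b n\<close>.\<close>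
    define q where "q = 1 - (1 - b n) / (2 * real (Suc n))"
    have q: "0 < q" "q < 1"
      using bn b_pos[of n] by (auto simp: q_def divide_simps)
    have "1 + real (Suc n) * (- ((1 - b n) / (2 * real (Suc n)))) \<le> (1 + - ((1 - b n) / (2 * real (Suc n)))) ^ Suc n"
      using q by (intro Bernoulli_inequality) (simp add: q_def)
    also have "real (Suc n) * (- ((1 - b n) / (2 * real (Suc n)))) = - ((1 - b n) / 2)"
      by (simp del: of_nat_Suc)
    finally have "1 - (1 - b n) / 2 \<le> q ^ Suc n" by (simp add: q_def)
    then have qn: "b n < q ^ Suc n" using bn by (simp add: field_simps)
    have "(\<lambda>k. \<rho> k / r) \<longlonglongrightarrow> r / r"
      using r_pos by (intro tendsto_intros r(1)) simp
    then have "\<forall>\<^sub>F k in sequentially. q < \<rho> k / r"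
      using q r_pos by (intro order_tendstoD) auto
    then obtain J where J: "\<And>k. k \<ge> J \<Longrightarrow> q < \<rho> k / r"
      by (auto simp: eventually_sequentially)
    have low: "b J * q ^ i \<le> b (J + i)" for i
    proof (induction i)
      case (Suc i)
      have "b J * q ^ Suc i = q * (b J * q ^ i)" by simp
      also have "\<dots> \<le> \<rho> (J + i) / r * b (J + i)"
        using Suc.IH J[of "J + i"] q b_pos[of J] by (intro mult_mono) auto
      finally show ?case by (simp add: b_Suc)
    qed simp
    have up: "b (Suc n * Suc k - 1) \<le> b n ^ Suc k" for k
    proof (induction k)
      case (Suc k)
      have "Suc n * Suc (Suc k) - 1 = Suc ((Suc n * Suc k - 1) + n)" by simp
      then have "b (Suc n * Suc (Suc k) - 1) = b (Suc ((Suc n * Suc k - 1) + n))"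
        by (rule arg_cong)
      also have "\<dots> \<le> b (Suc n * Suc k - 1) * b n" by (rule b_sub)
      also have "\<dots> \<le> b n ^ Suc k * b n"
        using Suc.IH b_pos[of n] by (intro mult_right_mono) auto
      finally show ?case by (simp add: mult.commute)
    qed simp
    define \<theta> where "\<theta> = b n / q ^ Suc n"
    have \<theta>: "0 < \<theta>" "\<theta> < 1" using qn q b_pos[of n] by (auto simp: \<theta>_def)
    have "b J \<le> \<theta> ^ Suc k" if "k \<ge> J" for k
    proof -
      define N where "N = Suc n * Suc k - 1"
      have N: "J \<le> N" using that by (simp add: N_def)
      have "b J * q ^ (Suc n * Suc k) \<le> b J * q ^ (N - J)"
        using q b_pos[of J] by (intro mult_left_mono power_decreasing) (auto simp: N_def)
      also have "\<dots> \<le> b n ^ Suc k"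
        using low[of "N - J"] up[of k] N by (simp add: N_def)
      finally have "b J * (q ^ Suc n) ^ Suc k \<le> b n ^ Suc k"
        by (simp only: power_mult)
      then show ?thesis
        using q by (simp add: \<theta>_def power_divide pos_le_divide_eq del: power_Suc)
    qed
    moreover have "(\<lambda>k. \<theta> ^ Suc k) \<longlonglongrightarrow> 0"
      using \<theta> by (intro LIMSEQ_Suc LIMSEQ_power_zero) simp
    ultimately have "b J \<le> 0" by (intro LIMSEQ_le_const) auto
    with b_pos[of J] show False by simp
  qed
  obtain \<beta> where \<beta>: "b \<longlonglongrightarrow> \<beta>"
    using decseq_convergent[OF b_dec, of 1] b_ge1 by blast
  have "\<beta> \<ge> 1" using b_ge1 by (intro LIMSEQ_le_const[OF \<beta>]) auto
  with \<beta> r_pos that show ?thesis by (simp add: b_def[abs_def])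
qed

context compact_haar
begin

primrec conv_pow :: "('a \<Rightarrow> complex) \<Rightarrow> nat \<Rightarrow> 'a \<Rightarrow> complex" where
  "conv_pow F 0 = F"
| "conv_pow F (Suc n) = conv F (conv_pow F n)"

lemma conv_pow_cont: "continuous_on UNIV F \<Longrightarrow> continuous_on UNIV (conv_pow F n)"
  by (induction n) (simp_all add: conv_cont')

lemma conv_pow_conv:
  assumes F: "continuous_on UNIV F"
  shows "conv (conv_pow F m) (conv_pow F n) = conv_pow F (Suc (m + n))"
  by (induction m) (simp_all add: conv_assoc F conv_pow_cont)

lemma conv_pow_adj:
  assumes F: "continuous_on UNIV F" and adj: "adj F = F"
  shows "adj (conv_pow F n) = conv_pow F n"
proof (induction n)
  case (Suc n)
  have "adj (conv_pow F (Suc n)) = conv (conv_pow F n) F"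
    by (simp add: adj_conv F conv_pow_cont Suc adj)
  also have "\<dots> = conv_pow F (Suc n)"
    using conv_pow_conv[OF F, of n 0] by simp
  finally show ?case .
qed (simp add: adj)

lemma conv_square_diff:
  assumes f: "continuous_on UNIV f" and g: "continuous_on UNIV g"
  shows "cmod (conv f f x - conv g g x) \<le> nrm \<mu> (\<lambda>x. f x - g x) * (nrm \<mu> f + nrm \<mu> g)"
proof -
  let ?d = "\<lambda>x. f x - g x"
  have d: "continuous_on UNIV ?d" by (intro continuous_on_diff f g)
  have "conv f f x - conv g g x = conv ?d f x + conv g ?d x"
    by (simp add: conv_diff_left conv_diff_right f g)
  also have "cmod \<dots> \<le> nrm \<mu> ?d * nrm \<mu> f + nrm \<mu> g * nrm \<mu> ?d"
    by (intro norm_triangle_le add_mono conv_bound cont_sq_int d f g)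
  finally show ?thesis by (simp add: algebra_simps)
qed

lemma nrm_tendsto_uniform:
  assumes S: "\<And>n. continuous_on UNIV (S n)" and p: "continuous_on UNIV p"
    and lim: "uniform_limit UNIV S p sequentially"
  shows "(\<lambda>n. nrm \<mu> (\<lambda>x. S n x - p x)) \<longlonglongrightarrow> 0"
proof (rule LIMSEQ_I)
  fix r :: real assume r: "r > 0"
  have "\<forall>\<^sub>F n in sequentially. \<forall>x\<in>UNIV. dist (S n x) (p x) < r / 2"
    using uniform_limitD[OF lim, of "r / 2"] r by simp
  then obtain N where N: "\<And>n x. n \<ge> N \<Longrightarrow> dist (S n x) (p x) < r / 2"
    by (auto simp: eventually_sequentially)
  have "nrm \<mu> (\<lambda>x. S n x - p x) \<le> r / 2" if "n \<ge> N" for n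
    using N[OF that]
    by (intro nrm_le_bound diff_sq_int cont_sq_int S p) (simp add: dist_norm less_imp_le)
  then show "\<exists>N. \<forall>n\<ge>N. norm (nrm \<mu> (\<lambda>x. S n x - p x) - 0) < r"
    using r by (intro exI[of _ N]) fastforce
qed

text \<open>The normalized powers \<open>p\<^sub>n\<close> of odd index satisfy \<open>p\<^sub>n * p\<^sub>n = p\<^sub>2\<^sub>n\<^sub>+\<^sub>1\<close> and form an \<open>L\<^sup>2\<close>-Cauchy
  sequence, because their inner products are terms of the convergent sequence of lemma
  \<open>log_convex_submultiplicative_limit\<close>. Convolving once more turns \<open>L\<^sup>2\<close>-convergence into uniform
  convergence. The limit is the spectral projection for the eigenvalues of largest modulus of
  convolution with \<open>F\<close>.\<close>

lemma idempotent_limit: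
  assumes F: "continuous_on UNIV F" and adj: "adj F = F" and nz: "F z \<noteq> 0"
  obtains p c k where "continuous_on UNIV p" "p 0 \<noteq> 0" "conv p p = p"
    "uniform_limit UNIV (\<lambda>n x. c n * conv_pow F (k n) x) p sequentially"
proof -
  define f where "f = conv_pow F"
  have f: "continuous_on UNIV (f n)" for n
    unfolding f_def by (rule conv_pow_cont[OF F])
  have ff: "conv (f m) (f n) = f (Suc (m + n))" for m n
    unfolding f_def by (rule conv_pow_conv[OF F])
  have ipf: "ip \<mu> (f m) (f n) = f (Suc (m + n)) 0" for m n
    using conv_0[of "f m" "f n"] ff[of m n] conv_pow_adj[OF F adj] by (simp add: f_def)
  define a where "a n = (nrm \<mu> (f n))\<^sup>2" for n
  have a0: "complex_of_real (a n) = f (Suc (n + n)) 0" for n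
    using ip_self[of \<mu> "f n"] ipf[of n n] by (simp add: a_def)
  have lc: "(a (Suc n))\<^sup>2 \<le> a n * a (Suc (Suc n))" for n
  proof -
    have "cmod (complex_of_real (a (Suc n))) \<le> nrm \<mu> (f n) * nrm \<mu> (f (Suc (Suc n)))"
      using cauchy_schwarz[OF cont_sq_int[OF f] cont_sq_int[OF f], of n "Suc (Suc n)"]
      by (simp add: a0 ipf)
    then have "\<bar>a (Suc n)\<bar>\<^sup>2 \<le> (nrm \<mu> (f n) * nrm \<mu> (f (Suc (Suc n))))\<^sup>2"
      by (intro power_mono) (simp_all del: of_real_power)
    then show ?thesis by (simp add: a_def power_mult_distrib)
  qed
  have sub: "a (Suc (m + n)) \<le> a m * a n" for m n
    using power_mono[OF nrm_conv[OF f f, of m n], of 2] by (simp add: ff a_def power_mult_distrib)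
  have apos: "f n x \<noteq> 0 \<Longrightarrow> a n > 0" for n x
    using cont_nrm_eq_0[OF f, of n x] by (auto simp: a_def)
  have pos: "a n > 0 \<and> a (Suc n) > 0" for n
  proof (induction n)
    case 0
    have "a 0 > 0" using nz by (intro apos[of 0 z]) (simp add: f_def)
    moreover from this have "a (Suc 0) > 0"
      using a0[of 0] by (intro apos[of "Suc 0" 0]) auto
    ultimately show ?case ..
  next
    case (Suc n)
    then have "0 < (a (Suc n))\<^sup>2" by simp
    with lc[of n] have "0 < a n * a (Suc (Suc n))" by linarith
    with Suc show ?case by (simp add: zero_less_mult_iff)
  qed
  obtain r \<beta> where r: "r > 0" and \<beta>: "\<beta> \<ge> 1" and lim: "(\<lambda>n. a n / r ^ Suc n) \<longlonglongrightarrow> \<beta>"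
    using log_convex_submultiplicative_limit[of a] pos lc sub by blast
  define b where "b n = a n / r ^ Suc n" for n
  have b: "b \<longlonglongrightarrow> \<beta>" using lim by (simp add: b_def[abs_def])
  define p where "p n = (\<lambda>x. complex_of_real (1 / r ^ Suc n) * f (Suc (n + n)) x)" for n
  have p: "continuous_on UNIV (p n)" for n
    unfolding p_def by (intro continuous_intros f)
  have ipp: "ip \<mu> (p m) (p n) = complex_of_real (b (Suc (m + n)))" for m n
  proof -
    have "Suc (Suc (m + m) + Suc (n + n)) = Suc (Suc (m + n) + Suc (m + n))" by simp
    then have "ip \<mu> (f (Suc (m + m))) (f (Suc (n + n))) = complex_of_real (a (Suc (m + n)))"
      unfolding ipf a0 by presburger
    then have "ip \<mu> (p m) (p n) = complex_of_real (1 / r ^ Suc m) *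
        (cnj (complex_of_real (1 / r ^ Suc n)) * complex_of_real (a (Suc (m + n))))"
      by (simp only: p_def ip_scale_left ip_scale_right)
    also have "\<dots> = complex_of_real (b (Suc (m + n)))"
      by (simp add: b_def power_add mult_ac)
    finally show ?thesis .
  qed
  have nrmp: "(nrm \<mu> (p n))\<^sup>2 = b (Suc (n + n))" for n
    using ipp[of n n] unfolding ip_self by (simp only: of_real_eq_iff)
  have pp: "conv (p n) (p n) = p (Suc (n + n))" for n
  proof
    fix x
    have "conv (p n) (p n) x = complex_of_real (1 / r ^ Suc n) * complex_of_real (1 / r ^ Suc n) *
        f (Suc (Suc (n + n) + Suc (n + n))) x"
      unfolding p_def by (simp only: conv_scale ff)
    then show "conv (p n) (p n) x = p (Suc (n + n)) x"
      unfolding p_def by (simp add: power_add mult_ac)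
  qed
  obtain K where K: "\<And>n. b n \<le> K" "K > 0"
    using convergent_imp_Bseq[of b] b by (auto simp: convergent_def Bseq_def abs_le_iff)
  have nrmp_le: "nrm \<mu> (p n) \<le> sqrt K" for n
    using K(1)[of "Suc (n + n)"] nrmp[of n] real_le_rsqrt by auto
  \<comment> \<open>The convolution squares \<open>q n = p n * p n\<close> are the subsequence that converges uniformly.\<close>
  define q where "q n = p (Suc (n + n))" for n
  have q: "continuous_on UNIV (q n)" for n unfolding q_def by (rule p)
  have q_le: "nrm \<mu> (q n) \<le> sqrt K" for n unfolding q_def by (rule nrmp_le)
  have qq: "conv (q n) (q n) = q (Suc (n + n))" for n
    unfolding q_def pp by simp
  have q0: "q n 0 = complex_of_real (b (Suc (n + n)))" for n
    using a0[of "Suc (n + n)"] by (simp add: q_def p_def b_def)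
  have diffp: "(nrm \<mu> (\<lambda>x. p m x - p n x))\<^sup>2 = b (Suc (m + m)) + b (Suc (n + n)) - 2 * b (Suc (m + n))" for m n
    using nrm_diff_sq[OF cont_sq_int[OF p] cont_sq_int[OF p], of m n] by (simp add: nrmp ipp)
  have Cauchy: "uniformly_Cauchy_on UNIV q"
  proof (rule uniformly_Cauchy_onI)
    fix e :: real assume e: "e > 0"
    define \<delta> where "\<delta> = e / (2 * sqrt K)"
    have \<delta>: "\<delta> > 0" using e K by (simp add: \<delta>_def)
    have "\<forall>\<^sub>F n in sequentially. dist (b n) \<beta> < \<delta>\<^sup>2 / 4"
      using b \<delta> by (intro tendstoD) simp_all
    then obtain N where N: "\<And>n. n \<ge> N \<Longrightarrow> \<bar>b n - \<beta>\<bar> < \<delta>\<^sup>2 / 4"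
      by (auto simp: eventually_sequentially dist_real_def)
    show "\<exists>M. \<forall>x\<in>UNIV. \<forall>m\<ge>M. \<forall>n\<ge>M. dist (q m x) (q n x) < e"
    proof (intro exI[of _ N] ballI allI impI)
      fix x m n assume mn: "m \<ge> N" "n \<ge> N"
      have "(nrm \<mu> (\<lambda>x. p m x - p n x))\<^sup>2 < \<delta>\<^sup>2"
        using N[of "Suc (m + m)"] N[of "Suc (n + n)"] N[of "Suc (m + n)"] mn
        unfolding diffp abs_less_iff by simp
      from power2_less_imp_less[OF this] have less: "nrm \<mu> (\<lambda>x. p m x - p n x) < \<delta>"
        using \<delta> by simp
      have "cmod (q m x - q n x) \<le> nrm \<mu> (\<lambda>x. p m x - p n x) * (nrm \<mu> (p m) + nrm \<mu> (p n))"
        using conv_square_diff[OF p p, of m x n] by (simp add: pp q_def)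
      also have "\<dots> \<le> nrm \<mu> (\<lambda>x. p m x - p n x) * (2 * sqrt K)"
        using nrmp_le[of m] nrmp_le[of n] by (intro mult_left_mono) auto
      also have "\<dots> < \<delta> * (2 * sqrt K)"
        using less K by (intro mult_strict_right_mono) auto
      also have "\<dots> = e" using K by (simp add: \<delta>_def)
      finally show "dist (q m x) (q n x) < e" by (simp add: dist_norm)
    qed
  qed
  then obtain P where P: "uniform_limit UNIV q P sequentially"
    using Cauchy_uniformly_convergent uniformly_convergent_on_def by blast
  have Pc: "continuous_on UNIV P"
    by (rule uniform_limit_theorem[OF always_eventually P]) (simp_all add: q)
  have Pq: "(\<lambda>n. q n x) \<longlonglongrightarrow> P x" for x
    using tendsto_uniform_limitI[OF P] by simp
  have Pq_nrm: "(\<lambda>n. nrm \<mu> (\<lambda>x. q n x - P x)) \<longlonglongrightarrow> 0"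
    by (rule nrm_tendsto_uniform[OF q Pc P])
  have PP: "conv P P = P"
  proof
    fix x
    have "(\<lambda>n. conv (q n) (q n) x) \<longlonglongrightarrow> conv P P x"
    proof (rule Lim_transform2[where f="\<lambda>n. conv P P x"])
      have "cmod (conv P P x - conv (q n) (q n) x) \<le> nrm \<mu> (\<lambda>x. q n x - P x) * (sqrt K + nrm \<mu> P)" for n
      proof -
        have "cmod (conv P P x - conv (q n) (q n) x) \<le> nrm \<mu> (\<lambda>x. q n x - P x) * (nrm \<mu> (q n) + nrm \<mu> P)"
          using conv_square_diff[OF q Pc, of n x] by (simp add: norm_minus_commute)
        also have "\<dots> \<le> nrm \<mu> (\<lambda>x. q n x - P x) * (sqrt K + nrm \<mu> P)"
          using q_le[of n] by (intro mult_left_mono) auto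
        finally show ?thesis .
      qed
      then show "(\<lambda>n. conv P P x - conv (q n) (q n) x) \<longlonglongrightarrow> 0"
        by (intro Lim_null_comparison[OF _ tendsto_mult_left_zero[OF Pq_nrm]] always_eventually allI)
    qed simp
    moreover have "(\<lambda>n. conv (q n) (q n) x) \<longlonglongrightarrow> P x"
      unfolding qq
      using LIMSEQ_subseq_LIMSEQ[OF Pq[of x], of "\<lambda>n. Suc (n + n)"]
      by (simp add: o_def strict_mono_def)
    ultimately show "conv P P x = P x" by (rule LIMSEQ_unique)
  qed
  have P0: "P 0 \<noteq> 0"
  proof -
    have "(\<lambda>n. complex_of_real (b (Suc (n + n)))) \<longlonglongrightarrow> complex_of_real \<beta>"
      using LIMSEQ_subseq_LIMSEQ[OF b, of "\<lambda>n. Suc (n + n)"]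
      by (intro tendsto_of_real) (simp add: o_def strict_mono_def)
    then have "P 0 = complex_of_real \<beta>"
      using Pq[of 0] unfolding q0 by (rule LIMSEQ_unique[rotated])
    with \<beta> show ?thesis by simp
  qed
  have "uniform_limit UNIV (\<lambda>n x. complex_of_real (1 / r ^ Suc (Suc (n + n))) *
      conv_pow F (Suc (Suc (n + n) + Suc (n + n))) x) P sequentially"
    using P by (simp only: q_def[abs_def] p_def f_def)
  with Pc P0 PP show ?thesis by (rule that)
qed

lemma conv_alt:
  assumes p: "continuous_on UNIV p" and h: "continuous_on UNIV h"
  shows "conv p h x = ip \<mu> h (\<lambda>y. cnj (p (x - y)))"
proof -
  have m: "(\<lambda>y. p y * h (- y + x)) \<in> borel_measurable \<mu>"
    by (intro measurable_cont continuous_on_mult translate_cont p h)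
  have m': "(\<lambda>y. p (x - y) * h y) \<in> borel_measurable \<mu>"
    by (intro measurable_cont continuous_on_mult translate_cont p h)
  have "conv p h x = (\<integral>y. p (x + y) * h (- (x + y) + x) \<partial>\<mu>)"
    unfolding conv_def by (rule integral_translate_left[OF m, symmetric])
  also have "\<dots> = (\<integral>y. p (x - (- y)) * h (- y) \<partial>\<mu>)"
    by (simp add: minus_add diff_conv_add_uminus add.assoc del: add_uminus_conv_diff)
  also have "\<dots> = (\<integral>y. p (x - y) * h y \<partial>\<mu>)"
    by (rule integral_uminus[OF m'])
  finally show ?thesis by (simp add: ip_def mult.commute)
qed

text \<open>At each point \<open>x\<close>, Bessel's inequality for the function \<open>y \<mapsto> p(x - y)\<close> bounds \<open>\<Sum>|e\<^sub>i(x)|\<^sup>2\<close>.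
  Integration over \<open>x\<close> shows that the space of fixed points of convolution with \<open>p\<close> is
  finite-dimensional.\<close>

lemma card_orthonormal_fixed_le:
  assumes p: "continuous_on UNIV p" and e: "orthonormal \<mu> I e" and I: "finite I"
    and fp: "\<And>i. i \<in> I \<Longrightarrow> continuous_on UNIV (e i) \<and> conv p (e i) = e i"
  shows "real (card I) \<le> (nrm \<mu> p)\<^sup>2"
proof -
  define k where "k x = (\<lambda>y. cnj (p (x - y)))" for x
  have k: "k x \<in> sq_int \<mu>" "nrm \<mu> (k x) = nrm \<mu> p" for x
    unfolding k_def by (intro cont_sq_int continuous_on_cnj translate_cont p nrm_translate)+
  have pt: "(\<Sum>i\<in>I. (cmod (e i x))\<^sup>2) \<le> (nrm \<mu> p)\<^sup>2" for x
  proof -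
    have "e i x = cnj (ip \<mu> (k x) (e i))" if "i \<in> I" for i
      using conv_alt[OF p, of "e i" x] fp[OF that] ip_commute[of \<mu> "e i" "k x"] by (simp add: k_def)
    then have "(\<Sum>i\<in>I. (cmod (e i x))\<^sup>2) = (\<Sum>i\<in>I. (cmod (ip \<mu> (k x) (e i)))\<^sup>2)"
      by (intro sum.cong) auto
    also have "\<dots> \<le> (nrm \<mu> (k x))\<^sup>2" by (rule bessel[OF e I k(1)])
    finally show ?thesis by (simp add: k(2))
  qed
  have int: "integrable \<mu> (\<lambda>x. (cmod (e i x))\<^sup>2)" if "i \<in> I" for i
    using e that by (intro integrable_sq_int) (auto simp: orthonormal_def)
  have one: "(nrm \<mu> (e i))\<^sup>2 = 1" if "i \<in> I" for i
    using e that ip_self[of \<mu> "e i"] by (auto simp: orthonormal_def of_real_eq_1_iff simp del: of_real_power)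
  have "real (card I) = (\<Sum>i\<in>I. (nrm \<mu> (e i))\<^sup>2)"
    using one by simp
  also have "\<dots> = (\<integral>x. (\<Sum>i\<in>I. (cmod (e i x))\<^sup>2) \<partial>\<mu>)"
    using int by (simp add: nrm_sq)
  also have "\<dots> \<le> (\<integral>x. (nrm \<mu> p)\<^sup>2 \<partial>\<mu>)"
    using int by (intro integral_mono pt) auto
  also have "\<dots> = (nrm \<mu> p)\<^sup>2" by (simp add: prob_space[simplified])
  finally show ?thesis .
qed

end

section \<open>The Peter-Weyl theorem\<close>

lemma mat_adjoint_dims [simp]: "dim_row (mat_adjoint A) = dim_col A" "dim_col (mat_adjoint A) = dim_row A"
  by (simp_all add: mat_adjoint_def)

lemma mat_adjoint_index:
  fixes A :: "complex mat"
  assumes "i < dim_col A" "j < dim_row A"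
  shows "mat_adjoint A $$ (i, j) = cnj (A $$ (j, i))"
  using assms by (simp add: mat_adjoint_def mat_of_rows_def)

lemma unitary_mat_carrier: "unitary_mat d T \<Longrightarrow> T \<in> carrier_mat d d"
  by (simp add: unitary_mat_def)

lemma irreps_carrier: "\<xi> \<in> irreps \<Longrightarrow> \<xi> x \<in> carrier_mat (rep_dim \<xi>) (rep_dim \<xi>)"
  by (auto simp: irreps_def unitary_rep_def unitary_mat_def)

lemma irreps_add:
  assumes "\<xi> \<in> irreps" "i < rep_dim \<xi>" "j < rep_dim \<xi>"
  shows "\<xi> (x + y) $$ (i, j) = (\<Sum>k<rep_dim \<xi>. \<xi> x $$ (i, k) * \<xi> y $$ (k, j))"
proof -
  have "\<xi> (x + y) = \<xi> x * \<xi> y"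
    using assms by (auto simp: irreps_def unitary_rep_def)
  then show ?thesis
    using assms irreps_carrier[OF assms(1), of x] irreps_carrier[OF assms(1), of y]
    by (simp add: scalar_prod_def atLeast0LessThan)
qed

lemma irreps_cont:
  assumes "\<xi> \<in> irreps" "i < rep_dim \<xi>" "j < rep_dim \<xi>"
  shows "continuous_on UNIV (\<lambda>x. \<xi> x $$ (i, j))"
  using assms by (simp add: irreps_def unitary_rep_def)

lemma irreps_0:
  assumes \<xi>: "\<xi> \<in> irreps"
  shows "\<xi> 0 = 1\<^sub>m (rep_dim \<xi>)"
proof -
  let ?d = "rep_dim \<xi>"
  have c: "\<xi> 0 \<in> carrier_mat ?d ?d" "mat_adjoint (\<xi> 0) \<in> carrier_mat ?d ?d"
    using irreps_carrier[OF \<xi>, of 0] by (auto intro: carrier_matI)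
  have u: "mat_adjoint (\<xi> 0) * \<xi> 0 = 1\<^sub>m ?d" and "\<xi> 0 = \<xi> 0 * \<xi> 0"
    using \<xi> by (auto simp: irreps_def unitary_rep_def unitary_mat_def) (metis add_0)
  then have "1\<^sub>m ?d = mat_adjoint (\<xi> 0) * (\<xi> 0 * \<xi> 0)" by simp
  also have "\<dots> = (mat_adjoint (\<xi> 0) * \<xi> 0) * \<xi> 0"
    using c by (simp add: assoc_mult_mat[of _ ?d ?d _ ?d _ ?d])
  also have "\<dots> = \<xi> 0" using c u by simp
  finally show ?thesis ..
qed

lemma irreps_uminus:
  assumes \<xi>: "\<xi> \<in> irreps"
  shows "\<xi> (- x) = mat_adjoint (\<xi> x)"
proof -
  let ?d = "rep_dim \<xi>"
  have c: "\<xi> x \<in> carrier_mat ?d ?d" "\<xi> (- x) \<in> carrier_mat ?d ?d" "mat_adjoint (\<xi> x) \<in> carrier_mat ?d ?d"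
    using irreps_carrier[OF \<xi>, of x] irreps_carrier[OF \<xi>, of "- x"] by (auto intro: carrier_matI)
  have u: "mat_adjoint (\<xi> x) * \<xi> x = 1\<^sub>m ?d"
    using \<xi> by (auto simp: irreps_def unitary_rep_def unitary_mat_def)
  have inv: "\<xi> x * \<xi> (- x) = 1\<^sub>m ?d"
    using irreps_0[OF \<xi>] \<xi> by (auto simp: irreps_def unitary_rep_def) (metis add.right_inverse)
  have "\<xi> (- x) = (mat_adjoint (\<xi> x) * \<xi> x) * \<xi> (- x)" using u c by simp
  also have "\<dots> = mat_adjoint (\<xi> x) * (\<xi> x * \<xi> (- x))"
    using c by (simp add: assoc_mult_mat[of _ ?d ?d _ ?d _ ?d])
  also have "\<dots> = mat_adjoint (\<xi> x)" using inv c by simp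
  finally show ?thesis .
qed

lemma irreps_uminus_index:
  assumes \<xi>: "\<xi> \<in> irreps" "i < rep_dim \<xi>" "j < rep_dim \<xi>"
  shows "\<xi> (- x) $$ (i, j) = cnj (\<xi> x $$ (j, i))"
  using assms irreps_carrier[OF \<xi>(1), of x] by (simp add: irreps_uminus mat_adjoint_index)

context compact_haar
begin

definition inv_space :: "('a \<Rightarrow> complex) set \<Rightarrow> bool" where
  "inv_space S \<longleftrightarrow> (\<lambda>x. 0) \<in> S \<and> (\<forall>f\<in>S. continuous_on UNIV f) \<and>
     (\<forall>f\<in>S. \<forall>g\<in>S. (\<lambda>x. f x + g x) \<in> S) \<and> (\<forall>c. \<forall>f\<in>S. (\<lambda>x. c * f x) \<in> S) \<and>
     (\<forall>a. \<forall>f\<in>S. (\<lambda>x. f (x + a)) \<in> S)"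

lemma inv_space_add: "inv_space S \<Longrightarrow> f \<in> S \<Longrightarrow> g \<in> S \<Longrightarrow> (\<lambda>x. f x + g x) \<in> S"
  and inv_space_scale: "inv_space S \<Longrightarrow> f \<in> S \<Longrightarrow> (\<lambda>x. c * f x) \<in> S"
  by (simp_all add: inv_space_def)

lemma inv_space_sum:
  assumes "inv_space S" "\<And>i. i \<in> I \<Longrightarrow> e i \<in> S"
  shows "(\<lambda>x. \<Sum>i\<in>I. c i * e i x) \<in> S"
  using assms by (induction I rule: infinite_finite_induct) (simp_all add: inv_space_def)

lemma inv_space_sq_int: "inv_space S \<Longrightarrow> f \<in> S \<Longrightarrow> f \<in> sq_int \<mu>"
  by (simp add: inv_space_def cont_sq_int)

definition onb_in :: "('a \<Rightarrow> complex) set \<Rightarrow> nat \<Rightarrow> (nat \<Rightarrow> 'a \<Rightarrow> complex) \<Rightarrow> bool" where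
  "onb_in S d e \<longleftrightarrow> orthonormal \<mu> {..<d} e \<and> (\<forall>i<d. e i \<in> S)"

lemma onb_extend:
  assumes S: "inv_space S" and e: "onb_in S d e" and f: "f \<in> S"
    and nspan: "f \<noteq> (\<lambda>x. \<Sum>i<d. ip \<mu> f (e i) * e i x)"
  shows "\<exists>e'. onb_in S (Suc d) e'"
proof -
  have on: "orthonormal \<mu> {..<d} e" and eS: "\<And>i. i < d \<Longrightarrow> e i \<in> S"
    using e by (auto simp: onb_in_def)
  define s where "s = (\<lambda>x. \<Sum>i<d. ip \<mu> f (e i) * e i x)"
  have sS: "s \<in> S" unfolding s_def using eS by (intro inv_space_sum[OF S]) auto
  define g where "g = (\<lambda>x. f x + - 1 * s x)"
  have gS: "g \<in> S" unfolding g_def by (intro inv_space_add inv_space_scale S f sS)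
  have gq: "g \<in> sq_int \<mu>" and fq: "f \<in> sq_int \<mu>" and sq: "s \<in> sq_int \<mu>"
    using inv_space_sq_int[OF S] gS f sS by auto
  have eq: "e i \<in> sq_int \<mu>" if "i < d" for i using inv_space_sq_int[OF S eS[OF that]] .
  have "nrm \<mu> g \<noteq> 0"
  proof
    assume "nrm \<mu> g = 0"
    then have "g x = 0" for x
      using gS S by (intro cont_nrm_eq_0) (auto simp: inv_space_def)
    then have "f = s" by (auto simp: g_def fun_eq_iff)
    with nspan show False unfolding s_def by blast
  qed
  define h where "h = (\<lambda>x. complex_of_real (1 / nrm \<mu> g) * g x)"
  have hS: "h \<in> S" unfolding h_def by (intro inv_space_scale S gS)
  have ge: "ip \<mu> g (e i) = 0" if "i < d" for i
  proof -
    have "ip \<mu> g (e i) = ip \<mu> f (e i) - ip \<mu> s (e i)"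
      using ip_diff_left[OF fq sq eq[OF that]] by (simp add: g_def)
    also have "ip \<mu> s (e i) = ip \<mu> f (e i)"
      unfolding s_def using that by (intro ip_orthonormal_sum[OF on]) auto
    finally show ?thesis by simp
  qed
  have he: "ip \<mu> h (e i) = 0" "ip \<mu> (e i) h = 0" if "i < d" for i
  proof -
    show "ip \<mu> h (e i) = 0" unfolding h_def ip_scale_left ge[OF that] by simp
    then show "ip \<mu> (e i) h = 0" by (simp add: ip_commute[of \<mu> "e i"])
  qed
  have hh: "ip \<mu> h h = 1"
    unfolding h_def ip_scale_left ip_scale_right ip_self using \<open>nrm \<mu> g \<noteq> 0\<close>
    by (simp add: power2_eq_square)
  have "onb_in S (Suc d) (e(d := h))"
    unfolding onb_in_def orthonormal_def
  proof (intro conjI ballI allI impI)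
    fix i j assume "i \<in> {..<Suc d}" "j \<in> {..<Suc d}"
    then show "ip \<mu> ((e(d := h)) i) ((e(d := h)) j) = (if i = j then 1 else 0)"
      using on he hh by (auto simp: orthonormal_def less_Suc_eq)
  next
    fix i assume "i \<in> {..<Suc d}"
    then show "(e(d := h)) i \<in> sq_int \<mu>"
      using eq inv_space_sq_int[OF S hS] by (auto simp: less_Suc_eq)
  next
    fix i assume "i < Suc d"
    then show "(e(d := h)) i \<in> S" using eS hS by (auto simp: less_Suc_eq)
  qed
  then show ?thesis by blast
qed

text \<open>A finite-dimensional space that is invariant under right translations contains an irreducible one;
  expanding the translates of an orthonormal basis of the latter yields the matrix coefficients.\<close>

lemma irrep_in_inv_space:
  assumes W: "inv_space W" and h: "h \<in> W" "h z \<noteq> 0"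
    and fin: "\<And>d e. onb_in W d e \<Longrightarrow> d \<le> N"
  obtains \<xi> e where "\<xi> \<in> irreps" "onb_in W (rep_dim \<xi>) e"
    "\<And>j x y. j < rep_dim \<xi> \<Longrightarrow> e j (y + x) = (\<Sum>i<rep_dim \<xi>. \<xi> x $$ (i, j) * e i y)"
proof -
  \<comment> \<open>Among the nonzero invariant subspaces of \<open>W\<close> choose \<open>S\<close> of least dimension. The dimension is expressed
    by the size of a maximal orthonormal family.\<close>
  define maxdim where "maxdim S d \<longleftrightarrow> (\<exists>e. onb_in S d e) \<and> \<not> (\<exists>e. onb_in S (Suc d) e)" for S d
  define cand where "cand S \<longleftrightarrow> inv_space S \<and> S \<subseteq> W \<and> (\<exists>f\<in>S. \<exists>x. f x \<noteq> 0)" for S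
  have maxdim_ex: "\<exists>d. maxdim S d" if "S \<subseteq> W" for S
  proof -
    have bd: "d \<le> N" if ex: "\<exists>e. onb_in S d e" for d
    proof -
      obtain e where "onb_in S d e" using ex by blast
      then have "onb_in W d e" using \<open>S \<subseteq> W\<close> by (auto simp: onb_in_def)
      then show ?thesis by (rule fin)
    qed
    have ex0: "\<exists>e. onb_in S 0 e" by (simp add: onb_in_def orthonormal_def)
    define d where "d = (GREATEST d. \<exists>e. onb_in S d e)"
    have "\<exists>e. onb_in S d e"
      unfolding d_def by (rule GreatestI_nat[where P="\<lambda>d. \<exists>e. onb_in S d e" and k=0 and b=N], rule ex0) (rule bd)
    moreover have "\<not> (\<exists>e. onb_in S (Suc d) e)"
    proof
      assume "\<exists>e. onb_in S (Suc d) e"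
      then have "Suc d \<le> d"
        unfolding d_def by (rule Greatest_le_nat[where P="\<lambda>d. \<exists>e. onb_in S d e" and b=N]) (rule bd)
      then show False by simp
    qed
    ultimately show ?thesis by (auto simp: maxdim_def)
  qed
  define d where "d = (LEAST d. \<exists>S. cand S \<and> maxdim S d)"
  have "cand W" using W h by (auto simp: cand_def)
  then have "\<exists>S. cand S \<and> maxdim S d"
    unfolding d_def using maxdim_ex[of W] by (intro LeastI_ex[where P="\<lambda>d. \<exists>S. cand S \<and> maxdim S d"]) blast
  then obtain S where S: "cand S" "maxdim S d" by blast
  have least: "d \<le> d'" if "cand S'" "maxdim S' d'" for S' d'
    unfolding d_def using that by (intro Least_le[where P="\<lambda>d. \<exists>S. cand S \<and> maxdim S d"]) blast
  have Si: "inv_space S" and SW: "S \<subseteq> W" using S(1) by (auto simp: cand_def)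
  obtain e where e: "onb_in S d e" and nmax: "\<And>e. \<not> onb_in S (Suc d) e"
    using S(2) by (auto simp: maxdim_def)
  have on: "orthonormal \<mu> {..<d} e" and eS: "\<And>i. i < d \<Longrightarrow> e i \<in> S"
    using e by (auto simp: onb_in_def)
  have span: "f = (\<lambda>x. \<Sum>i<d. ip \<mu> f (e i) * e i x)" if "f \<in> S" for f
    using onb_extend[OF Si e that] nmax by blast
  have d_pos: "d > 0"
  proof (rule ccontr)
    assume "\<not> d > 0"
    then have "f x = 0" if "f \<in> S" for f x using span[OF that] by (metis lessThan_0 not_gr_zero sum.empty)
    with S(1) show False by (auto simp: cand_def)
  qed
  define c where "c x i j = ip \<mu> (\<lambda>y. e j (y + x)) (e i)" for x i j
  define \<xi> where "\<xi> x = mat d d (\<lambda>(i, j). c x i j)" for x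
  have \<xi>c: "\<xi> x \<in> carrier_mat d d" for x by (simp add: \<xi>_def)
  have rd: "rep_dim \<xi> = d" by (simp add: rep_dim_def \<xi>_def)
  have transS: "(\<lambda>y. e j (y + x)) \<in> S" if "j < d" for j x
    using Si eS[OF that] by (simp add: inv_space_def)
  have trans: "(\<lambda>y. e j (y + x)) = (\<lambda>y. \<Sum>i<d. c x i j * e i y)" if "j < d" for j x
    unfolding c_def by (rule span[OF transS[OF that]])
  have trans': "e j (y + x) = (\<Sum>i<d. c x i j * e i y)" if "j < d" for j x y
    using fun_cong[OF trans[OF that, of x], of y] .
  have coef: "ip \<mu> (\<lambda>y. \<Sum>i<d. v i * e i y) (e k) = v k" if "k < d" for v k
    using that by (intro ip_orthonormal_sum[OF on]) auto
  have ec: "continuous_on UNIV (e i)" if "i < d" for i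
    using eS[OF that] Si by (simp add: inv_space_def)
  have hom: "c (x + z) i j = (\<Sum>k<d. c x i k * c z k j)" if "i < d" "j < d" for x z i j
  proof -
    have "(\<lambda>y. e j (y + (x + z))) = (\<lambda>y. \<Sum>i<d. (\<Sum>k<d. c x i k * c z k j) * e i y)"
    proof
      fix y
      have "e j (y + (x + z)) = (\<Sum>k<d. c z k j * e k (y + x))"
        using trans'[OF that(2), of "y + x" z] by (simp add: add.assoc)
      also have "\<dots> = (\<Sum>k<d. \<Sum>i<d. c z k j * (c x i k * e i y))"
        by (intro sum.cong refl) (simp add: trans' sum_distrib_left)
      also have "\<dots> = (\<Sum>i<d. (\<Sum>k<d. c x i k * c z k j) * e i y)"
        by (subst sum.swap) (simp add: sum_distrib_left sum_distrib_right mult_ac)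
      finally show "e j (y + (x + z)) = (\<Sum>i<d. (\<Sum>k<d. c x i k * c z k j) * e i y)" .
    qed
    then show ?thesis
      unfolding c_def[of "x + z"] by (simp only: coef[OF that(1)])
  qed
  have unit: "(\<Sum>k<d. cnj (c x k i) * c x k j) = (if i = j then 1 else 0)" if "i < d" "j < d" for x i j
  proof -
    have "ip \<mu> (\<lambda>y. e j (y + x)) (\<lambda>y. e i (y + x)) = ip \<mu> (e j) (e i)"
      unfolding ip_def
      by (rule integral_translate_right)
        (intro measurable_cont continuous_on_mult continuous_on_cnj ec that)
    then have "ip \<mu> (\<lambda>y. e j (y + x)) (\<lambda>y. e i (y + x)) = (if i = j then 1 else 0)"
      using on that by (auto simp: orthonormal_def)
    moreover have "ip \<mu> (\<lambda>y. e j (y + x)) (\<lambda>y. e i (y + x)) = (\<Sum>k<d. cnj (c x k i) * ip \<mu> (\<lambda>y. e j (y + x)) (e k))"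
      unfolding trans[OF that(1)]
      by (rule ip_sum_right) (use that eS transS inv_space_sq_int[OF Si] in auto)
    ultimately show ?thesis by (simp add: c_def)
  qed
  have uni: "unitary_mat d (\<xi> x)" for x
  proof -
    have adjc: "mat_adjoint (\<xi> x) \<in> carrier_mat d d"
      using \<xi>c[of x] by (intro carrier_matI) auto
    have 1: "mat_adjoint (\<xi> x) * \<xi> x = 1\<^sub>m d"
    proof (rule eq_matI)
      fix i j assume "i < dim_row (1\<^sub>m d)" "j < dim_col (1\<^sub>m d)"
      then have ij: "i < d" "j < d" by simp_all
      have "(mat_adjoint (\<xi> x) * \<xi> x) $$ (i, j) = (\<Sum>k<d. cnj (c x k i) * c x k j)"
        using ij \<xi>c[of x] adjc
        by (simp add: scalar_prod_def atLeast0LessThan mat_adjoint_index) (simp add: \<xi>_def)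
      then show "(mat_adjoint (\<xi> x) * \<xi> x) $$ (i, j) = 1\<^sub>m d $$ (i, j)"
        using unit[OF ij] ij by simp
    qed (use \<xi>c[of x] adjc in auto)
    then show ?thesis
      unfolding unitary_mat_def using \<xi>c[of x] mat_mult_left_right_inverse[OF adjc \<xi>c] by blast
  qed
  have urep: "unitary_rep \<xi>"
    unfolding unitary_rep_def rd
  proof (intro conjI allI impI)
    show "unitary_mat d (\<xi> x)" for x by (rule uni)
    show "\<xi> (x + y) = \<xi> x * \<xi> y" for x y
      by (rule eq_matI) (simp_all add: \<xi>_def scalar_prod_def atLeast0LessThan hom)
    fix i j assume ij: "i < d" "j < d"
    have "(\<lambda>x. \<xi> x $$ (i, j)) = conv (adj (e i)) (e j)"
    proof
      fix x
      have "(\<lambda>y. e j (y + x) * cnj (e i y)) \<in> borel_measurable \<mu>"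
        by (intro measurable_cont continuous_on_mult continuous_on_cnj translate_cont ec ij)
      from integral_uminus[OF this]
      show "\<xi> x $$ (i, j) = conv (adj (e i)) (e j) x"
        using ij by (simp add: \<xi>_def c_def ip_def conv_def adj_def mult.commute)
    qed
    then show "continuous_on UNIV (\<lambda>x. \<xi> x $$ (i, j))"
      by (simp only:) (intro conv_cont' adj_cont ec ij)
  qed
  have irr: "irreducible_rep \<xi>"
    unfolding irreducible_rep_def rd
  proof (intro conjI allI impI)
    show "0 < d" by (rule d_pos)
    fix U assume U: "VectorSpace.subspace class_ring U (module_vec TYPE(complex) d) \<and> (\<forall>x. \<forall>v\<in>U. \<xi> x *\<^sub>v v \<in> U)"
    then have "submodule class_ring U (module_vec TYPE(complex) d)"
      by (simp add: VectorSpace.subspace_def)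
    then have Uc: "U \<subseteq> carrier_vec d" and U0: "0\<^sub>v d \<in> U"
      and Uadd: "\<And>v w. v \<in> U \<Longrightarrow> w \<in> U \<Longrightarrow> v + w \<in> U" and Usm: "\<And>a v. v \<in> U \<Longrightarrow> a \<cdot>\<^sub>v v \<in> U"
      by (auto simp: submodule_def module_vec_simps class_ring_simps)
    have Uinv: "\<And>x v. v \<in> U \<Longrightarrow> \<xi> x *\<^sub>v v \<in> U" using U by blast
    \<comment> \<open>\<open>L\<close> turns an invariant space of coordinate vectors into an invariant subspace of \<open>S\<close>, which is
      all of \<open>S\<close> by minimality.\<close>
    define L where "L v = (\<lambda>y. \<Sum>i<d. v $ i * e i y)" for v :: "complex vec"
    have L_inj: "v = w" if "L v = L w" "v \<in> carrier_vec d" "w \<in> carrier_vec d" for v w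
    proof (rule eq_vecI)
      fix i assume "i < dim_vec w"
      then have "i < d" using that by simp
      then show "v $ i = w $ i"
        using coef[of i "\<lambda>i. v $ i"] coef[of i "\<lambda>i. w $ i"] that(1) by (simp add: L_def)
    qed (use that in auto)
    show "U = {0\<^sub>v d} \<or> U = carrier_vec d"
    proof (cases "U = {0\<^sub>v d}")
      case False
      then obtain v where v: "v \<in> U" "v \<noteq> 0\<^sub>v d" using U0 by blast
      define S' where "S' = L ` U"
      have S'S: "S' \<subseteq> S"
        unfolding S'_def L_def using eS by (auto intro!: inv_space_sum[OF Si])
      have S'i: "inv_space S'"
        unfolding inv_space_def
      proof (intro conjI ballI allI)
        have "L (0\<^sub>v d) = (\<lambda>x. 0)" by (simp add: L_def)
        then show "(\<lambda>x. 0) \<in> S'" using U0 unfolding S'_def by (metis imageI)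
      next
        fix f assume "f \<in> S'"
        then show "continuous_on UNIV f" using S'S Si by (auto simp: inv_space_def)
      next
        fix f g assume "f \<in> S'" "g \<in> S'"
        then obtain u w where uw: "u \<in> U" "w \<in> U" "f = L u" "g = L w" by (auto simp: S'_def)
        have "L (u + w) = (\<lambda>x. f x + g x)"
          using uw Uc by (auto simp: L_def fun_eq_iff distrib_right sum.distrib intro!: sum.cong)
        then show "(\<lambda>x. f x + g x) \<in> S'" using Uadd[OF uw(1,2)] unfolding S'_def by (metis imageI)
      next
        fix a f assume "f \<in> S'"
        then obtain u where u: "u \<in> U" "f = L u" by (auto simp: S'_def)
        have "L (a \<cdot>\<^sub>v u) = (\<lambda>x. a * f x)"
          using u Uc by (auto simp: L_def fun_eq_iff sum_distrib_left mult.assoc intro!: sum.cong)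
        then show "(\<lambda>x. a * f x) \<in> S'" using Usm[OF u(1)] unfolding S'_def by (metis imageI)
      next
        fix x f assume "f \<in> S'"
        then obtain u where u: "u \<in> U" "f = L u" by (auto simp: S'_def)
        then have uc: "u \<in> carrier_vec d" using Uc by blast
        have "L (\<xi> x *\<^sub>v u) y = f (y + x)" for y
        proof -
          have "f (y + x) = (\<Sum>j<d. u $ j * (\<Sum>i<d. c x i j * e i y))"
            unfolding u(2) L_def by (intro sum.cong refl) (simp add: trans')
          also have "\<dots> = (\<Sum>i<d. (\<Sum>j<d. c x i j * u $ j) * e i y)"
            by (simp add: sum_distrib_left sum_distrib_right mult_ac) (rule sum.swap)
          also have "\<dots> = L (\<xi> x *\<^sub>v u) y"
            unfolding L_def using uc
            by (intro sum.cong refl) (simp add: \<xi>_def scalar_prod_def atLeast0LessThan)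
          finally show ?thesis ..
        qed
        then have "L (\<xi> x *\<^sub>v u) = (\<lambda>y. f (y + x))" by (rule ext)
        then show "(\<lambda>y. f (y + x)) \<in> S'"
          using imageI[OF Uinv[OF u(1), of x], of L] by (simp only: S'_def)
      qed
      have "\<exists>f\<in>S'. \<exists>x. f x \<noteq> 0"
      proof (rule ccontr)
        assume "\<not> ?thesis"
        then have "L v = L (0\<^sub>v d)" using v(1) by (auto simp: S'_def L_def fun_eq_iff)
        then show False using L_inj[of v "0\<^sub>v d"] v Uc by auto
      qed
      then have "cand S'" using S'i S'S SW by (auto simp: cand_def)
      moreover obtain d' where d': "maxdim S' d'" using maxdim_ex S'S SW by blast
      ultimately have "d \<le> d'" by (rule least)
      obtain e' where "onb_in S' d' e'" using d' by (auto simp: maxdim_def)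
      then have e': "onb_in S' d e'"
        using \<open>d \<le> d'\<close> orthonormal_subset[of \<mu> "{..<d'}" e' "{..<d}"] by (auto simp: onb_in_def)
      have S'_eq: "f \<in> S'" if "f \<in> S" for f
      proof -
        have "onb_in S d e'" using e' S'S by (auto simp: onb_in_def)
        then have "f = (\<lambda>x. \<Sum>i<d. ip \<mu> f (e' i) * e' i x)"
          using onb_extend[OF Si _ that] nmax by blast
        moreover have "(\<lambda>x. \<Sum>i<d. ip \<mu> f (e' i) * e' i x) \<in> S'"
          using e' by (intro inv_space_sum[OF S'i]) (auto simp: onb_in_def)
        ultimately show ?thesis by simp
      qed
      have "w \<in> U" if w: "w \<in> carrier_vec d" for w
      proof -
        have "L w \<in> S" unfolding L_def using eS by (intro inv_space_sum[OF Si]) auto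
        then obtain u where "u \<in> U" "L w = L u" using S'_eq by (auto simp: S'_def)
        then show ?thesis using L_inj[of w u] w Uc by auto
      qed
      then show ?thesis using Uc by blast
    qed simp
  qed
  show ?thesis
  proof
    show "\<xi> \<in> irreps" using urep irr by (simp add: irreps_def)
    show "onb_in W (rep_dim \<xi>) e" unfolding rd using e SW by (auto simp: onb_in_def)
    show "e j (y + x) = (\<Sum>i<rep_dim \<xi>. \<xi> x $$ (i, j) * e i y)" if "j < rep_dim \<xi>" for j x y
      using trans'[of j y x] that unfolding rd by (simp add: \<xi>_def)
  qed
qed

lemma coefficient_sq_int:
  "\<xi> \<in> irreps \<Longrightarrow> i < rep_dim \<xi> \<Longrightarrow> j < rep_dim \<xi> \<Longrightarrow> (\<lambda>x. \<xi> x $$ (i, j)) \<in> sq_int \<mu>"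
  by (intro cont_sq_int irreps_cont)

text \<open>Fubini's theorem, left invariance and multiplicativity of the representation.\<close>

lemma ip_conv_coefficient:
  assumes f: "f \<in> sq_int \<mu>" and g: "continuous_on UNIV g"
    and \<xi>: "\<xi> \<in> irreps" and i: "i < rep_dim \<xi>" and j: "j < rep_dim \<xi>"
  shows "ip \<mu> (conv f g) (\<lambda>x. \<xi> x $$ (i, j)) =
    (\<Sum>k<rep_dim \<xi>. ip \<mu> f (\<lambda>x. \<xi> x $$ (i, k)) * ip \<mu> g (\<lambda>x. \<xi> x $$ (k, j)))"
proof -
  have int_f: "integrable \<mu> f" by (rule integrable_sq_int1[OF f])
  have gk: "g \<in> sq_int \<mu>" by (rule cont_sq_int[OF g])
  have "ip \<mu> (conv f g) (\<lambda>x. \<xi> x $$ (i, j)) = (\<integral>x. (\<integral>y. f y * (g (- y + x) * cnj (\<xi> x $$ (i, j))) \<partial>\<mu>) \<partial>\<mu>)"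
    unfolding ip_def conv_def by (simp add: mult.assoc flip: integral_mult_left_zero)
  also have "\<dots> = (\<integral>y. f y * (\<integral>x. g (- y + x) * cnj (\<xi> x $$ (i, j)) \<partial>\<mu>) \<partial>\<mu>)"
  proof (rule fubini_cont[OF int_f])
    show "continuous_on UNIV (\<lambda>(x, y). g (- y + x) * cnj (\<xi> x $$ (i, j)))"
      unfolding split_def
      by (intro continuous_on_mult continuous_on_cnj continuous_on_compose2[OF g]
          continuous_on_compose2[OF irreps_cont[OF \<xi> i j]] continuous_intros) auto
  qed
  also have "\<dots> = (\<integral>y. (\<Sum>k<rep_dim \<xi>. f y * cnj (\<xi> y $$ (i, k)) * ip \<mu> g (\<lambda>x. \<xi> x $$ (k, j))) \<partial>\<mu>)"
  proof (rule Bochner_Integration.integral_cong[OF refl])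
    fix y
    have "(\<lambda>x. g (- y + x) * cnj (\<xi> x $$ (i, j))) \<in> borel_measurable \<mu>"
      by (intro measurable_cont continuous_on_mult continuous_on_cnj translate_cont g irreps_cont \<xi> i j)
    from integral_translate_left[OF this, of y]
    have "(\<integral>x. g (- y + x) * cnj (\<xi> x $$ (i, j)) \<partial>\<mu>) = (\<integral>x. g x * cnj (\<xi> (y + x) $$ (i, j)) \<partial>\<mu>)"
      by (simp add: add.assoc[symmetric])
    also have "\<dots> = (\<integral>x. (\<Sum>k<rep_dim \<xi>. cnj (\<xi> y $$ (i, k)) * (g x * cnj (\<xi> x $$ (k, j)))) \<partial>\<mu>)"
      by (simp add: irreps_add[OF \<xi> i j] sum_distrib_left mult_ac)
    also have "\<dots> = (\<Sum>k<rep_dim \<xi>. cnj (\<xi> y $$ (i, k)) * ip \<mu> g (\<lambda>x. \<xi> x $$ (k, j)))"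
      using integrable_ip[OF gk coefficient_sq_int[OF \<xi> _ j]]
      by (simp add: ip_def)
    finally show "f y * (\<integral>x. g (- y + x) * cnj (\<xi> x $$ (i, j)) \<partial>\<mu>) =
        (\<Sum>k<rep_dim \<xi>. f y * cnj (\<xi> y $$ (i, k)) * ip \<mu> g (\<lambda>x. \<xi> x $$ (k, j)))"
      by (simp add: sum_distrib_left mult.assoc)
  qed
  also have "\<dots> = (\<Sum>k<rep_dim \<xi>. ip \<mu> f (\<lambda>x. \<xi> x $$ (i, k)) * ip \<mu> g (\<lambda>x. \<xi> x $$ (k, j)))"
    using integrable_ip[OF f coefficient_sq_int[OF \<xi> i]] by (simp add: ip_def)
  finally show ?thesis .
qed

definition coeffs_vanish :: "('a \<Rightarrow> complex) \<Rightarrow> bool" where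
  "coeffs_vanish f \<longleftrightarrow>
     (\<forall>\<xi>\<in>irreps. \<forall>i<rep_dim \<xi>. \<forall>j<rep_dim \<xi>. ip \<mu> f (\<lambda>x. \<xi> x $$ (i, j)) = 0)"

lemma coeffs_vanish_conv:
  assumes "f \<in> sq_int \<mu>" "continuous_on UNIV g" "coeffs_vanish f \<or> coeffs_vanish g"
  shows "coeffs_vanish (conv f g)"
  using assms by (auto simp: coeffs_vanish_def ip_conv_coefficient intro!: sum.neutral)

text \<open>If the coefficients of a nonzero continuous \<open>g\<close> vanished, so would those of all convolution powers
  of \<open>g\<^sup>* * g\<close>, of the idempotent \<open>p\<close> that they produce and of every fixed point of convolution with
  \<open>p\<close>. But some nonzero fixed point is a combination of coefficients of an irreducible representation,
  so it would be orthogonal to itself.\<close>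

theorem peter_weyl_continuous:
  assumes g: "continuous_on UNIV g" and van: "coeffs_vanish g"
  shows "g x = 0"
proof (rule ccontr)
  assume gx: "g x \<noteq> 0"
  define F where "F = conv (adj g) g"
  have F: "continuous_on UNIV F" unfolding F_def by (intro conv_cont' adj_cont g)
  have adjF: "adj F = F" unfolding F_def by (simp add: adj_conv adj_cont g)
  have "F 0 = complex_of_real ((nrm \<mu> g)\<^sup>2)"
    unfolding F_def conv_0 ip_self nrm_translate(3)[OF g] ..
  then have F0: "F 0 \<noteq> 0" using cont_nrm_eq_0[OF g, of x] gx by auto
  obtain p c k where p: "continuous_on UNIV p" "p 0 \<noteq> 0" "conv p p = p"
    and lim: "uniform_limit UNIV (\<lambda>n x. c n * conv_pow F (k n) x) p sequentially"
    using idempotent_limit[OF F adjF F0] by blast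
  have pow: "coeffs_vanish (conv_pow F n)" for n
  proof (induction n)
    case 0
    show ?case
      using coeffs_vanish_conv[OF cont_sq_int[OF adj_cont[OF g]] g] van by (simp add: F_def)
  next
    case (Suc n)
    then show ?case
      using coeffs_vanish_conv[OF cont_sq_int[OF F] conv_pow_cont[OF F]] by simp
  qed
  have p_van: "coeffs_vanish p"
    unfolding coeffs_vanish_def
  proof (intro ballI allI impI)
    fix \<xi> :: "'a \<Rightarrow> complex mat" and i j
    assume \<xi>: "\<xi> \<in> irreps" "i < rep_dim \<xi>" "j < rep_dim \<xi>"
    let ?q = "\<lambda>n x. c n * conv_pow F (k n) x"
    have q: "continuous_on UNIV (?q n)" for n
      by (intro continuous_intros conv_pow_cont F)
    have "(\<lambda>n. nrm \<mu> (\<lambda>x. ?q n x - p x)) \<longlonglongrightarrow> 0"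
      by (rule nrm_tendsto_uniform[OF q p(1) lim])
    from ip_tendsto_left[OF cont_sq_int[OF p(1)] cont_sq_int[OF q] coefficient_sq_int[OF \<xi>] this]
    have "(\<lambda>n. ip \<mu> (?q n) (\<lambda>x. \<xi> x $$ (i, j))) \<longlonglongrightarrow> ip \<mu> p (\<lambda>x. \<xi> x $$ (i, j))" .
    moreover have "ip \<mu> (?q n) (\<lambda>x. \<xi> x $$ (i, j)) = 0" for n
      using pow[of "k n"] \<xi> by (simp add: ip_scale_left coeffs_vanish_def)
    ultimately show "ip \<mu> p (\<lambda>x. \<xi> x $$ (i, j)) = 0" by (simp add: LIMSEQ_const_iff)
  qed
  define W where "W = {h. continuous_on UNIV h \<and> conv p h = h}"
  have conv_trans: "conv p (\<lambda>x. h (x + a)) x = conv p h (x + a)" for h a x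
    by (simp add: conv_def add.assoc)
  have W: "inv_space W"
    unfolding inv_space_def W_def
  proof (intro conjI ballI allI CollectI; (elim CollectE conjE)?)
    fix f h assume fh: "continuous_on UNIV f" "conv p f = f" "continuous_on UNIV h" "conv p h = h"
    show "continuous_on UNIV (\<lambda>x. f x + h x)" by (intro continuous_intros fh)
    have "conv p (\<lambda>x. f x - - 1 * h x) x = conv p f x - conv p (\<lambda>x. - 1 * h x) x" for x
      by (intro conv_diff_right continuous_intros fh p)
    moreover have "conv p (\<lambda>x. - 1 * h x) x = - 1 * h x" for x
      using conv_scale[of 1 p "-1" h x] fh by simp
    ultimately show "conv p (\<lambda>x. f x + h x) = (\<lambda>x. f x + h x)" using fh by auto
  next
    fix a f assume fh: "continuous_on UNIV f" "conv p f = f"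
    show "continuous_on UNIV (\<lambda>x. a * f x)" by (intro continuous_intros fh)
    show "conv p (\<lambda>x. a * f x) = (\<lambda>x. a * f x)"
      using conv_scale[of 1 p a f] fh by (auto simp: fun_eq_iff)
  next
    fix a f assume fh: "continuous_on UNIV f" "conv p f = f"
    show "continuous_on UNIV (\<lambda>x. f (x + a))" by (intro translate_cont fh)
    show "conv p (\<lambda>x. f (x + a)) = (\<lambda>x. f (x + a))"
      using conv_trans[of f a] fh by auto
  qed (simp_all add: conv_def fun_eq_iff)
  have fin: "d \<le> nat \<lfloor>(nrm \<mu> p)\<^sup>2\<rfloor>" if "onb_in W d e" for d e
  proof -
    have "real (card {..<d}) \<le> (nrm \<mu> p)\<^sup>2"
      using that by (intro card_orthonormal_fixed_le[OF p(1)]) (auto simp: onb_in_def W_def)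
    then show ?thesis by (simp add: le_nat_floor)
  qed
  have "p \<in> W" using p by (simp add: W_def)
  obtain \<xi> e where \<xi>: "\<xi> \<in> irreps" and e: "onb_in W (rep_dim \<xi>) e"
    and ex: "\<And>j x y. j < rep_dim \<xi> \<Longrightarrow> e j (y + x) = (\<Sum>i<rep_dim \<xi>. \<xi> x $$ (i, j) * e i y)"
    by (rule irrep_in_inv_space[OF W \<open>p \<in> W\<close> p(2)]) (rule fin, assumption, blast)
  have pos: "0 < rep_dim \<xi>" using \<xi> by (simp add: irreps_def irreducible_rep_def)
  have e0W: "e 0 \<in> W" using e pos by (simp add: onb_in_def)
  have e0: "continuous_on UNIV (e 0)" "conv p (e 0) = e 0" using e0W by (auto simp: W_def)
  have "coeffs_vanish (conv p (e 0))"
    using p_van by (intro coeffs_vanish_conv cont_sq_int p e0) simp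
  then have "coeffs_vanish (e 0)" using e0 by simp
  moreover have "e 0 = (\<lambda>x. \<Sum>i<rep_dim \<xi>. e i 0 * \<xi> x $$ (i, 0))"
    using ex[OF pos, of 0] by (auto simp: mult.commute)
  then have "ip \<mu> (e 0) (e 0) = ip \<mu> (e 0) (\<lambda>x. \<Sum>i<rep_dim \<xi>. e i 0 * \<xi> x $$ (i, 0))"
    by simp
  then have "ip \<mu> (e 0) (e 0) = (\<Sum>i<rep_dim \<xi>. cnj (e i 0) * ip \<mu> (e 0) (\<lambda>x. \<xi> x $$ (i, 0)))"
    using pos \<xi> by (subst (asm) ip_sum_right) (auto intro: coefficient_sq_int cont_sq_int e0)
  ultimately have "ip \<mu> (e 0) (e 0) = 0"
    using \<xi> pos by (simp add: coeffs_vanish_def)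
  moreover have "ip \<mu> (e 0) (e 0) = 1"
    using e pos by (simp add: onb_in_def orthonormal_def)
  ultimately show False by simp
qed

text \<open>For square-integrable \<open>f\<close> the convolutions \<open>f * h\<close> with continuous \<open>h\<close> are continuous, and their
  values at the neutral element are the integrals of \<open>f\<close> against continuous functions.\<close>

theorem peter_weyl:
  assumes f: "f \<in> sq_int \<mu>" and van: "coeffs_vanish f"
  shows "nrm \<mu> f = 0"
proof -
  have int_f: "integrable \<mu> f" by (rule integrable_sq_int1[OF f])
  have "(\<integral>x. f x * h x \<partial>\<mu>) = 0" if h: "continuous_on UNIV h" for h
  proof -
    have h': "continuous_on UNIV (\<lambda>y. h (- y))" by (intro translate_cont h)
    have "conv f (\<lambda>y. h (- y)) 0 = 0"
      using van by (intro peter_weyl_continuous conv_cont[OF int_f] coeffs_vanish_conv f h') simp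
    then show ?thesis by (simp add: conv_def)
  qed
  from AE_zero_if_orthogonal_cont[OF int_f this] show ?thesis
    using nrm_eq_0_AE[OF f] by blast
qed

end

section \<open>Schur orthogonality and the Parseval inequality\<close>

lemma mat_adjoint_carrier [intro]: "A \<in> carrier_mat n k \<Longrightarrow> mat_adjoint A \<in> carrier_mat k n"
  by (intro carrier_matI) auto

lemma mat_adjoint_adjoint [simp]: "mat_adjoint (mat_adjoint A) = (A :: complex mat)"
  by (rule eq_matI) (simp_all add: mat_adjoint_index)

lemma mat_adjoint_mult:
  fixes A B :: "complex mat"
  assumes "A \<in> carrier_mat n k" "B \<in> carrier_mat k l"
  shows "mat_adjoint (A * B) = mat_adjoint B * mat_adjoint A"
  using assms
  by (intro eq_matI) (simp_all add: mat_adjoint_index scalar_prod_def mult.commute)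

lemma mat_adjoint_smult:
  fixes A :: "complex mat"
  shows "mat_adjoint (c \<cdot>\<^sub>m A) = cnj c \<cdot>\<^sub>m mat_adjoint A"
  by (rule eq_matI) (simp_all add: mat_adjoint_index)

lemma mat_adjoint_one [simp]: "mat_adjoint (1\<^sub>m d :: complex mat) = 1\<^sub>m d"
  by (rule eq_matI) (auto simp: mat_adjoint_index)

lemma unitary_mat_adjoint: "unitary_mat d T \<Longrightarrow> unitary_mat d (mat_adjoint T)"
  by (auto simp: unitary_mat_def)

lemma unitary_mat_mult:
  assumes "unitary_mat d S" "unitary_mat d T"
  shows "unitary_mat d (S * T)"
proof -
  have S: "S \<in> carrier_mat d d" "mat_adjoint S \<in> carrier_mat d d" and T: "T \<in> carrier_mat d d" "mat_adjoint T \<in> carrier_mat d d"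
    using assms by (auto simp: unitary_mat_def)
  have "S * T * (mat_adjoint T * mat_adjoint S) = S * (T * mat_adjoint T) * mat_adjoint S"
    using S T by (simp add: assoc_mult_mat[of _ d d _ d _ d])
  moreover have "mat_adjoint T * mat_adjoint S * (S * T) = mat_adjoint T * (mat_adjoint S * S) * T"
    using S T by (simp add: assoc_mult_mat[of _ d d _ d _ d])
  ultimately show ?thesis
    using assms S T by (simp add: unitary_mat_def mat_adjoint_mult[of _ d d _ d])
qed

text \<open>An eigenspace of an operator that commutes with an irreducible representation is invariant.\<close>

lemma schur_scalar:
  assumes \<xi>: "\<xi> \<in> irreps" and A: "A \<in> carrier_mat (rep_dim \<xi>) (rep_dim \<xi>)"
    and comm: "\<And>x. \<xi> x * A = A * \<xi> x"
  obtains c where "A = c \<cdot>\<^sub>m 1\<^sub>m (rep_dim \<xi>)"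
proof -
  define d where "d = rep_dim \<xi>"
  have A: "A \<in> carrier_mat d d" and \<xi>c: "\<xi> x \<in> carrier_mat d d" for x
    using A irreps_carrier[OF \<xi>] by (auto simp: d_def)
  have pos: "d > 0" and irr: "\<And>W. VectorSpace.subspace class_ring W (module_vec TYPE(complex) d) \<Longrightarrow>
      (\<And>x v. v \<in> W \<Longrightarrow> \<xi> x *\<^sub>v v \<in> W) \<Longrightarrow> W = {0\<^sub>v d} \<or> W = carrier_vec d"
    using \<xi> by (auto simp: irreps_def irreducible_rep_def d_def)
  obtain c v where v: "v \<in> carrier_vec d" "v \<noteq> 0\<^sub>v d" "A *\<^sub>v v = c \<cdot>\<^sub>v v"
    using spectrum_non_empty[OF A pos] A by (auto simp: spectrum_def eigenvalue_def eigenvector_def)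
  define U where "U = {v \<in> carrier_vec d. A *\<^sub>v v = c \<cdot>\<^sub>v v}"
  have "U = {0\<^sub>v d} \<or> U = carrier_vec d"
  proof (rule irr)
    have "submodule class_ring U (module_vec TYPE(complex) d)"
    proof (rule submodule.intro)
      show "module class_ring (module_vec TYPE(complex) d)" by (rule vec_module)
    qed (use A in \<open>auto simp: U_def module_vec_simps class_ring_simps mult_add_distrib_mat_vec
          smult_add_distrib_vec mult_mat_vec smult_smult_assoc mult.commute\<close>)
    then show "VectorSpace.subspace class_ring U (module_vec TYPE(complex) d)"
      by (simp add: VectorSpace.subspace_def vec_vs)
    fix x w assume "w \<in> U"
    then have w: "w \<in> carrier_vec d" "A *\<^sub>v w = c \<cdot>\<^sub>v w" by (auto simp: U_def)
    have "A *\<^sub>v (\<xi> x *\<^sub>v w) = (A * \<xi> x) *\<^sub>v w"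
      using A \<xi>c w by (simp add: assoc_mult_mat_vec[of _ d d _ d])
    also have "\<dots> = \<xi> x *\<^sub>v (A *\<^sub>v w)"
      unfolding comm[symmetric] using A \<xi>c w by (simp add: assoc_mult_mat_vec[of _ d d _ d])
    also have "\<dots> = c \<cdot>\<^sub>v (\<xi> x *\<^sub>v w)"
      using w \<xi>c[of x] by (simp add: mult_mat_vec)
    finally show "\<xi> x *\<^sub>v w \<in> U" using \<xi>c[of x] w by (auto simp: U_def)
  qed
  then have U: "U = carrier_vec d" using v by (auto simp: U_def)
  have "A = c \<cdot>\<^sub>m 1\<^sub>m d"
  proof (rule eq_matI)
    fix i j assume "i < dim_row (c \<cdot>\<^sub>m 1\<^sub>m d)" "j < dim_col (c \<cdot>\<^sub>m 1\<^sub>m d)"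
    then have ij: "i < d" "j < d" by simp_all
    have "unit_vec d j \<in> U" by (simp add: U)
    then have "A *\<^sub>v unit_vec d j = c \<cdot>\<^sub>v unit_vec d j" by (simp add: U_def)
    then have "(A *\<^sub>v unit_vec d j) $ i = (c \<cdot>\<^sub>v unit_vec d j) $ i" by simp
    then show "A $$ (i, j) = (c \<cdot>\<^sub>m 1\<^sub>m d) $$ (i, j)"
      using A ij by simp
  qed (use A in auto)
  then show ?thesis using that by (simp add: d_def)
qed

lemma irreps_intertwiner_adjoint:
  assumes \<xi>: "\<xi> \<in> irreps" and \<eta>: "\<eta> \<in> irreps" and T: "T \<in> carrier_mat (rep_dim \<xi>) (rep_dim \<eta>)"
    and inter: "\<And>z. \<xi> z * T = T * \<eta> z"
  shows "\<eta> z * mat_adjoint T = mat_adjoint T * \<xi> z"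
proof -
  have "mat_adjoint (\<xi> (- z) * T) = mat_adjoint (T * \<eta> (- z))" by (simp add: inter)
  then have "mat_adjoint T * mat_adjoint (\<xi> (- z)) = mat_adjoint (\<eta> (- z)) * mat_adjoint T"
    by (simp add: mat_adjoint_mult[OF irreps_carrier[OF \<xi>] T] mat_adjoint_mult[OF T irreps_carrier[OF \<eta>]])
  then show ?thesis by (simp add: irreps_uminus \<xi> \<eta>)
qed

text \<open>For an intertwiner \<open>T\<close> both \<open>T\<^sup>* T\<close> and \<open>T T\<^sup>*\<close> are scalar by lemma \<open>schur_scalar\<close>. If \<open>T\<close> is nonzero,
  the two scalars agree, comparing traces shows that the dimensions agree, and \<open>T\<close> is a multiple of
  a unitary matrix.\<close>

lemma schur_inequivalent:
  assumes \<xi>: "\<xi> \<in> irreps" and \<eta>: "\<eta> \<in> irreps" and T: "T \<in> carrier_mat (rep_dim \<xi>) (rep_dim \<eta>)"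
    and inter: "\<And>z. \<xi> z * T = T * \<eta> z" and nz: "i < rep_dim \<xi>" "l < rep_dim \<eta>" "T $$ (i, l) \<noteq> 0"
  shows "(\<xi>, \<eta>) \<in> rep_equiv"
proof -
  define d e where "d = rep_dim \<xi>" and "e = rep_dim \<eta>"
  define S where "S = mat_adjoint T"
  have T: "T \<in> carrier_mat d e" and S: "S \<in> carrier_mat e d"
    using T by (auto simp: d_def e_def S_def)
  have \<xi>c: "\<xi> x \<in> carrier_mat d d" and \<eta>c: "\<eta> x \<in> carrier_mat e e" for x
    using irreps_carrier[OF \<xi>] irreps_carrier[OF \<eta>] by (auto simp: d_def e_def)
  have inter': "\<eta> z * S = S * \<xi> z" for z
    unfolding S_def by (rule irreps_intertwiner_adjoint[OF \<xi> \<eta> _ inter]) (use T in \<open>simp add: d_def e_def\<close>)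
  have "\<eta> z * (S * T) = (S * T) * \<eta> z" for z
  proof -
    have "\<eta> z * (S * T) = (\<eta> z * S) * T"
      using assoc_mult_mat[OF \<eta>c S T] by simp
    also have "\<dots> = S * (\<xi> z * T)"
      unfolding inter' by (rule assoc_mult_mat[OF S \<xi>c T])
    also have "\<dots> = (S * T) * \<eta> z"
      unfolding inter using assoc_mult_mat[OF S T \<eta>c] by simp
    finally show ?thesis .
  qed
  then obtain c where c: "S * T = c \<cdot>\<^sub>m 1\<^sub>m e"
    using schur_scalar[OF \<eta>, of "S * T"] S T unfolding e_def by auto
  have "\<xi> z * (T * S) = (T * S) * \<xi> z" for z
  proof -
    have "\<xi> z * (T * S) = (\<xi> z * T) * S"
      using assoc_mult_mat[OF \<xi>c T S] by simp
    also have "\<dots> = T * (\<eta> z * S)"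
      unfolding inter by (rule assoc_mult_mat[OF T \<eta>c S])
    also have "\<dots> = (T * S) * \<xi> z"
      unfolding inter' using assoc_mult_mat[OF T S \<xi>c] by simp
    finally show ?thesis .
  qed
  then obtain c' where c': "T * S = c' \<cdot>\<^sub>m 1\<^sub>m d"
    using schur_scalar[OF \<xi>, of "T * S"] S T unfolding d_def by auto
  have il: "i < d" "l < e" using nz by (auto simp: d_def e_def)
  have "c' \<cdot>\<^sub>m T = (T * S) * T" unfolding c' using mult_smult_assoc_mat[OF one_carrier_mat T, of c'] T by simp
  also have "\<dots> = T * (S * T)" by (rule assoc_mult_mat[OF T S T])
  also have "\<dots> = c \<cdot>\<^sub>m T" unfolding c using T mult_smult_distrib[OF T one_carrier_mat] by simp
  finally have "(c' \<cdot>\<^sub>m T) $$ (i, l) = (c \<cdot>\<^sub>m T) $$ (i, l)" by simp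
  then have cc: "c' = c" using T il nz(3) by simp
  define N where "N = (\<Sum>k<d. (cmod (T $$ (k, l)))\<^sup>2)"
  have cN: "c = complex_of_real N"
  proof -
    have "c = (S * T) $$ (l, l)" using il by (simp add: c)
    also have "\<dots> = (\<Sum>k<d. cnj (T $$ (k, l)) * T $$ (k, l))"
      using S T il by (simp add: scalar_prod_def atLeast0LessThan S_def mat_adjoint_index)
    finally show ?thesis
      by (simp add: N_def complex_norm_square mult.commute del: of_real_power)
  qed
  have "0 < (cmod (T $$ (i, l)))\<^sup>2" using nz by simp
  also have "\<dots> \<le> N" unfolding N_def using il by (intro member_le_sum) auto
  finally have N: "N > 0" .
  have "of_nat e * c = (\<Sum>l<e. (S * T) $$ (l, l))" by (simp add: c)
  also have "\<dots> = (\<Sum>l<e. \<Sum>k<d. S $$ (l, k) * T $$ (k, l))"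
    using S T by (intro sum.cong refl) (simp add: scalar_prod_def atLeast0LessThan)
  also have "\<dots> = (\<Sum>k<d. \<Sum>l<e. T $$ (k, l) * S $$ (l, k))"
    by (subst sum.swap) (simp add: mult.commute)
  also have "\<dots> = (\<Sum>k<d. (T * S) $$ (k, k))"
    using S T by (intro sum.cong refl) (simp add: scalar_prod_def atLeast0LessThan)
  also have "\<dots> = of_nat d * c" by (simp add: c' cc)
  finally have "of_nat e = (of_nat d :: complex)" using cN N by simp
  then have de: "e = d" by simp
  define R where "R = complex_of_real (1 / sqrt N) \<cdot>\<^sub>m S"
  have R: "R \<in> carrier_mat d d" using S de by (simp add: R_def)
  have adjR: "mat_adjoint R = complex_of_real (1 / sqrt N) \<cdot>\<^sub>m T"
    by (simp add: R_def mat_adjoint_smult S_def)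
  have sc: "complex_of_real (1 / sqrt N) * complex_of_real (1 / sqrt N) * c = 1"
    unfolding cN of_real_mult[symmetric] using N by simp
  have "R * mat_adjoint R = (complex_of_real (1 / sqrt N) * complex_of_real (1 / sqrt N)) \<cdot>\<^sub>m (S * T)"
    unfolding adjR unfolding R_def using S T
    by (intro eq_matI) (auto simp: scalar_prod_def sum_distrib_left mult_ac)
  also have "\<dots> = 1\<^sub>m d"
    unfolding c using sc by (intro eq_matI) (auto simp: de)
  finally have R1: "R * mat_adjoint R = 1\<^sub>m d" .
  have R2: "mat_adjoint R * R = 1\<^sub>m d"
    using mat_mult_left_right_inverse[OF R _ R1] R by auto
  have "R * \<xi> x = \<eta> x * R" for x
    unfolding R_def using S \<xi>c[of x] \<eta>c[of x] inter'[of x]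
    by (simp add: mult_smult_assoc_mat[of _ e d] mult_smult_distrib[of _ e e])
  then show ?thesis
    using R R1 R2 \<xi> \<eta> de unfolding rep_equiv_def unitary_mat_def d_def e_def by auto
qed

lemma rep_equivE:
  assumes "(\<xi>, \<eta>) \<in> rep_equiv"
  obtains T where "\<xi> \<in> irreps" "\<eta> \<in> irreps" "rep_dim \<eta> = rep_dim \<xi>"
    "unitary_mat (rep_dim \<xi>) T" "\<And>x. T * \<xi> x = \<eta> x * T"
proof -
  have "\<xi> \<in> irreps" "\<eta> \<in> irreps" "rep_dim \<eta> = rep_dim \<xi>"
    and "\<exists>T. unitary_mat (rep_dim \<xi>) T \<and> (\<forall>x. T * \<xi> x = \<eta> x * T)"
    using assms by (auto simp: rep_equiv_def)
  then show ?thesis using that by blast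
qed

lemma equiv_rep_equiv: "equiv (irreps :: ('a::topological_group_add \<Rightarrow> complex mat) set) rep_equiv"
  (is "equiv ?I ?R")
proof (rule equivI)
  show "?R \<subseteq> ?I \<times> ?I" by (auto simp: rep_equiv_def)
  show "refl_on ?I ?R"
  proof (rule refl_onI)
    fix \<xi> :: "'a \<Rightarrow> complex mat" assume \<xi>: "\<xi> \<in> irreps"
    then show "(\<xi>, \<xi>) \<in> rep_equiv"
      using left_mult_one_mat[OF irreps_carrier[OF \<xi>]] right_mult_one_mat[OF irreps_carrier[OF \<xi>]]
      by (auto simp: rep_equiv_def unitary_mat_def intro!: exI[of _ "1\<^sub>m (rep_dim \<xi>)"])
  qed
  show "sym ?R"
  proof (rule symI)
    fix \<xi> \<eta> :: "'a \<Rightarrow> complex mat" assume "(\<xi>, \<eta>) \<in> rep_equiv"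
    then obtain T where \<xi>: "\<xi> \<in> irreps" and \<eta>: "\<eta> \<in> irreps" and d: "rep_dim \<eta> = rep_dim \<xi>"
      and T: "unitary_mat (rep_dim \<xi>) T" and inter: "\<And>x. T * \<xi> x = \<eta> x * T"
      by (rule rep_equivE) blast
    have "mat_adjoint T * \<eta> x = \<xi> x * mat_adjoint T" for x
      using irreps_intertwiner_adjoint[OF \<eta> \<xi>, of T x] inter unitary_mat_carrier[OF T] d by simp
    then show "(\<eta>, \<xi>) \<in> rep_equiv"
      using \<xi> \<eta> d unitary_mat_adjoint[OF T] unfolding rep_equiv_def by auto
  qed
  show "trans ?R"
  proof (rule transI)
    fix \<xi> \<eta> \<zeta> :: "'a \<Rightarrow> complex mat"
    assume 1: "(\<xi>, \<eta>) \<in> rep_equiv" and 2: "(\<eta>, \<zeta>) \<in> rep_equiv"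
    obtain T where irr: "\<xi> \<in> irreps" "\<eta> \<in> irreps" and d\<eta>: "rep_dim \<eta> = rep_dim \<xi>"
      and T: "unitary_mat (rep_dim \<xi>) T" "\<And>x. T * \<xi> x = \<eta> x * T"
      using 1 by (rule rep_equivE) blast
    obtain S where irr': "\<zeta> \<in> irreps" and d\<zeta>: "rep_dim \<zeta> = rep_dim \<eta>"
      and S': "unitary_mat (rep_dim \<eta>) S" and S: "\<And>x. S * \<eta> x = \<zeta> x * S"
      using 2 by (rule rep_equivE) blast
    note d = d\<eta> d\<zeta>[unfolded d\<eta>]
    note S = S'[unfolded d\<eta>] S
    note irr = irr irr'
    let ?d = "rep_dim \<xi>"
    have c: "T \<in> carrier_mat ?d ?d" "S \<in> carrier_mat ?d ?d" "\<xi> x \<in> carrier_mat ?d ?d"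
      "\<eta> x \<in> carrier_mat ?d ?d" "\<zeta> x \<in> carrier_mat ?d ?d" for x
      using T S irreps_carrier[OF irr(1), of x] irreps_carrier[OF irr(2), of x] irreps_carrier[OF irr(3), of x] d
      by (auto simp: unitary_mat_def)
    have "(S * T) * \<xi> x = \<zeta> x * (S * T)" for x
    proof -
      have "(S * T) * \<xi> x = S * (T * \<xi> x)" by (rule assoc_mult_mat[OF c(2) c(1) c(3)])
      also have "\<dots> = (S * \<eta> x) * T" unfolding T(2) by (rule assoc_mult_mat[OF c(2) c(4) c(1), symmetric])
      also have "\<dots> = \<zeta> x * (S * T)" unfolding S(2) by (rule assoc_mult_mat[OF c(5) c(2) c(1)])
      finally show ?thesis .
    qed
    then show "(\<xi>, \<zeta>) \<in> rep_equiv"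
      using irr d unitary_mat_mult[OF S(1) T(1)] unfolding rep_equiv_def by auto
  qed
qed

lemma repr_in: "\<kappa> \<in> unitary_dual \<Longrightarrow> repr \<kappa> \<in> \<kappa>"
  unfolding unitary_dual_def repr_def
  using in_quotient_imp_non_empty[OF equiv_rep_equiv] by (simp add: some_in_eq)

lemma repr_irreps: "\<kappa> \<in> unitary_dual \<Longrightarrow> repr \<kappa> \<in> irreps"
  using repr_in in_quotient_imp_subset[OF equiv_rep_equiv] unfolding unitary_dual_def by blast

lemma repr_inequivalent:
  assumes "\<kappa> \<in> unitary_dual" "\<kappa>' \<in> unitary_dual" "(repr \<kappa>, repr \<kappa>') \<in> rep_equiv"
  shows "\<kappa> = \<kappa>'"
  using quotient_eq_iff[OF equiv_rep_equiv _ _ repr_in[OF assms(1)] repr_in[OF assms(2)]] assms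
  unfolding unitary_dual_def by blast

lemma ex_repr_equiv:
  assumes "\<xi> \<in> irreps"
  obtains \<kappa> where "\<kappa> \<in> unitary_dual" "(\<xi>, repr \<kappa>) \<in> rep_equiv"
proof
  show "rep_equiv `` {\<xi>} \<in> unitary_dual"
    unfolding unitary_dual_def using assms by (rule quotientI)
  from repr_in[OF this] show "(\<xi>, repr (rep_equiv `` {\<xi>})) \<in> rep_equiv" by blast
qed

context compact_haar
begin

text \<open>Translating the variable of integration by \<open>- z\<close> moves the representation matrix of \<open>z\<close> from one
  factor of the integrand to the other; the indices \<open>j\<close> and \<open>k\<close> are parameters.\<close>

lemma coefficient_intertwiner:
  assumes \<xi>: "\<xi> \<in> irreps" and \<eta>: "\<eta> \<in> irreps" and j: "j < rep_dim \<xi>" and k: "k < rep_dim \<eta>"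
  defines "T \<equiv> mat (rep_dim \<xi>) (rep_dim \<eta>) (\<lambda>(i, l). ip \<mu> (\<lambda>x. \<xi> x $$ (i, j)) (\<lambda>x. \<eta> x $$ (l, k)))"
  shows "\<xi> z * T = T * \<eta> z"
proof (rule eq_matI)
  have Tc: "T \<in> carrier_mat (rep_dim \<xi>) (rep_dim \<eta>)" by (simp add: T_def)
  note c = irreps_carrier[OF \<xi>, of z] irreps_carrier[OF \<eta>, of z] Tc
  fix i l assume "i < dim_row (T * \<eta> z)" "l < dim_col (T * \<eta> z)"
  then have i: "i < rep_dim \<xi>" and l: "l < rep_dim \<eta>" using c by auto
  have m: "(\<lambda>x. \<xi> (z + x) $$ (i, j) * cnj (\<eta> x $$ (l, k))) \<in> borel_measurable \<mu>"
    by (intro measurable_cont continuous_on_mult continuous_on_cnj irreps_cont \<eta> l k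
        translate_cont(3)[OF irreps_cont[OF \<xi> i j]])
  have "(\<xi> z * T) $$ (i, l) = (\<Sum>m<rep_dim \<xi>. \<xi> z $$ (i, m) * ip \<mu> (\<lambda>x. \<xi> x $$ (m, j)) (\<lambda>x. \<eta> x $$ (l, k)))"
    using c i l by (simp add: scalar_prod_def atLeast0LessThan) (simp add: T_def)
  also have "\<dots> = ip \<mu> (\<lambda>x. \<Sum>m<rep_dim \<xi>. \<xi> z $$ (i, m) * \<xi> x $$ (m, j)) (\<lambda>x. \<eta> x $$ (l, k))"
    using \<xi> \<eta> j k l by (intro ip_sum_left[symmetric] coefficient_sq_int) auto
  also have "\<dots> = (\<integral>x. \<xi> (z + x) $$ (i, j) * cnj (\<eta> x $$ (l, k)) \<partial>\<mu>)"
    by (simp add: ip_def irreps_add[OF \<xi> i j])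
  also have "\<dots> = (\<integral>x. \<xi> (z + (- z + x)) $$ (i, j) * cnj (\<eta> (- z + x) $$ (l, k)) \<partial>\<mu>)"
    by (rule integral_translate_left[OF m, symmetric])
  also have "\<dots> = ip \<mu> (\<lambda>x. \<xi> x $$ (i, j)) (\<lambda>x. \<Sum>m<rep_dim \<eta>. \<eta> (- z) $$ (l, m) * \<eta> x $$ (m, k))"
    by (simp add: ip_def irreps_add[OF \<eta> l k] add.assoc[symmetric])
  also have "\<dots> = (\<Sum>m<rep_dim \<eta>. cnj (\<eta> (- z) $$ (l, m)) * ip \<mu> (\<lambda>x. \<xi> x $$ (i, j)) (\<lambda>x. \<eta> x $$ (m, k)))"
    using \<xi> \<eta> i j k by (intro ip_sum_right coefficient_sq_int) auto
  also have "\<dots> = (T * \<eta> z) $$ (i, l)"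
    using c i l by (simp add: scalar_prod_def atLeast0LessThan irreps_uminus_index[OF \<eta> l])
      (simp add: T_def mult.commute)
  finally show "(\<xi> z * T) $$ (i, l) = (T * \<eta> z) $$ (i, l)" .
qed (use irreps_carrier[OF \<xi>, of z] irreps_carrier[OF \<eta>, of z] in \<open>auto simp: T_def\<close>)

lemma coefficients_orthogonal_inequivalent:
  assumes "\<xi> \<in> irreps" "\<eta> \<in> irreps" "(\<xi>, \<eta>) \<notin> rep_equiv"
    and "i < rep_dim \<xi>" "j < rep_dim \<xi>" "l < rep_dim \<eta>" "k < rep_dim \<eta>"
  shows "ip \<mu> (\<lambda>x. \<xi> x $$ (i, j)) (\<lambda>x. \<eta> x $$ (l, k)) = 0"
proof (rule ccontr)
  assume nz: "\<not> ?thesis"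
  let ?T = "mat (rep_dim \<xi>) (rep_dim \<eta>) (\<lambda>(i, l). ip \<mu> (\<lambda>x. \<xi> x $$ (i, j)) (\<lambda>x. \<eta> x $$ (l, k)))"
  have "(\<xi>, \<eta>) \<in> rep_equiv"
    by (rule schur_inequivalent[OF assms(1,2), of ?T i l])
      (use assms nz in \<open>simp_all add: coefficient_intertwiner\<close>)
  with assms(3) show False ..
qed

lemma coefficients_orthogonal_row:
  assumes \<xi>: "\<xi> \<in> irreps" and ij: "i < rep_dim \<xi>" "j < rep_dim \<xi>" and lk: "l < rep_dim \<xi>" "k < rep_dim \<xi>"
    and il: "i \<noteq> l"
  shows "ip \<mu> (\<lambda>x. \<xi> x $$ (i, j)) (\<lambda>x. \<xi> x $$ (l, k)) = 0"
proof -
  let ?T = "mat (rep_dim \<xi>) (rep_dim \<xi>) (\<lambda>(i, l). ip \<mu> (\<lambda>x. \<xi> x $$ (i, j)) (\<lambda>x. \<xi> x $$ (l, k)))"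
  obtain c where "?T = c \<cdot>\<^sub>m 1\<^sub>m (rep_dim \<xi>)"
    using schur_scalar[OF \<xi>, of ?T] coefficient_intertwiner[OF \<xi> \<xi> ij(2) lk(2)] by auto
  then have "?T $$ (i, l) = (c \<cdot>\<^sub>m 1\<^sub>m (rep_dim \<xi>)) $$ (i, l)" by simp
  then show ?thesis using ij lk il by simp
qed

text \<open>Inversion of the group interchanges the roles of rows and columns.\<close>

lemma coefficients_orthogonal:
  assumes \<xi>: "\<xi> \<in> irreps" and ij: "i < rep_dim \<xi>" "j < rep_dim \<xi>" and lk: "l < rep_dim \<xi>" "k < rep_dim \<xi>"
    and ne: "(i, j) \<noteq> (l, k)"
  shows "ip \<mu> (\<lambda>x. \<xi> x $$ (i, j)) (\<lambda>x. \<xi> x $$ (l, k)) = 0"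
proof (cases "i = l")
  case True
  then have "k \<noteq> j" using ne by auto
  have m: "(\<lambda>x. \<xi> x $$ (i, j) * cnj (\<xi> x $$ (l, k))) \<in> borel_measurable \<mu>"
    by (intro measurable_cont continuous_on_mult continuous_on_cnj irreps_cont \<xi> ij lk)
  have "ip \<mu> (\<lambda>x. \<xi> x $$ (i, j)) (\<lambda>x. \<xi> x $$ (l, k)) =
      (\<integral>x. \<xi> (- x) $$ (i, j) * cnj (\<xi> (- x) $$ (l, k)) \<partial>\<mu>)"
    unfolding ip_def by (rule integral_uminus[OF m, symmetric])
  also have "\<dots> = ip \<mu> (\<lambda>x. \<xi> x $$ (k, l)) (\<lambda>x. \<xi> x $$ (j, i))"
    by (simp add: ip_def irreps_uminus_index \<xi> ij lk mult.commute)
  also have "\<dots> = 0"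
    using \<open>k \<noteq> j\<close> by (intro coefficients_orthogonal_row \<xi> ij lk)
  finally show ?thesis .
qed (intro coefficients_orthogonal_row \<xi> ij lk)

lemma coeffs_vanish_if_repr:
  assumes f: "f \<in> sq_int \<mu>"
    and van: "\<And>\<kappa> i j. \<kappa> \<in> unitary_dual \<Longrightarrow> i < rep_dim (repr \<kappa>) \<Longrightarrow> j < rep_dim (repr \<kappa>) \<Longrightarrow>
      ip \<mu> f (\<lambda>x. repr \<kappa> x $$ (i, j)) = 0"
  shows "coeffs_vanish f"
  unfolding coeffs_vanish_def
proof (intro ballI allI impI)
  fix \<xi> :: "'a \<Rightarrow> complex mat" and i j assume \<xi>: "\<xi> \<in> irreps" "i < rep_dim \<xi>" "j < rep_dim \<xi>"
  obtain \<kappa> where \<kappa>: "\<kappa> \<in> unitary_dual" "(\<xi>, repr \<kappa>) \<in> rep_equiv" using ex_repr_equiv[OF \<xi>(1)] .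
  define \<eta> where "\<eta> = repr \<kappa>"
  define d where "d = rep_dim \<xi>"
  obtain T where T: "unitary_mat d T" "\<And>x. T * \<xi> x = \<eta> x * T" and d: "rep_dim \<eta> = d"
    using \<kappa>(2) unfolding \<eta>_def d_def by (rule rep_equivE) blast
  have \<eta>: "\<eta> \<in> irreps" unfolding \<eta>_def by (rule repr_irreps[OF \<kappa>(1)])
  have c: "T \<in> carrier_mat d d" "mat_adjoint T \<in> carrier_mat d d" "\<xi> x \<in> carrier_mat d d" "\<eta> x \<in> carrier_mat d d" for x
    using T(1) irreps_carrier[OF \<xi>(1), of x] irreps_carrier[OF \<eta>, of x] d by (auto simp: unitary_mat_def d_def)
  have eq: "\<xi> x = mat_adjoint T * (\<eta> x * T)" for x
  proof -
    have "mat_adjoint T * (\<eta> x * T) = (mat_adjoint T * T) * \<xi> x"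
      unfolding T(2)[symmetric] by (rule assoc_mult_mat[OF c(2) c(1) c(3), symmetric])
    then show ?thesis using T(1) c(3)[of x] by (simp add: unitary_mat_def)
  qed
  have "\<xi> x $$ (i, j) = (\<Sum>a<d. mat_adjoint T $$ (i, a) * (\<Sum>b<d. T $$ (b, j) * \<eta> x $$ (a, b)))" for x
    unfolding eq using c(1,2) c(3)[of x] c(4)[of x] \<xi>(2,3)
    by (simp add: scalar_prod_def atLeast0LessThan d_def[symmetric] mult.commute)
  then have "ip \<mu> f (\<lambda>x. \<xi> x $$ (i, j)) =
      (\<Sum>a<d. cnj (mat_adjoint T $$ (i, a)) * ip \<mu> f (\<lambda>x. \<Sum>b<d. T $$ (b, j) * \<eta> x $$ (a, b)))"
    using f \<eta> d by (simp only:) (intro ip_sum_right sum_sq_int coefficient_sq_int; simp)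
  also have "\<dots> = (\<Sum>a<d. cnj (mat_adjoint T $$ (i, a)) * (\<Sum>b<d. cnj (T $$ (b, j)) * ip \<mu> f (\<lambda>x. \<eta> x $$ (a, b))))"
    using f \<eta> d by (intro sum.cong refl arg_cong2[where f="(*)"] ip_sum_right coefficient_sq_int) auto
  also have "\<dots> = 0"
    using van[OF \<kappa>(1)] d by (simp add: \<eta>_def)
  finally show "ip \<mu> f (\<lambda>x. \<xi> x $$ (i, j)) = 0" .
qed

text \<open>By Parseval's identity the \<open>L\<^sup>2\<close>-norm is a monotone function of the moduli of the coefficients.\<close>

theorem nrm_le_if_coefficients_le:
  assumes f: "f \<in> sq_int \<mu>" and J: "finite J" and g: "\<And>a. a \<in> J \<Longrightarrow> g a \<in> sq_int \<mu>" and K: "K \<ge> 0"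
    and le: "\<And>\<kappa> i j. \<kappa> \<in> unitary_dual \<Longrightarrow> i < rep_dim (repr \<kappa>) \<Longrightarrow> j < rep_dim (repr \<kappa>) \<Longrightarrow>
      cmod (ip \<mu> f (\<lambda>x. repr \<kappa> x $$ (i, j))) \<le> K * (\<Sum>a\<in>J. cmod (ip \<mu> (g a) (\<lambda>x. repr \<kappa> x $$ (i, j))))"
  shows "nrm \<mu> f \<le> K * real (card J) * (\<Sum>a\<in>J. nrm \<mu> (g a))"
proof -
  define I0 where "I0 = {(\<kappa> :: ('a \<Rightarrow> complex mat) set, i, j). \<kappa> \<in> unitary_dual \<and> i < rep_dim (repr \<kappa>) \<and> j < rep_dim (repr \<kappa>)}"
  define c where "c = (\<lambda>(\<kappa>, i, j) (x :: 'a). repr \<kappa> x $$ (i, j) :: complex)"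
  \<comment> \<open>Only indices with a nonzero norm can be normalized; orthogonality to the others is automatic.\<close>
  define I where "I = {s \<in> I0. nrm \<mu> (c s) \<noteq> 0}"
  define e where "e s = (\<lambda>x. complex_of_real (1 / nrm \<mu> (c s)) * c s x)" for s
  have cq: "c s \<in> sq_int \<mu>" if "s \<in> I0" for s
    using that by (auto simp: I0_def c_def intro!: coefficient_sq_int repr_irreps)
  have orth: "ip \<mu> (c s) (c s') = 0" if "s \<in> I0" "s' \<in> I0" "s \<noteq> s'" for s s'
  proof -
    obtain \<kappa> i j \<kappa>' l k where s: "s = (\<kappa>, i, j)" "s' = (\<kappa>', l, k)" by (metis prod_cases3)
    have ir: "repr \<kappa> \<in> irreps" "repr \<kappa>' \<in> irreps" using that s by (auto simp: I0_def repr_irreps)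
    show ?thesis
    proof (cases "\<kappa> = \<kappa>'")
      case True
      then show ?thesis
        using that s ir by (simp add: c_def I0_def) (intro coefficients_orthogonal; simp)
    next
      case False
      then have "(repr \<kappa>, repr \<kappa>') \<notin> rep_equiv"
        using repr_inequivalent that s by (auto simp: I0_def)
      then show ?thesis
        using that s ir by (simp add: c_def I0_def coefficients_orthogonal_inequivalent)
    qed
  qed
  have on: "orthonormal \<mu> I e"
    unfolding orthonormal_def
  proof (intro conjI ballI)
    fix s assume s: "s \<in> I"
    then show "e s \<in> sq_int \<mu>" unfolding e_def I_def by (intro scale_sq_int cq) simp
    fix s' assume s': "s' \<in> I"
    show "ip \<mu> (e s) (e s') = (if s = s' then 1 else 0)"
    proof (cases "s = s'")
      case True
      have "ip \<mu> (e s) (e s) = 1"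
        unfolding e_def ip_scale_left ip_scale_right ip_self using s by (simp add: I_def power2_eq_square)
      with True show ?thesis by simp
    next
      case False
      then have "ip \<mu> (c s) (c s') = 0" using s s' by (intro orth) (auto simp: I_def)
      with False show ?thesis unfolding e_def ip_scale_left ip_scale_right by simp
    qed
  qed
  have complete: "nrm \<mu> h = 0" if h: "h \<in> sq_int \<mu>" and 0: "\<And>s. s \<in> I \<Longrightarrow> ip \<mu> h (e s) = 0" for h
  proof (rule peter_weyl[OF h coeffs_vanish_if_repr[OF h]])
    fix \<kappa> :: "('a \<Rightarrow> complex mat) set" and i j
    assume "\<kappa> \<in> unitary_dual" "i < rep_dim (repr \<kappa>)" "j < rep_dim (repr \<kappa>)"
    then have s: "(\<kappa>, i, j) \<in> I0" by (simp add: I0_def)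
    have "ip \<mu> h (c (\<kappa>, i, j)) = 0"
    proof (cases "nrm \<mu> (c (\<kappa>, i, j)) = 0")
      case True
      then show ?thesis using cauchy_schwarz[OF h cq[OF s]] by simp
    next
      case False
      then show ?thesis using 0[of "(\<kappa>, i, j)"] s unfolding e_def ip_scale_right by (simp add: I_def)
    qed
    then show "ip \<mu> h (\<lambda>x. repr \<kappa> x $$ (i, j)) = 0" by (simp add: c_def)
  qed
  have le_e: "cmod (ip \<mu> f (e s)) \<le> K * (\<Sum>a\<in>J. cmod (ip \<mu> (g a) (e s)))" if s: "s \<in> I" for s
  proof -
    obtain \<kappa> i j where s_eq: "s = (\<kappa>, i, j)" by (rule prod_cases3)
    have "cmod (ip \<mu> f (c s)) \<le> K * (\<Sum>a\<in>J. cmod (ip \<mu> (g a) (c s)))"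
      using le[of \<kappa> i j] s by (simp add: s_eq I_def I0_def c_def)
    then have "cmod (ip \<mu> f (c s)) / nrm \<mu> (c s) \<le> K * (\<Sum>a\<in>J. cmod (ip \<mu> (g a) (c s))) / nrm \<mu> (c s)"
      by (rule divide_right_mono) simp
    then show ?thesis
      unfolding e_def ip_scale_right by (simp add: norm_mult norm_divide flip: sum_divide_distrib)
  qed
  have "(nrm \<mu> f)\<^sup>2 \<le> K\<^sup>2 * real (card J) * (\<Sum>a\<in>J. (nrm \<mu> (g a))\<^sup>2)"
  proof (rule parseval_le[OF on complete f])
    fix \<Phi> assume \<Phi>: "finite \<Phi>" "\<Phi> \<subseteq> I"
    have "(\<Sum>s\<in>\<Phi>. (cmod (ip \<mu> f (e s)))\<^sup>2) \<le> (\<Sum>s\<in>\<Phi>. K\<^sup>2 * (real (card J) * (\<Sum>a\<in>J. (cmod (ip \<mu> (g a) (e s)))\<^sup>2)))"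
    proof (rule sum_mono)
      fix s assume "s \<in> \<Phi>"
      then have "(cmod (ip \<mu> f (e s)))\<^sup>2 \<le> (K * (\<Sum>a\<in>J. cmod (ip \<mu> (g a) (e s))))\<^sup>2"
        using \<Phi> by (intro power_mono le_e) auto
      also have "\<dots> \<le> K\<^sup>2 * (real (card J) * (\<Sum>a\<in>J. (cmod (ip \<mu> (g a) (e s)))\<^sup>2))"
        using sum_squared_le_sum_of_squares[of "\<lambda>a. cmod (ip \<mu> (g a) (e s))" J] J
        by (simp add: power_mult_distrib mult_left_mono mult.commute)
      finally show "(cmod (ip \<mu> f (e s)))\<^sup>2 \<le> K\<^sup>2 * (real (card J) * (\<Sum>a\<in>J. (cmod (ip \<mu> (g a) (e s)))\<^sup>2))" .
    qed
    also have "\<dots> = K\<^sup>2 * real (card J) * (\<Sum>a\<in>J. \<Sum>s\<in>\<Phi>. (cmod (ip \<mu> (g a) (e s)))\<^sup>2)"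
      by (subst sum.swap) (simp add: sum_distrib_left mult_ac)
    also have "\<dots> \<le> K\<^sup>2 * real (card J) * (\<Sum>a\<in>J. (nrm \<mu> (g a))\<^sup>2)"
      using \<Phi> by (intro mult_left_mono sum_mono bessel[OF orthonormal_subset[OF on]] g) auto
    finally show "(\<Sum>s\<in>\<Phi>. (cmod (ip \<mu> f (e s)))\<^sup>2) \<le> K\<^sup>2 * real (card J) * (\<Sum>a\<in>J. (nrm \<mu> (g a))\<^sup>2)" .
  qed
  also have "\<dots> \<le> K\<^sup>2 * (real (card J))\<^sup>2 * (\<Sum>a\<in>J. nrm \<mu> (g a))\<^sup>2"
  proof (intro mult_mono)
    show "real (card J) \<le> (real (card J))\<^sup>2"
      by (cases "card J = 0") (auto simp: power2_eq_square)
    show "(\<Sum>a\<in>J. (nrm \<mu> (g a))\<^sup>2) \<le> (\<Sum>a\<in>J. nrm \<mu> (g a))\<^sup>2"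
    proof -
      have "(L2_set (\<lambda>a. nrm \<mu> (g a)) J)\<^sup>2 \<le> (\<Sum>a\<in>J. nrm \<mu> (g a))\<^sup>2"
        by (intro power_mono L2_set_le_sum) auto
      then show ?thesis by (simp add: L2_set_def sum_nonneg)
    qed
  qed (auto intro: sum_nonneg)
  also have "\<dots> = (K * real (card J) * (\<Sum>a\<in>J. nrm \<mu> (g a)))\<^sup>2"
    by (simp add: power_mult_distrib)
  finally show ?thesis
    by (rule power2_le_imp_le) (intro mult_nonneg_nonneg K sum_nonneg; simp)
qed

end

section \<open>The ordinary differential equation of a single mode\<close>

text \<open>The Duhamel kernel \<open>\<integral>\<^sub>0\<^sup>t exp (- m (t - s)) exp (- s) ds\<close> of the two characteristic roots \<open>-1\<close>
  and \<open>-m\<close>.\<close>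

definition duhamel :: "real \<Rightarrow> real \<Rightarrow> real" where
  "duhamel m t = (if m = 1 then t * exp (- t) else (exp (- (m * t)) - exp (- t)) / (1 - m))"

lemma duhamel_0 [simp]: "duhamel m 0 = 0"
  by (simp add: duhamel_def)

lemma DERIV_duhamel [derivative_intros]:
  "(duhamel m has_real_derivative exp (- t) - m * duhamel m t) (at t)"
proof (cases "m = 1")
  case True
  have "((\<lambda>t. t * exp (- t)) has_real_derivative exp (- t) - t * exp (- t)) (at t)"
    by (auto intro!: derivative_eq_intros)
  with True show ?thesis by (simp add: duhamel_def[abs_def])
next
  case False
  have "((\<lambda>t. (exp (- (m * t)) - exp (- t)) / (1 - m)) has_real_derivative
      (- m * exp (- (m * t)) + exp (- t)) / (1 - m)) (at t)"
    using False by (auto intro!: derivative_eq_intros)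
  moreover have "1 - m \<noteq> 0" using False by simp
  then have "(- m * exp (- (m * t)) + exp (- t)) / (1 - m) =
      exp (- t) - m * ((exp (- (m * t)) - exp (- t)) / (1 - m))"
    by (simp add: divide_simps) (simp add: algebra_simps)
  moreover have "duhamel m = (\<lambda>t. (exp (- (m * t)) - exp (- t)) / (1 - m))"
    using False by (simp add: duhamel_def fun_eq_iff)
  ultimately show ?thesis by simp
qed

text \<open>All estimates of the kernel compare it with an explicit supersolution of \<open>K' + m K = exp (- t)\<close>.\<close>

lemma nonneg_if_supersolution:
  fixes h h' :: "real \<Rightarrow> real"
  assumes h: "\<And>s. (h has_real_derivative h' s) (at s)"
    and super: "\<And>s. s \<ge> 0 \<Longrightarrow> h' s + m * h s \<ge> 0" and h0: "h 0 \<ge> 0" and t: "t \<ge> 0"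
  shows "h t \<ge> 0"
proof -
  have "\<exists>y. ((\<lambda>s. exp (m * s) * h s) has_real_derivative y) (at s) \<and> y \<ge> 0" if "0 \<le> s" "s \<le> t" for s
  proof (intro exI conjI)
    show "((\<lambda>s. exp (m * s) * h s) has_real_derivative exp (m * s) * (h' s + m * h s)) (at s)"
      by (auto intro!: derivative_eq_intros h simp: algebra_simps)
    show "exp (m * s) * (h' s + m * h s) \<ge> 0"
      using super[OF that(1)] by simp
  qed
  from DERIV_nonneg_imp_nondecreasing[OF t this]
  have "exp (m * 0) * h 0 \<le> exp (m * t) * h t" by blast
  with h0 have "0 \<le> exp (m * t) * h t" by simp
  then show ?thesis by (simp add: zero_le_mult_iff)
qed

lemma duhamel_nonneg: "t \<ge> 0 \<Longrightarrow> duhamel m t \<ge> 0"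
  by (rule nonneg_if_supersolution[of "duhamel m" "\<lambda>s. exp (- s) - m * duhamel m s" m t, OF DERIV_duhamel]) auto

lemma duhamel_le_1:
  assumes "m \<ge> 0" "t \<ge> 0"
  shows "exp (- t) + duhamel m t \<le> 1"
proof -
  have "0 \<le> 1 - exp (- t) - duhamel m t"
  proof (rule nonneg_if_supersolution[where m=m and h="\<lambda>s. 1 - exp (- s) - duhamel m s" and
        h'="\<lambda>s. exp (- s) - (exp (- s) - m * duhamel m s)"])
    show "((\<lambda>s. 1 - exp (- s) - duhamel m s) has_real_derivative exp (- s) - (exp (- s) - m * duhamel m s)) (at s)" for s
      by (auto intro!: derivative_eq_intros)
    show "exp (- s) - (exp (- s) - m * duhamel m s) + m * (1 - exp (- s) - duhamel m s) \<ge> 0" if "s \<ge> 0" for s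
    proof -
      have "exp (- s) - (exp (- s) - m * duhamel m s) + m * (1 - exp (- s) - duhamel m s) = m * (1 - exp (- s))"
        by (simp add: algebra_simps)
      then show ?thesis using assms that by simp
    qed
  qed (use assms in auto)
  then show ?thesis by simp
qed

lemma duhamel_high_frequency:
  assumes "m \<ge> 1 / 2" "t \<ge> 0"
  shows "m * duhamel m t \<le> 2 * exp (- (t / 4))"
proof -
  have "0 \<le> 2 * exp (- (t / 4)) - m * duhamel m t"
  proof (rule nonneg_if_supersolution[where m=m and h="\<lambda>s. 2 * exp (- (s / 4)) - m * duhamel m s" and
        h'="\<lambda>s. - (1 / 2) * exp (- (s / 4)) - m * (exp (- s) - m * duhamel m s)"])
    show "((\<lambda>s. 2 * exp (- (s / 4)) - m * duhamel m s) has_real_derivative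
        - (1 / 2) * exp (- (s / 4)) - m * (exp (- s) - m * duhamel m s)) (at s)" for s
      by (auto intro!: derivative_eq_intros)
    show "- (1 / 2) * exp (- (s / 4)) - m * (exp (- s) - m * duhamel m s) +
        m * (2 * exp (- (s / 4)) - m * duhamel m s) \<ge> 0" if "s \<ge> 0" for s
    proof -
      have "m * exp (- s) \<le> m * exp (- (s / 4))"
        using assms that by (intro mult_left_mono) auto
      moreover have "0 \<le> (m - 1 / 2) * exp (- (s / 4))" using assms by simp
      moreover have "- (1 / 2) * exp (- (s / 4)) - m * (exp (- s) - m * duhamel m s) +
          m * (2 * exp (- (s / 4)) - m * duhamel m s) =
          (m - 1 / 2) * exp (- (s / 4)) + (m * exp (- (s / 4)) - m * exp (- s))"
        by (simp add: algebra_simps)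
      ultimately show ?thesis by linarith
    qed
  qed (use assms in auto)
  then show ?thesis by simp
qed

lemma duhamel_low_frequency:
  assumes "m \<le> 1 / 2" "t \<ge> 0"
  shows "duhamel m t \<le> 2 * exp (- (m * t))"
proof -
  have "0 \<le> 2 * (exp (- (m * t)) - exp (- t)) - duhamel m t"
  proof (rule nonneg_if_supersolution[where m=m and h="\<lambda>s. 2 * (exp (- (m * s)) - exp (- s)) - duhamel m s" and
        h'="\<lambda>s. 2 * (- m * exp (- (m * s)) + exp (- s)) - (exp (- s) - m * duhamel m s)"])
    show "((\<lambda>s. 2 * (exp (- (m * s)) - exp (- s)) - duhamel m s) has_real_derivative
        2 * (- m * exp (- (m * s)) + exp (- s)) - (exp (- s) - m * duhamel m s)) (at s)" for s
      by (auto intro!: derivative_eq_intros)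
    show "2 * (- m * exp (- (m * s)) + exp (- s)) - (exp (- s) - m * duhamel m s) +
        m * (2 * (exp (- (m * s)) - exp (- s)) - duhamel m s) \<ge> 0" for s
    proof -
      have "0 \<le> (1 - 2 * m) * exp (- s)" using assms by simp
      then show ?thesis by (simp add: algebra_simps)
    qed
  qed (use assms in auto)
  then have "duhamel m t \<le> 2 * (exp (- (m * t)) - exp (- t))" by simp
  also have "\<dots> \<le> 2 * exp (- (m * t))" by simp
  finally show ?thesis .
qed

lemma exp_quarter_bound:
  assumes "t \<ge> (0::real)"
  shows "exp (- (t / 4)) * (1 + t)\<^sup>2 \<le> 64"
proof -
  have "(1 + t) / 8 \<le> 1 + t / 8" by simp
  also have "\<dots> \<le> exp (t / 8)" by (rule exp_ge_add_one_self)
  finally have "(1 + t) / 8 \<le> exp (t / 8)" .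
  then have "((1 + t) / 8)\<^sup>2 \<le> (exp (t / 8))\<^sup>2"
    using assms by (intro power_mono) auto
  also have "(exp (t / 8))\<^sup>2 = exp (t / 4)"
    by (simp add: power2_eq_square flip: exp_add)
  finally have "(1 + t)\<^sup>2 \<le> 64 * exp (t / 4)" by (simp add: power_divide)
  then have "exp (- (t / 4)) * (1 + t)\<^sup>2 \<le> exp (- (t / 4)) * (64 * exp (t / 4))"
    by (intro mult_left_mono) auto
  also have "\<dots> = 64" by (simp add: exp_minus)
  finally show ?thesis .
qed

text \<open>In terms of \<open>y = m (1 + t)\<close> the kernel is bounded by a multiple of \<open>exp (- y)\<close>, which absorbs powers
  of \<open>y\<close>. Two powers are enough for all decay rates below.\<close>

lemma duhamel_low_frequency_decay:
  assumes m: "0 \<le> m" "m \<le> 1 / 2" and t: "t \<ge> 0"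
  shows "(m * (1 + t))\<^sup>2 * duhamel m t \<le> 8" "m * (1 + t) * duhamel m t \<le> 8"
proof -
  define y where "y = m * (1 + t)"
  have y: "0 \<le> y" using m t by (simp add: y_def)
  have mt: "0 \<le> m * t" using m t by simp
  have "y / 2 \<le> 1 + m * t / 2" using m by (simp add: y_def algebra_simps)
  also have "\<dots> \<le> exp (m * t / 2)" by (rule exp_ge_add_one_self)
  finally have "y / 2 \<le> exp (m * t / 2)" .
  then have "(y / 2)\<^sup>2 \<le> (exp (m * t / 2))\<^sup>2"
    using y by (intro power_mono) auto
  also have "(exp (m * t / 2))\<^sup>2 = exp (m * t)"
    by (simp add: power2_eq_square flip: exp_add)
  finally have y2: "y\<^sup>2 \<le> 4 * exp (m * t)" by (simp add: power_divide)
  have "y\<^sup>2 * duhamel m t \<le> (4 * exp (m * t)) * (2 * exp (- (m * t)))"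
    using y2 duhamel_low_frequency[OF m(2) t] duhamel_nonneg[OF t, of m]
    by (intro mult_mono) auto
  also have "\<dots> = 8" by (simp add: exp_minus)
  finally show *: "(m * (1 + t))\<^sup>2 * duhamel m t \<le> 8" by (simp add: y_def)
  have K: "duhamel m t \<le> 1" "0 \<le> duhamel m t"
    using duhamel_le_1[OF m(1) t] duhamel_nonneg[OF t, of m] exp_gt_zero[of "- t"] by linarith+
  show "m * (1 + t) * duhamel m t \<le> 8"
  proof (cases "y \<le> 1")
    case True
    have "y * duhamel m t \<le> 1 * 1" using True K y by (intro mult_mono) auto
    then show ?thesis by (simp add: y_def)
  next
    case False
    then have "y \<le> y\<^sup>2" by (simp add: power2_eq_square)
    then have "y * duhamel m t \<le> y\<^sup>2 * duhamel m t" using K by (intro mult_right_mono)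
    with * show ?thesis by (simp add: y_def)
  qed
qed

lemma duhamel_high_frequency_decay:
  assumes "m \<ge> 1 / 2" "t \<ge> 0"
  shows "m * duhamel m t * (1 + t)\<^sup>2 \<le> 128"
proof -
  have "m * duhamel m t * (1 + t)\<^sup>2 \<le> 2 * exp (- (t / 4)) * (1 + t)\<^sup>2"
    using duhamel_high_frequency[OF assms] by (intro mult_right_mono) auto
  also have "\<dots> = 2 * (exp (- (t / 4)) * (1 + t)\<^sup>2)" by simp
  also have "\<dots> \<le> 2 * 64" using exp_quarter_bound[OF assms(2)] by (intro mult_left_mono) auto
  also have "\<dots> = 128" by simp
  finally show ?thesis .
qed

lemma exp_decay_powr:
  assumes "t \<ge> (0::real)" "a \<le> 2"
  shows "exp (- t) \<le> 64 * (1 + t) powr (- a)"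
proof -
  have "exp (- t) * (1 + t)\<^sup>2 \<le> exp (- (t / 4)) * (1 + t)\<^sup>2"
    using assms by (intro mult_right_mono) auto
  also note exp_quarter_bound[OF assms(1)]
  finally have "exp (- t) \<le> 64 / (1 + t)\<^sup>2"
    using assms by (simp add: pos_le_divide_eq)
  also have "\<dots> = 64 * (1 + t) powr (- 2)"
    using assms by (simp add: powr_minus powr_realpow divide_inverse)
  also have "\<dots> \<le> 64 * (1 + t) powr (- a)"
    using assms by (intro mult_left_mono powr_mono) auto
  finally show ?thesis .
qed

text \<open>In the last estimate the factor \<open>1 + s\<close> pays for large
  frequencies, for which \<open>s m K\<close> is only bounded by \<open>s\<close> times a decaying exponential.\<close>

lemma duhamel_decay:
  assumes s: "s \<ge> 0" and t: "t \<ge> 0"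
  shows "s\<^sup>2 * duhamel (s\<^sup>2) t \<le> 128 * (1 + t) powr (- 1)"
    "s * duhamel (s\<^sup>2) t \<le> 12 * (1 + t) powr (- 1 / 2)"
    "s * (s\<^sup>2 * duhamel (s\<^sup>2) t) \<le> 128 * (1 + t) powr (- 3 / 2) * (1 + s)"
proof -
  define m where "m = s\<^sup>2"
  define K where "K = duhamel m t"
  define \<tau> where "\<tau> = 1 + t"
  have m: "0 \<le> m" by (simp add: m_def)
  have \<tau>: "1 \<le> \<tau>" using t by (simp add: \<tau>_def)
  have K: "0 \<le> K" "K \<le> 1"
    using duhamel_le_1[OF m t] duhamel_nonneg[OF t, of m] exp_gt_zero[of "- t"]
    unfolding K_def by linarith+
  have rate1: "m * K * \<tau> \<le> 128"
  proof (cases "m \<le> 1 / 2")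
    case True
    then show ?thesis
      using duhamel_low_frequency_decay(2)[OF m True t] by (simp add: K_def \<tau>_def mult_ac)
  next
    case False
    have "m * K * \<tau> \<le> m * K * \<tau>\<^sup>2"
      using \<tau> m K by (intro mult_left_mono) (auto simp: power2_eq_square)
    also have "\<dots> \<le> 128"
      using duhamel_high_frequency_decay[of m t] False t by (simp add: K_def \<tau>_def)
    finally show ?thesis .
  qed
  have "m * K \<le> 128 / \<tau>" using rate1 \<tau> by (simp add: pos_le_divide_eq)
  then show "s\<^sup>2 * duhamel (s\<^sup>2) t \<le> 128 * (1 + t) powr (- 1)"
    using \<tau> by (simp add: m_def K_def \<tau>_def powr_minus divide_inverse)
  have half: "(\<tau> powr (- 1 / 2))\<^sup>2 = 1 / \<tau>" "(\<tau> powr (- 3 / 2))\<^sup>2 = 1 / \<tau> ^ 3"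
  proof -
    have sq: "(\<tau> powr x)\<^sup>2 = \<tau> powr (x + x)" for x
      by (simp only: power2_eq_square powr_add)
    have "\<tau> powr (- 1) = 1 / \<tau>" "\<tau> powr (- 3) = 1 / \<tau> ^ 3"
      using \<tau> by (simp_all add: powr_minus_divide)
    then show "(\<tau> powr (- 1 / 2))\<^sup>2 = 1 / \<tau>" "(\<tau> powr (- 3 / 2))\<^sup>2 = 1 / \<tau> ^ 3"
      by (simp_all add: sq)
  qed
  have "(s * K)\<^sup>2 \<le> (12 * \<tau> powr (- 1 / 2))\<^sup>2"
  proof -
    have "(s * K)\<^sup>2 = (m * K) * K" by (simp add: m_def power2_eq_square mult_ac)
    also have "\<dots> \<le> (m * K) * 1" using m K by (intro mult_left_mono) auto
    also have "\<dots> \<le> 144 / \<tau>" using rate1 \<tau> by (simp add: pos_le_divide_eq)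
    also have "\<dots> = (12 * \<tau> powr (- 1 / 2))\<^sup>2"
      by (simp only: power_mult_distrib half) simp
    finally show ?thesis .
  qed
  then show "s * duhamel (s\<^sup>2) t \<le> 12 * (1 + t) powr (- 1 / 2)"
    unfolding K_def m_def \<tau>_def by (rule power2_le_imp_le) simp
  show "s * (s\<^sup>2 * duhamel (s\<^sup>2) t) \<le> 128 * (1 + t) powr (- 3 / 2) * (1 + s)"
  proof (cases "m \<le> 1 / 2")
    case True
    have "((m * \<tau>)\<^sup>2 * K) * (m * \<tau> * K) \<le> 8 * 8"
      using duhamel_low_frequency_decay[OF m True t] m K \<tau>
      by (intro mult_mono) (auto simp: K_def \<tau>_def)
    then have "(s * (m * K))\<^sup>2 * \<tau> ^ 3 \<le> 64"
      by (simp add: m_def power2_eq_square power3_eq_cube mult_ac)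
    then have "(s * (m * K))\<^sup>2 \<le> 64 * (1 / \<tau> ^ 3)"
      using \<tau> by (simp add: pos_le_divide_eq)
    then have "(s * (m * K))\<^sup>2 \<le> (8 * \<tau> powr (- 3 / 2))\<^sup>2"
      by (simp only: power_mult_distrib half) simp
    then have "s * (m * K) \<le> 8 * \<tau> powr (- 3 / 2)" by (rule power2_le_imp_le) simp
    also have "\<dots> \<le> (128 * (1 + s)) * \<tau> powr (- 3 / 2)"
      using s by (intro mult_right_mono) auto
    also have "\<dots> = 128 * \<tau> powr (- 3 / 2) * (1 + s)" by simp
    finally show ?thesis by (simp add: K_def m_def \<tau>_def)
  next
    case False
    have "m * K \<le> 128 / \<tau>\<^sup>2"
      using duhamel_high_frequency_decay[of m t] False t \<tau>
      by (simp add: K_def \<tau>_def pos_le_divide_eq)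
    also have "\<dots> = 128 * \<tau> powr (- 2)"
      using \<tau> by (simp add: powr_minus powr_realpow divide_inverse)
    also have "\<dots> \<le> 128 * \<tau> powr (- 3 / 2)"
      using \<tau> by (intro mult_left_mono powr_mono) auto
    finally have "s * (m * K) \<le> s * (128 * \<tau> powr (- 3 / 2))"
      using s by (intro mult_left_mono)
    also have "\<dots> \<le> 128 * \<tau> powr (- 3 / 2) * (1 + s)"
      by (simp add: algebra_simps)
    finally show ?thesis by (simp add: K_def m_def \<tau>_def)
  qed
qed

lemma constant_if_zero_derivative:
  fixes f :: "real \<Rightarrow> 'b::banach"
  assumes c: "continuous_on {0..} f" and d: "\<And>t. t > 0 \<Longrightarrow> (f has_vector_derivative 0) (at t)"
    and t: "t \<ge> 0"
  shows "f t = f 0"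
proof (rule has_derivative_zero_unique_strong_interval[of "{0}" 0 t f "f 0" t])
  show "continuous_on {0..t} f" using c by (rule continuous_on_subset) auto
  show "(f has_derivative (\<lambda>h. 0)) (at x within {0..t})" if "x \<in> {0..t} - {0}" for x
    using d[of x] that has_derivative_at_withinI by (auto simp: has_vector_derivative_def)
qed (use t in auto)

text \<open>The equation factors as \<open>(\<partial> + 1)(\<partial> + m) v = 0\<close>.\<close>

lemma mode_solution:
  fixes v v' :: "real \<Rightarrow> complex"
  assumes v: "\<And>t. t \<ge> 0 \<Longrightarrow> (v has_vector_derivative v' t) (at t within {0..})"
    and v'c: "continuous_on {0..} v'"
    and ode: "\<And>t. t > 0 \<Longrightarrow> \<exists>w. (v' has_vector_derivative w) (at t) \<and>
        w + (1 + complex_of_real m) * v' t + complex_of_real m * v t = 0"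
    and t: "t \<ge> 0"
  shows "v t = of_real (exp (- t) + duhamel m t) * v 0 + of_real (duhamel m t) * v' 0"
    "v' t = of_real (- m * duhamel m t) * v 0 + of_real (exp (- t) - m * duhamel m t) * v' 0"
proof -
  have vc: "continuous_on {0..} v"
    using v by (intro continuous_on_vector_derivative) auto
  have v_at: "(v has_vector_derivative v' t) (at t)" if "t > 0" for t
    using v[of t] that by (simp add: at_within_interior[of t "{0..}"])
  define c where "c = v' 0 + of_real m * v 0"
  have first: "v' t + of_real m * v t = of_real (exp (- t)) * c" if "t \<ge> 0" for t
  proof -
    define f where "f t = exp t *\<^sub>R (v' t + of_real m * v t)" for t
    have "f t = f 0"
    proof (rule constant_if_zero_derivative[OF _ _ that])
      show "continuous_on {0..} f"
        unfolding f_def by (intro continuous_intros vc v'c)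
      fix t :: real assume t: "t > 0"
      obtain w where w: "(v' has_vector_derivative w) (at t)"
        "w + (1 + of_real m) * v' t + of_real m * v t = 0"
        using ode[OF t] by blast
      have "(f has_vector_derivative exp t *\<^sub>R (w + of_real m * v' t) + exp t *\<^sub>R (v' t + of_real m * v t)) (at t)"
        unfolding f_def
        by (intro has_vector_derivative_scaleR has_vector_derivative_add has_vector_derivative_mult_right w v_at t DERIV_exp)
      moreover have "w + of_real m * v' t + (v' t + of_real m * v t) = 0"
        using w(2) by (simp add: algebra_simps)
      then have "exp t *\<^sub>R (w + of_real m * v' t) + exp t *\<^sub>R (v' t + of_real m * v t) = 0"
        unfolding scaleR_add_right[symmetric] by simp
      ultimately show "(f has_vector_derivative 0) (at t)" by simp
    qed
    then have "f t = c" by (simp add: f_def c_def)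
    moreover have "v' t + of_real m * v t = exp (- t) *\<^sub>R f t" by (simp add: f_def exp_minus)
    ultimately show ?thesis by (simp add: scaleR_conv_of_real)
  qed
  have second: "v t = of_real (exp (- (m * t))) * v 0 + of_real (duhamel m t) * c"
  proof -
    define g where "g t = exp (m * t) *\<^sub>R (v t - duhamel m t *\<^sub>R c)" for t
    have dk: "((\<lambda>t. duhamel m t) has_real_derivative exp (- t) - m * duhamel m t) (at t)" for t
      by (rule DERIV_duhamel)
    have "continuous_on {0..} (\<lambda>t. duhamel m t)"
      using dk by (intro continuous_at_imp_continuous_on) (blast intro: DERIV_isCont)
    then have gc: "continuous_on {0..} g"
      unfolding g_def by (intro continuous_intros vc)
    have "g t = g 0"
    proof (rule constant_if_zero_derivative[OF gc _ t])
      fix t :: real assume t: "t > 0"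
      have de: "((\<lambda>t. exp (m * t)) has_real_derivative exp (m * t) * m) (at t)"
        by (auto intro!: derivative_eq_intros)
      have "(g has_vector_derivative
          exp (m * t) *\<^sub>R (v' t - (exp (- t) - m * duhamel m t) *\<^sub>R c) + (exp (m * t) * m) *\<^sub>R (v t - duhamel m t *\<^sub>R c)) (at t)"
        unfolding g_def
        using has_vector_derivative_scaleR[OF dk[of t] has_vector_derivative_const[of c "at t"]]
        by (intro has_vector_derivative_scaleR has_vector_derivative_diff v_at t de) simp
      moreover have "exp (m * t) *\<^sub>R (v' t - (exp (- t) - m * duhamel m t) *\<^sub>R c) +
          (exp (m * t) * m) *\<^sub>R (v t - duhamel m t *\<^sub>R c) =
          of_real (exp (m * t)) * (v' t + of_real m * v t - of_real (exp (- t)) * c)"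
        by (simp add: scaleR_conv_of_real algebra_simps)
      ultimately show "(g has_vector_derivative 0) (at t)" using first[of t] t by simp
    qed
    then have "g t = v 0" by (simp add: g_def)
    moreover have "v t - duhamel m t *\<^sub>R c = exp (- (m * t)) *\<^sub>R g t" by (simp add: g_def exp_minus)
    ultimately have "v t - duhamel m t *\<^sub>R c = of_real (exp (- (m * t))) * v 0"
      by (simp add: scaleR_conv_of_real)
    then show ?thesis by (simp add: scaleR_conv_of_real algebra_simps)
  qed
  have E: "exp (- (m * t)) = exp (- t) + (1 - m) * duhamel m t"
    by (simp add: duhamel_def)
  show *: "v t = of_real (exp (- t) + duhamel m t) * v 0 + of_real (duhamel m t) * v' 0"
    unfolding second E c_def by (simp add: algebra_simps)
  have "v' t = of_real (exp (- t)) * c - of_real m * v t"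
    using first[OF t] by (simp add: algebra_simps)
  then show "v' t = of_real (- m * duhamel m t) * v 0 + of_real (exp (- t) - m * duhamel m t) * v' 0"
    unfolding * c_def by (simp add: algebra_simps)
qed

text \<open>With the solution formula it remains to insert the decay rates: \<open>K\<close> itself is only bounded, and each
  factor \<open>s\<close> in front of \<open>K\<close> contributes half a power of \<open>1 + t\<close>.\<close>

lemma mode_bounds:
  fixes v v' :: "real \<Rightarrow> complex"
  assumes s: "s \<ge> 0"
    and v: "\<And>t. t \<ge> 0 \<Longrightarrow> (v has_vector_derivative v' t) (at t within {0..})"
    and v'c: "continuous_on {0..} v'"
    and ode: "\<And>t. t > 0 \<Longrightarrow> \<exists>w. (v' has_vector_derivative w) (at t) \<and>
        w + (1 + complex_of_real (s\<^sup>2)) * v' t + complex_of_real (s\<^sup>2) * v t = 0"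
    and t: "t \<ge> 0"
  shows "cmod (v t) \<le> cmod (v 0) + cmod (v' 0)"
    "s * cmod (v t) \<le> 64 * (1 + t) powr (- 1 / 2) * (cmod (v 0) + s * cmod (v 0) + cmod (v' 0))"
    "cmod (v' t) \<le> 192 * (1 + t) powr (- 1) * (cmod (v 0) + cmod (v' 0))"
    "s * cmod (v' t) \<le> 192 * (1 + t) powr (- 3 / 2) *
       (cmod (v 0) + s * cmod (v 0) + cmod (v' 0) + s * cmod (v' 0))"
proof -
  define K where "K = duhamel (s\<^sup>2) t"
  define \<epsilon> where "\<epsilon> = exp (- t)"
  define a where "a = cmod (v 0)"
  define b where "b = cmod (v' 0)"
  have ab: "0 \<le> a" "0 \<le> b" by (simp_all add: a_def b_def)
  have \<epsilon>: "0 \<le> \<epsilon>" by (simp add: \<epsilon>_def)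
  have K: "0 \<le> K" "\<epsilon> + K \<le> 1"
    using duhamel_nonneg[OF t] duhamel_le_1[OF _ t, of "s\<^sup>2"] by (simp_all add: K_def \<epsilon>_def)
  have vt: "cmod (v t) \<le> (\<epsilon> + K) * a + K * b"
  proof -
    have "v t = of_real (\<epsilon> + K) * v 0 + of_real K * v' 0"
      unfolding K_def \<epsilon>_def by (rule mode_solution(1)[OF v v'c ode t])
    then have "cmod (v t) \<le> cmod (of_real (\<epsilon> + K) * v 0) + cmod (of_real K * v' 0)"
      by (metis norm_triangle_ineq)
    then show ?thesis using K \<epsilon> by (simp only: norm_mult norm_of_real a_def b_def abs_of_nonneg add_nonneg_nonneg)
  qed
  have v't: "cmod (v' t) \<le> s\<^sup>2 * K * a + (\<epsilon> + s\<^sup>2 * K) * b"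
  proof -
    have "v' t = of_real (- s\<^sup>2 * K) * v 0 + of_real (\<epsilon> - s\<^sup>2 * K) * v' 0"
      unfolding K_def \<epsilon>_def by (rule mode_solution(2)[OF v v'c ode t])
    then have "cmod (v' t) \<le> cmod (of_real (- s\<^sup>2 * K) * v 0) + cmod (of_real (\<epsilon> - s\<^sup>2 * K) * v' 0)"
      by (metis norm_triangle_ineq)
    also have "\<dots> = s\<^sup>2 * K * a + \<bar>\<epsilon> - s\<^sup>2 * K\<bar> * b"
      using K by (simp only: norm_mult norm_of_real a_def b_def) (simp add: abs_mult)
    also have "\<dots> \<le> s\<^sup>2 * K * a + (\<epsilon> + s\<^sup>2 * K) * b"
      using \<epsilon> K ab by (intro add_left_mono mult_right_mono abs_leI) auto
    finally show ?thesis .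
  qed
  have p: "0 \<le> (1 + t) powr x" for x by simp
  have "(\<epsilon> + K) * a + K * b \<le> 1 * a + 1 * b"
    using K \<epsilon> ab by (intro add_mono mult_right_mono) auto
  with vt show "cmod (v t) \<le> cmod (v 0) + cmod (v' 0)" by (simp add: a_def b_def)
  show "s * cmod (v t) \<le> 64 * (1 + t) powr (- 1 / 2) * (cmod (v 0) + s * cmod (v 0) + cmod (v' 0))"
  proof -
    define P where "P = (1 + t) powr (- 1 / 2)"
    have e: "\<epsilon> \<le> 64 * P" using exp_decay_powr[OF t, of "1 / 2"] by (simp add: \<epsilon>_def P_def)
    have k: "s * K \<le> 64 * P" using duhamel_decay(2)[OF s t] p[of "- 1 / 2"] unfolding K_def P_def by linarith
    have "s * cmod (v t) \<le> s * ((\<epsilon> + K) * a + K * b)" using vt s by (rule mult_left_mono)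
    also have "\<dots> = \<epsilon> * (s * a) + (s * K) * a + (s * K) * b" by (simp add: algebra_simps)
    also have "\<dots> \<le> 64 * P * (s * a) + 64 * P * a + 64 * P * b"
      using e k s ab by (intro add_mono mult_right_mono) auto
    finally show ?thesis by (simp add: P_def a_def b_def algebra_simps)
  qed
  show "cmod (v' t) \<le> 192 * (1 + t) powr (- 1) * (cmod (v 0) + cmod (v' 0))"
  proof -
    define P where "P = (1 + t) powr (- 1)"
    have e: "\<epsilon> \<le> 64 * P" using exp_decay_powr[OF t, of 1] by (simp add: \<epsilon>_def P_def)
    have k: "s\<^sup>2 * K \<le> 128 * P" using duhamel_decay(1)[OF s t] by (simp add: K_def P_def)
    have P: "0 \<le> P" by (simp add: P_def)
    have "s\<^sup>2 * K * a + (\<epsilon> + s\<^sup>2 * K) * b \<le> 192 * P * a + 192 * P * b"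
      using e k ab P by (intro add_mono mult_right_mono) linarith+
    from order_trans[OF v't this] show ?thesis by (simp only: P_def a_def b_def distrib_left)
  qed
  show "s * cmod (v' t) \<le> 192 * (1 + t) powr (- 3 / 2) *
       (cmod (v 0) + s * cmod (v 0) + cmod (v' 0) + s * cmod (v' 0))"
  proof -
    define P where "P = (1 + t) powr (- 3 / 2)"
    have P: "0 \<le> P" by (simp add: P_def)
    have e: "\<epsilon> \<le> 64 * P" using exp_decay_powr[OF t, of "3 / 2"] by (simp add: \<epsilon>_def P_def)
    have k: "s * (s\<^sup>2 * K) \<le> 128 * P * (1 + s)" using duhamel_decay(3)[OF s t] by (simp add: K_def P_def)
    have "s * cmod (v' t) \<le> s * (s\<^sup>2 * K * a + (\<epsilon> + s\<^sup>2 * K) * b)" using v't s by (rule mult_left_mono)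
    also have "\<dots> = (s * (s\<^sup>2 * K)) * a + (s * (s\<^sup>2 * K)) * b + \<epsilon> * (s * b)" by (simp add: algebra_simps)
    also have "\<dots> \<le> 128 * P * (1 + s) * a + 128 * P * (1 + s) * b + 64 * P * (s * b)"
      using e k s ab by (intro add_mono mult_right_mono) auto
    also have "\<dots> = 192 * P * (a + s * a + b + s * b) - 64 * (P * a) - 64 * (P * (s * a)) - 64 * (P * b)"
      by (simp add: algebra_simps)
    also have "\<dots> \<le> 192 * P * (a + s * a + b + s * b)"
      using P s ab mult_nonneg_nonneg[OF P ab(1)] mult_nonneg_nonneg[OF P ab(2)]
        mult_nonneg_nonneg[OF P mult_nonneg_nonneg[OF s ab(1)]] by linarith
    finally show ?thesis by (simp add: P_def a_def b_def)
  qed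
qed

section \<open>The damped wave equation on a compact group\<close>

lemma L2_eq_sq_int: "L2 G = sq_int (haar G)"
  by (simp add: L2_def sq_int_def)

lemma L2_norm_eq_nrm: "L2_norm G f = nrm (haar G) f"
  by (simp add: L2_norm_def nrm_def)

lemma fourier_eq_ip:
  assumes "\<xi> \<in> irreps" "k < rep_dim \<xi>" "l < rep_dim \<xi>"
  shows "fourier G f \<xi> $$ (k, l) = ip (haar G) f (\<lambda>x. \<xi> x $$ (l, k))"
proof -
  have "mat_adjoint (\<xi> x) $$ (k, l) = cnj (\<xi> x $$ (l, k))" for x
    using irreps_carrier[OF assms(1), of x] assms by (intro mat_adjoint_index) auto
  then show ?thesis using assms by (simp add: fourier_def ip_def)
qed

lemma powr_one_abs: "(x::real) powr 1 = \<bar>x\<bar>"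
proof (cases "x \<ge> 0")
  case False
  then have "exp (ln (- x)) = - x" by (intro exp_ln) simp
  with False show ?thesis by (simp add: powr_def ln_minus)
qed simp

locale compact_haar_data = compact_haar "haar G" for G :: "('a::{topological_group_add, t2_space, second_countable_topology}) lie_data"
begin

abbreviation coeff :: "('a \<Rightarrow> complex mat) set \<Rightarrow> nat \<Rightarrow> nat \<Rightarrow> ('a \<Rightarrow> complex) \<Rightarrow> complex" where
  "coeff \<kappa> i j f \<equiv> ip (haar G) f (\<lambda>x. repr \<kappa> x $$ (i, j))"

abbreviation freq :: "('a \<Rightarrow> complex mat) set \<Rightarrow> real" where
  "freq \<kappa> \<equiv> \<bar>lap_root G (repr \<kappa>)\<bar>"

definition index :: "('a \<Rightarrow> complex mat) set \<Rightarrow> nat \<Rightarrow> nat \<Rightarrow> bool" where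
  "index \<kappa> i j \<longleftrightarrow> \<kappa> \<in> unitary_dual \<and> i < rep_dim (repr \<kappa>) \<and> j < rep_dim (repr \<kappa>)"

lemma index_sq_int: "index \<kappa> i j \<Longrightarrow> (\<lambda>x. repr \<kappa> x $$ (i, j)) \<in> sq_int (haar G)"
  unfolding index_def by (elim conjE) (intro coefficient_sq_int repr_irreps)

lemma nrm_le_if_coeffs_le_list:
  assumes f: "f \<in> sq_int (haar G)" and g: "set gs \<subseteq> sq_int (haar G)" and K: "K \<ge> 0"
    and le: "\<And>\<kappa> i j. index \<kappa> i j \<Longrightarrow> cmod (coeff \<kappa> i j f) \<le> K * (\<Sum>g\<leftarrow>gs. cmod (coeff \<kappa> i j g))"
  shows "nrm (haar G) f \<le> K * real (length gs) * (\<Sum>g\<leftarrow>gs. nrm (haar G) g)"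
proof -
  have "nrm (haar G) f \<le> K * real (card {..<length gs}) * (\<Sum>a<length gs. nrm (haar G) (gs ! a))"
  proof (rule nrm_le_if_coefficients_le[OF f _ _ K])
    show "gs ! a \<in> sq_int (haar G)" if "a \<in> {..<length gs}" for a
      using that g by auto
    show "cmod (coeff \<kappa> i j f) \<le> K * (\<Sum>a<length gs. cmod (coeff \<kappa> i j (gs ! a)))"
      if "\<kappa> \<in> unitary_dual" "i < rep_dim (repr \<kappa>)" "j < rep_dim (repr \<kappa>)" for \<kappa> i j
      using le[of \<kappa> i j] that by (simp add: index_def sum_list_sum_nth atLeast0LessThan)
  qed simp
  then show ?thesis by (simp add: sum_list_sum_nth atLeast0LessThan)
qed

lemma nrm_eq_if_coeffs_eq:
  assumes f: "f \<in> sq_int (haar G)" and g: "g \<in> sq_int (haar G)"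
    and eq: "\<And>\<kappa> i j. index \<kappa> i j \<Longrightarrow> coeff \<kappa> i j f = coeff \<kappa> i j g"
  shows "nrm (haar G) f = nrm (haar G) g"
proof -
  have "nrm (haar G) (\<lambda>x. f x - g x) \<le> 0"
    using nrm_le_if_coeffs_le_list[OF diff_sq_int[OF f g], of "[]" 0] eq
    by (simp add: ip_diff_left[OF f g index_sq_int])
  then have "nrm (haar G) (\<lambda>x. f x - g x) = 0" by (simp add: antisym)
  then show ?thesis
    using nrm_le_add_diff[OF f g] nrm_le_add_diff[OF g f] nrm_minus_commute[of "haar G" f g] by simp
qed

lemma is_frac_lap_iff_coeff:
  "is_frac_lap G 1 f h \<longleftrightarrow> h \<in> sq_int (haar G) \<and>
     (\<forall>\<kappa> i j. index \<kappa> i j \<longrightarrow> coeff \<kappa> i j h = of_real (freq \<kappa>) * coeff \<kappa> i j f)"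
proof -
  have "fourier G h (repr \<kappa>) = complex_of_real (lap_root G (repr \<kappa>) powr 1) \<cdot>\<^sub>m fourier G f (repr \<kappa>) \<longleftrightarrow>
      (\<forall>i j. index \<kappa> i j \<longrightarrow> coeff \<kappa> i j h = of_real (freq \<kappa>) * coeff \<kappa> i j f)"
    if \<kappa>: "\<kappa> \<in> unitary_dual" for \<kappa>
  proof -
    have dims: "dim_row (fourier G f (repr \<kappa>)) = rep_dim (repr \<kappa>)" "dim_col (fourier G f (repr \<kappa>)) = rep_dim (repr \<kappa>)" for f
      by (simp_all add: fourier_def)
    show ?thesis
      unfolding mat_eq_iff
      using \<kappa> by (auto simp: dims fourier_eq_ip[OF repr_irreps[OF \<kappa>]] index_def powr_one_abs)
  qed
  then show ?thesis
    unfolding is_frac_lap_def L2_eq_sq_int by (auto simp: index_def)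
qed

lemma sobolev_sq_int: "f \<in> sobolev G 1 \<Longrightarrow> f \<in> sq_int (haar G)"
  by (simp add: sobolev_def L2_eq_sq_int)

lemma frac_lap:
  assumes "f \<in> sobolev G 1"
  shows "frac_lap G 1 f \<in> sq_int (haar G)"
    "index \<kappa> i j \<Longrightarrow> coeff \<kappa> i j (frac_lap G 1 f) = of_real (freq \<kappa>) * coeff \<kappa> i j f"
proof -
  have "is_frac_lap G 1 f (frac_lap G 1 f)"
    unfolding frac_lap_def using assms by (intro someI_ex[of "is_frac_lap G 1 f"]) (simp add: sobolev_def)
  then show "frac_lap G 1 f \<in> sq_int (haar G)"
    "index \<kappa> i j \<Longrightarrow> coeff \<kappa> i j (frac_lap G 1 f) = of_real (freq \<kappa>) * coeff \<kappa> i j f"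
    by (simp_all add: is_frac_lap_iff_coeff)
qed

lemma nrm_le_sobolev_norm: "nrm (haar G) f \<le> sobolev_norm G 1 f"
  by (simp add: sobolev_norm_def L2_norm_eq_nrm)

text \<open>Although \<^const>\<open>frac_lap\<close> chooses a representative, it is linear up to null sets.\<close>

lemma nrm_frac_lap_increment:
  assumes f: "f \<in> sobolev G 1" and g: "g \<in> sobolev G 1" and h: "h \<in> sobolev G 1"
  shows "nrm (haar G) (\<lambda>x. frac_lap G 1 f x - frac_lap G 1 g x - c * frac_lap G 1 h x) \<le>
    sobolev_norm G 1 (\<lambda>x. f x - g x - c * h x)"
proof -
  let ?d = "\<lambda>x. f x - g x - c * h x"
  let ?F = "\<lambda>x. frac_lap G 1 f x - frac_lap G 1 g x - c * frac_lap G 1 h x"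
  note sq = f[THEN sobolev_sq_int] g[THEN sobolev_sq_int] h[THEN sobolev_sq_int]
    f[THEN frac_lap(1)] g[THEN frac_lap(1)] h[THEN frac_lap(1)]
  have F: "?F \<in> sq_int (haar G)" and d: "?d \<in> sq_int (haar G)"
    by (intro diff_sq_int scale_sq_int sq)+
  have coef: "coeff \<kappa> i j ?F = of_real (freq \<kappa>) * coeff \<kappa> i j ?d" if "index \<kappa> i j" for \<kappa> i j
    using f g h that
    by (simp add: ip_diff_left diff_sq_int scale_sq_int frac_lap sobolev_sq_int index_sq_int
        ip_scale_left right_diff_distrib)
  have "is_frac_lap G 1 ?d ?F"
    unfolding is_frac_lap_iff_coeff using F coef by blast
  then have "?d \<in> sobolev G 1"
    using d unfolding sobolev_def L2_eq_sq_int by blast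
  then have "nrm (haar G) ?F = nrm (haar G) (frac_lap G 1 ?d)"
    by (intro nrm_eq_if_coeffs_eq F) (simp_all add: frac_lap coef)
  then show ?thesis by (simp add: sobolev_norm_def L2_norm_eq_nrm)
qed

text \<open>A coefficient is a continuous functional for every norm that dominates the \<open>L\<^sup>2\<close>-norm, so it maps
  derivatives of curves to derivatives.\<close>

lemma coeff_has_vector_derivative:
  assumes deriv: "has_curve_deriv N f w t" and t: "t \<ge> 0"
    and f: "\<And>s. s \<ge> 0 \<Longrightarrow> f s \<in> sq_int (haar G)" and w: "w \<in> sq_int (haar G)"
    and N: "\<And>h. nrm (haar G) h \<le> N h" and e: "e \<in> sq_int (haar G)"
  shows "((\<lambda>s. ip (haar G) (f s) e) has_vector_derivative ip (haar G) w e) (at t within {0..})"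
  unfolding has_vector_derivative_def has_derivative_within
proof
  show "bounded_linear (\<lambda>x. x *\<^sub>R ip (haar G) w e)" by (rule bounded_linear_scaleR_left)
  let ?D = "\<lambda>s x. f s x - f t x - complex_of_real (s - t) * w x"
  show "((\<lambda>s. (1 / norm (s - t)) *\<^sub>R (ip (haar G) (f s) e - (ip (haar G) (f t) e + (s - t) *\<^sub>R ip (haar G) w e)))
      \<longlongrightarrow> 0) (at t within {0..})"
  proof (rule Lim_null_comparison)
    show "((\<lambda>s. N (?D s) / \<bar>s - t\<bar> * nrm (haar G) e) \<longlongrightarrow> 0) (at t within {0..})"
      using deriv unfolding has_curve_deriv_def by (rule tendsto_mult_left_zero)
    have "norm ((1 / norm (s - t)) *\<^sub>R (ip (haar G) (f s) e - (ip (haar G) (f t) e + (s - t) *\<^sub>R ip (haar G) w e))) \<le>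
        N (?D s) / \<bar>s - t\<bar> * nrm (haar G) e" if s: "s \<ge> 0" for s
    proof -
      have "ip (haar G) (f s) e - (ip (haar G) (f t) e + (s - t) *\<^sub>R ip (haar G) w e) = ip (haar G) (?D s) e"
        using f[OF s] f[OF t] w e
        by (simp add: ip_diff_left diff_sq_int scale_sq_int ip_scale_left scaleR_conv_of_real)
      also have "cmod \<dots> \<le> nrm (haar G) (?D s) * nrm (haar G) e"
        using f[OF s] f[OF t] w e by (intro cauchy_schwarz diff_sq_int scale_sq_int)
      also have "\<dots> \<le> N (?D s) * nrm (haar G) e" by (intro mult_right_mono N) simp
      finally show ?thesis by (simp add: divide_right_mono)
    qed
    then show "\<forall>\<^sub>F s in at t within {0..}. norm ((1 / norm (s - t)) *\<^sub>R
        (ip (haar G) (f s) e - (ip (haar G) (f t) e + (s - t) *\<^sub>R ip (haar G) w e))) \<le>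
        N (?D s) / \<bar>s - t\<bar> * nrm (haar G) e"
      by (simp add: eventually_at_filter)
  qed
qed

lemma half_line_vector_derivative_unique:
  fixes f :: "real \<Rightarrow> complex"
  assumes "t \<ge> 0" "(f has_vector_derivative a) (at t within {0..})" "(f has_vector_derivative b) (at t within {0..})"
  shows "a = b"
proof (rule vector_derivative_unique_within[OF _ assms(2,3)])
  have "at_right t \<le> at t within {0..}"
    using assms(1) by (intro at_le) auto
  then show "at t within {0..} \<noteq> bot"
    using trivial_limit_at_right_real[of t] by (metis bot.extremum_uniqueI)
qed

text \<open>Fourier coefficients only satisfy the equation for \<open>t > 0\<close>. The \<open>C\<^sup>1\<close>-regularity of the curve makes the
  derivative of each coefficient continuous up to \<open>t = 0\<close>, which connects the equation to the initial
  data.\<close>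

lemma solution_coeff_bounds:
  assumes u0: "u0 \<in> sobolev G 1" and u1: "u1 \<in> sobolev G 1"
    and u: "\<And>t. t \<ge> 0 \<Longrightarrow> u t \<in> sobolev G 1" and u': "\<And>t. t \<ge> 0 \<Longrightarrow> u' t \<in> sobolev G 1"
    and deriv: "\<And>t. t \<ge> 0 \<Longrightarrow> has_curve_deriv (sobolev_norm G 1) u (u' t) t"
    and cont: "\<And>t. t \<ge> 0 \<Longrightarrow> ((\<lambda>s. sobolev_norm G 1 (\<lambda>x. u' s x - u' t x)) \<longlongrightarrow> 0) (at t within {0..})"
    and sol: "cauchy_solution G u0 u1 u"
    and ij: "index \<kappa> i j" and t: "t \<ge> 0"
  defines "s \<equiv> freq \<kappa>" and "a \<equiv> cmod (coeff \<kappa> i j u0)" and "b \<equiv> cmod (coeff \<kappa> i j u1)"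
  shows "cmod (coeff \<kappa> i j (u t)) \<le> a + b"
    "s * cmod (coeff \<kappa> i j (u t)) \<le> 64 * (1 + t) powr (- 1 / 2) * (a + s * a + b)"
    "cmod (coeff \<kappa> i j (u' t)) \<le> 192 * (1 + t) powr (- 1) * (a + b)"
    "s * cmod (coeff \<kappa> i j (u' t)) \<le> 192 * (1 + t) powr (- 3 / 2) * (a + s * a + b + s * b)"
proof -
  have \<kappa>: "\<kappa> \<in> unitary_dual" "i < rep_dim (repr \<kappa>)" "j < rep_dim (repr \<kappa>)" using ij by (auto simp: index_def)
  have e: "(\<lambda>x. repr \<kappa> x $$ (i, j)) \<in> sq_int (haar G)" by (rule index_sq_int[OF ij])
  define v where "v t = coeff \<kappa> i j (u t)" for t
  define v' where "v' t = coeff \<kappa> i j (u' t)" for t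
  have dv: "(v has_vector_derivative v' t) (at t within {0..})" if "t \<ge> 0" for t
    unfolding v_def v'_def
    by (rule coeff_has_vector_derivative[OF deriv[OF that] that _ _ nrm_le_sobolev_norm e])
      (use u u' that sobolev_sq_int in auto)
  have v'c: "continuous_on {0..} v'"
    unfolding continuous_on_def
  proof
    fix t :: real assume "t \<in> {0..}"
    then have t: "t \<ge> 0" by simp
    show "(v' \<longlongrightarrow> v' t) (at t within {0..})"
    proof (rule Lim_null[THEN iffD2], rule Lim_null_comparison)
      show "((\<lambda>s. sobolev_norm G 1 (\<lambda>x. u' s x - u' t x) * nrm (haar G) (\<lambda>x. repr \<kappa> x $$ (i, j))) \<longlongrightarrow> 0) (at t within {0..})"
        by (rule tendsto_mult_left_zero[OF cont[OF t]])
      have "cmod (v' s - v' t) \<le> sobolev_norm G 1 (\<lambda>x. u' s x - u' t x) * nrm (haar G) (\<lambda>x. repr \<kappa> x $$ (i, j))"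
        if s: "s \<ge> 0" for s
      proof -
        have "v' s - v' t = coeff \<kappa> i j (\<lambda>x. u' s x - u' t x)"
          unfolding v'_def using u'[OF s] u'[OF t] e by (simp add: ip_diff_left sobolev_sq_int)
        also have "cmod \<dots> \<le> nrm (haar G) (\<lambda>x. u' s x - u' t x) * nrm (haar G) (\<lambda>x. repr \<kappa> x $$ (i, j))"
          by (intro cauchy_schwarz[OF diff_sq_int e] sobolev_sq_int u' s t)
        also have "\<dots> \<le> sobolev_norm G 1 (\<lambda>x. u' s x - u' t x) * nrm (haar G) (\<lambda>x. repr \<kappa> x $$ (i, j))"
          by (intro mult_right_mono nrm_le_sobolev_norm) simp
        finally show ?thesis .
      qed
      then show "\<forall>\<^sub>F s in at t within {0..}. norm (v' s - v' t) \<le>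
          sobolev_norm G 1 (\<lambda>x. u' s x - u' t x) * nrm (haar G) (\<lambda>x. repr \<kappa> x $$ (i, j))"
        by (simp add: eventually_at_filter)
    qed
  qed
  \<comment> \<open>The entry \<open>(j, i)\<close> of a Fourier coefficient is the inner product with the matrix coefficient \<open>(i, j)\<close>.\<close>
  have entry: "fourier G f (repr \<kappa>) $$ (j, i) = coeff \<kappa> i j f" for f
    by (rule fourier_eq_ip[OF repr_irreps[OF \<kappa>(1)] \<kappa>(3,2)])
  have m: "(lap_root G (repr \<kappa>))\<^sup>2 = s\<^sup>2" by (simp add: s_def)
  from sol \<kappa> have v0: "v 0 = coeff \<kappa> i j u0"
    and "\<exists>w. (\<forall>t\<ge>0. (v has_vector_derivative w t) (at t within {0..})) \<and> w 0 = coeff \<kappa> i j u1 \<and>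
      (\<forall>t>0. \<exists>w'. (w has_vector_derivative w') (at t) \<and>
        w' + (1 + complex_of_real (s\<^sup>2)) * w t + complex_of_real (s\<^sup>2) * v t = 0)"
    unfolding cauchy_solution_def Let_def m[symmetric] v_def[abs_def] entry[symmetric] by blast+
  then obtain w where w: "\<And>t. t \<ge> 0 \<Longrightarrow> (v has_vector_derivative w t) (at t within {0..})" "w 0 = coeff \<kappa> i j u1"
    "\<And>t. t > 0 \<Longrightarrow> \<exists>w'. (w has_vector_derivative w') (at t) \<and>
        w' + (1 + complex_of_real (s\<^sup>2)) * w t + complex_of_real (s\<^sup>2) * v t = 0"
    by blast
  have wv': "w t = v' t" if "t \<ge> 0" for t
    using half_line_vector_derivative_unique[OF that w(1)[OF that] dv[OF that]] .
  have v'0: "v' 0 = coeff \<kappa> i j u1" using wv'[of 0] w(2) by simp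
  have ode: "\<exists>w'. (v' has_vector_derivative w') (at t) \<and>
      w' + (1 + complex_of_real (s\<^sup>2)) * v' t + complex_of_real (s\<^sup>2) * v t = 0" if t: "t > 0" for t
  proof -
    obtain w' where w': "(w has_vector_derivative w') (at t)"
      "w' + (1 + complex_of_real (s\<^sup>2)) * w t + complex_of_real (s\<^sup>2) * v t = 0"
      using w(3)[OF t] by blast
    have "(v' has_vector_derivative w') (at t)"
      by (rule has_vector_derivative_transform_within_open[OF w'(1), of "{0<..}"]) (use t wv' in auto)
    with w'(2) wv'[of t] t show ?thesis by auto
  qed
  show "cmod (coeff \<kappa> i j (u t)) \<le> a + b"
    "s * cmod (coeff \<kappa> i j (u t)) \<le> 64 * (1 + t) powr (- 1 / 2) * (a + s * a + b)"
    "cmod (coeff \<kappa> i j (u' t)) \<le> 192 * (1 + t) powr (- 1) * (a + b)"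
    "s * cmod (coeff \<kappa> i j (u' t)) \<le> 192 * (1 + t) powr (- 3 / 2) * (a + s * a + b + s * b)"
    using mode_bounds[of s v v' t, OF _ dv v'c ode t] v0 v'0
    by (simp_all add: v_def v'_def a_def b_def s_def)
qed

end

theorem theorem1p1:
  fixes G :: "('a::{topological_group_add, t2_space, second_countable_topology}) lie_data"
  assumes "compact_lie_group G"
    and "bi_invariant_metric G"
    and "normalized_haar (haar G)"
  shows "\<exists>C>0. \<forall>u0 u1 u.
    u0 \<in> sobolev G 1 \<and> u1 \<in> sobolev G 1 \<and>
    C1_curve (sobolev G 1) (sobolev_norm G 1) u \<and>
    cauchy_solution G u0 u1 u \<longrightarrow>
    (\<forall>t\<ge>0.
      L2_norm G (u t) \<le> C * (L2_norm G u0 + L2_norm G u1) \<and>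
      L2_norm G (frac_lap G 1 (u t)) \<le>
        C * (1 + t) powr (- 1 / 2) * (sobolev_norm G 1 u0 + L2_norm G u1) \<and>
      L2_norm G (curve_deriv (sobolev G 1) (sobolev_norm G 1) u t) \<le>
        C * (1 + t) powr (- 1) * (sobolev_norm G 1 u0 + L2_norm G u1) \<and>
      L2_norm G (curve_deriv (L2 G) (L2_norm G) (\<lambda>s. frac_lap G 1 (u s)) t) \<le>
        C * (1 + t) powr (- 3 / 2) * (sobolev_norm G 1 u0 + sobolev_norm G 1 u1))"
proof -
  have "compact (UNIV :: 'a set)"
    using assms(1) unfolding compact_lie_group_def by (rule conjunct1)
  then interpret compact_haar_data G
    using assms(3) by (intro compact_haar_data.intro compact_haar.intro)
  let ?n = "nrm (haar G)"
  show ?thesis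
  \<comment> \<open>The constant 192 of the mode bounds times the number of functions on the right-hand side, at most
    four, in the comparison of norms.\<close>
  proof (intro exI[of _ 768] conjI allI impI; (elim conjE)?)
    fix u0 u1 u and t :: real
    assume u0: "u0 \<in> sobolev G 1" and u1: "u1 \<in> sobolev G 1"
      and C1: "C1_curve (sobolev G 1) (sobolev_norm G 1) u" and sol: "cauchy_solution G u0 u1 u"
      and t: "t \<ge> 0"
    obtain u' where u: "\<And>t. t \<ge> 0 \<Longrightarrow> u t \<in> sobolev G 1" and u': "\<And>t. t \<ge> 0 \<Longrightarrow> u' t \<in> sobolev G 1"
      and deriv: "\<And>t. t \<ge> 0 \<Longrightarrow> has_curve_deriv (sobolev_norm G 1) u (u' t) t"
      and cont: "\<And>t. t \<ge> 0 \<Longrightarrow> ((\<lambda>s. sobolev_norm G 1 (\<lambda>x. u' s x - u' t x)) \<longlongrightarrow> 0) (at t within {0..})"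
      using C1 unfolding C1_curve_def by blast
    have bounds:
      "cmod (coeff \<kappa> i j (u t)) \<le> cmod (coeff \<kappa> i j u0) + cmod (coeff \<kappa> i j u1)"
      "freq \<kappa> * cmod (coeff \<kappa> i j (u t)) \<le> 64 * (1 + t) powr (- 1 / 2) *
         (cmod (coeff \<kappa> i j u0) + freq \<kappa> * cmod (coeff \<kappa> i j u0) + cmod (coeff \<kappa> i j u1))"
      "cmod (coeff \<kappa> i j (u' t)) \<le> 192 * (1 + t) powr (- 1) * (cmod (coeff \<kappa> i j u0) + cmod (coeff \<kappa> i j u1))"
      "freq \<kappa> * cmod (coeff \<kappa> i j (u' t)) \<le> 192 * (1 + t) powr (- 3 / 2) *
         (cmod (coeff \<kappa> i j u0) + freq \<kappa> * cmod (coeff \<kappa> i j u0) +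
          cmod (coeff \<kappa> i j u1) + freq \<kappa> * cmod (coeff \<kappa> i j u1))"
      if "index \<kappa> i j" for \<kappa> i j
      by (rule solution_coeff_bounds[OF u0 u1 u u' deriv cont sol that t]; assumption)+
    have sq: "u0 \<in> sq_int (haar G)" "u1 \<in> sq_int (haar G)" "frac_lap G 1 u0 \<in> sq_int (haar G)"
      "frac_lap G 1 u1 \<in> sq_int (haar G)" "u t \<in> sq_int (haar G)" "frac_lap G 1 (u t) \<in> sq_int (haar G)"
      using u0 u1 u[OF t] by (simp_all add: sobolev_sq_int frac_lap)
    have fl: "cmod (coeff \<kappa> i j (frac_lap G 1 f)) = freq \<kappa> * cmod (coeff \<kappa> i j f)"
      if "index \<kappa> i j" "f \<in> sobolev G 1" for \<kappa> i j f
      using that by (simp add: frac_lap norm_mult)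
    have n0: "0 \<le> ?n f" for f by simp
    have P: "0 \<le> (1 + t) powr x" for x by simp

    have "?n (u t) \<le> 1 * real (length [u0, u1]) * (\<Sum>g\<leftarrow>[u0, u1]. ?n g)"
      using bounds(1) sq by (intro nrm_le_if_coeffs_le_list) auto
    also have "\<dots> \<le> 768 * (?n u0 + ?n u1)"
      using n0[of u0] n0[of u1] by simp
    finally show "L2_norm G (u t) \<le> 768 * (L2_norm G u0 + L2_norm G u1)"
      by (simp add: L2_norm_eq_nrm)

    have "?n (frac_lap G 1 (u t)) \<le> (64 * (1 + t) powr (- 1 / 2)) *
        real (length [u0, frac_lap G 1 u0, u1]) * (\<Sum>g\<leftarrow>[u0, frac_lap G 1 u0, u1]. ?n g)"
    proof (rule nrm_le_if_coeffs_le_list)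
      fix \<kappa> i j assume ij: "index \<kappa> i j"
      show "cmod (coeff \<kappa> i j (frac_lap G 1 (u t))) \<le> 64 * (1 + t) powr (- 1 / 2) *
          (\<Sum>g\<leftarrow>[u0, frac_lap G 1 u0, u1]. cmod (coeff \<kappa> i j g))"
        using bounds(2)[OF ij] fl[OF ij u[OF t]] fl[OF ij u0] by (simp add: add.assoc)
    qed (use sq in auto)
    also have "\<dots> = 192 * ((1 + t) powr (- 1 / 2) * (sobolev_norm G 1 u0 + ?n u1))"
      by (simp add: sobolev_norm_def L2_norm_eq_nrm add.assoc)
    also have "\<dots> \<le> 768 * ((1 + t) powr (- 1 / 2) * (sobolev_norm G 1 u0 + ?n u1))"
      by (intro mult_right_mono mult_nonneg_nonneg P add_nonneg_nonneg)
        (simp_all add: sobolev_norm_def L2_norm_eq_nrm)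
    finally show "L2_norm G (frac_lap G 1 (u t)) \<le>
        768 * (1 + t) powr (- 1 / 2) * (sobolev_norm G 1 u0 + L2_norm G u1)"
      by (simp add: L2_norm_eq_nrm mult.assoc)

    define d where "d = curve_deriv (sobolev G 1) (sobolev_norm G 1) u t"
    have "\<exists>v. v \<in> sobolev G 1 \<and> has_curve_deriv (sobolev_norm G 1) u v t"
      using u'[OF t] deriv[OF t] by blast
    then have d: "d \<in> sobolev G 1" "has_curve_deriv (sobolev_norm G 1) u d t"
      unfolding d_def curve_deriv_def by (rule someI2_ex, simp)+
    have d_coeff: "coeff \<kappa> i j d = coeff \<kappa> i j (u' t)" if ij: "index \<kappa> i j" for \<kappa> i j
      by (rule half_line_vector_derivative_unique[OF t];
          rule coeff_has_vector_derivative[where N="sobolev_norm G 1"])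
        (use d deriv[OF t] t u u' ij in \<open>auto intro: sobolev_sq_int nrm_le_sobolev_norm index_sq_int\<close>)
    have "?n d \<le> (192 * (1 + t) powr (- 1)) * real (length [u0, u1]) * (\<Sum>g\<leftarrow>[u0, u1]. ?n g)"
      using bounds(3) sq d d_coeff by (intro nrm_le_if_coeffs_le_list) (auto intro: sobolev_sq_int)
    also have "\<dots> = 384 * ((1 + t) powr (- 1) * (?n u0 + ?n u1))"
      by simp
    also have "\<dots> \<le> 768 * ((1 + t) powr (- 1) * (sobolev_norm G 1 u0 + ?n u1))"
      by (intro mult_mono mult_left_mono add_right_mono nrm_le_sobolev_norm mult_nonneg_nonneg P add_nonneg_nonneg) simp_all
    finally show "L2_norm G (curve_deriv (sobolev G 1) (sobolev_norm G 1) u t) \<le>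
        768 * (1 + t) powr (- 1) * (sobolev_norm G 1 u0 + L2_norm G u1)"
      by (simp add: L2_norm_eq_nrm mult.assoc d_def)

    define q where "q = curve_deriv (L2 G) (L2_norm G) (\<lambda>s. frac_lap G 1 (u s)) t"
    have q_ex: "has_curve_deriv (L2_norm G) (\<lambda>s. frac_lap G 1 (u s)) (frac_lap G 1 (u' t)) t"
      unfolding has_curve_deriv_def
    proof (rule Lim_null_comparison)
      show "((\<lambda>s. sobolev_norm G 1 (\<lambda>x. u s x - u t x - complex_of_real (s - t) * u' t x) / \<bar>s - t\<bar>) \<longlongrightarrow> 0) (at t within {0..})"
        using deriv[OF t] by (simp add: has_curve_deriv_def)
      show "\<forall>\<^sub>F s in at t within {0..}. norm (L2_norm G (\<lambda>x. frac_lap G 1 (u s) x - frac_lap G 1 (u t) x -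
          complex_of_real (s - t) * frac_lap G 1 (u' t) x) / \<bar>s - t\<bar>) \<le>
          sobolev_norm G 1 (\<lambda>x. u s x - u t x - complex_of_real (s - t) * u' t x) / \<bar>s - t\<bar>"
        unfolding eventually_at_filter
        by (intro always_eventually allI impI)
          (use nrm_frac_lap_increment[OF u u[OF t] u'[OF t]] in \<open>simp add: L2_norm_eq_nrm divide_right_mono\<close>)
    qed
    then have "\<exists>v. v \<in> L2 G \<and> has_curve_deriv (L2_norm G) (\<lambda>s. frac_lap G 1 (u s)) v t"
      using frac_lap(1)[OF u'[OF t]] by (auto simp: L2_eq_sq_int)
    then have q: "q \<in> sq_int (haar G)" "has_curve_deriv (L2_norm G) (\<lambda>s. frac_lap G 1 (u s)) q t"
      unfolding q_def curve_deriv_def L2_eq_sq_int by (rule someI2_ex, simp)+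
    have q_coeff: "coeff \<kappa> i j q = coeff \<kappa> i j (frac_lap G 1 (u' t))" if ij: "index \<kappa> i j" for \<kappa> i j
      by (rule half_line_vector_derivative_unique[OF t];
          rule coeff_has_vector_derivative[where N="L2_norm G" and f="\<lambda>s. frac_lap G 1 (u s)"])
        (use q q_ex t u u' ij in \<open>auto intro: frac_lap index_sq_int simp: L2_norm_eq_nrm\<close>)
    have "?n q \<le> (192 * (1 + t) powr (- 3 / 2)) * real (length [u0, frac_lap G 1 u0, u1, frac_lap G 1 u1]) *
        (\<Sum>g\<leftarrow>[u0, frac_lap G 1 u0, u1, frac_lap G 1 u1]. ?n g)"
    proof (rule nrm_le_if_coeffs_le_list)
      fix \<kappa> i j assume ij: "index \<kappa> i j"
      show "cmod (coeff \<kappa> i j q) \<le> 192 * (1 + t) powr (- 3 / 2) *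
          (\<Sum>g\<leftarrow>[u0, frac_lap G 1 u0, u1, frac_lap G 1 u1]. cmod (coeff \<kappa> i j g))"
        using bounds(4)[OF ij] fl[OF ij u'[OF t]] fl[OF ij u0] fl[OF ij u1] q_coeff[OF ij]
        by (simp add: add.assoc)
    qed (use sq q in auto)
    also have "\<dots> = 768 * ((1 + t) powr (- 3 / 2) * (sobolev_norm G 1 u0 + sobolev_norm G 1 u1))"
      by (simp add: sobolev_norm_def L2_norm_eq_nrm add.assoc)
    finally show "L2_norm G (curve_deriv (L2 G) (L2_norm G) (\<lambda>s. frac_lap G 1 (u s)) t) \<le>
        768 * (1 + t) powr (- 3 / 2) * (sobolev_norm G 1 u0 + sobolev_norm G 1 u1)"
      by (simp add: L2_norm_eq_nrm mult.assoc q_def)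
  qed simp
qed

end
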